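(* Let $H_A,H_B$ be finite-dimensional Hilbert spaces and let $\Phi:B(H_A)\to B(H_B)$ be a positive, trace-preserving linear map whose adjoint $\Phi^*$ (with respect to the Hilbert–Schmidt inner product) satisfies the Schwarz-type inequality $$\Phi^{*}(\rho^{*})\,\Phi^{*}(\sigma)^{-1}\,\Phi^{*}(\rho)\le \Phi^{*}(\rho^{*}\sigma^{-1}\rho)$$ for every $\rho\in B(H_B)$ and every positive definite $\sigma\in B(H_B)$. Let $f:(0,\infty)\to\mathbb{R}$ be operator anti-monotone (i.e., $0<A\le B$ implies $f(A)\ge f(B)$ for positive definite matrices of every size). Then for all positive semidefinite $X,Y\in B(H_A)$, $$\tilde{Q}_{f}(X\|Y)\ge \tilde{Q}_{f}(\Phi(X)\|\Phi(Y)).$$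
   Context: Let $f:(0,\infty)\to\mathbb{R}$. For a finite-dimensional Hilbert space $H_S$, let $H_{\hat S}$ be an isomorphic copy, fix orthonormal bases $\{|i\rangle_S\}$, $\{|i\rangle_{\hat S}\}$, and set $|\Gamma\rangle_{S\hat S}=\sum_i |i\rangle_S|i\rangle_{\hat S}$. For positive semidefinite $X$ on $H_S$ let $|\phi^X\rangle_{S\hat S}=(X^{1/2}\otimes I_{\hat S})|\Gamma\rangle_{S\hat S}$. For positive definite $Z,\tau$ on $H_S$ define $$\tilde{Q}_f(X\|Z;\tau)=\langle\phi^X|\, f(\tau^{-1}\otimes Z^{T})\,|\phi^X\rangle,$$ where $Z^T$ is the transpose with respect to $\{|i\rangle_{\hat S}\}$. Equivalently, $\tilde{Q}_f(X\|Z;\tau)=\langle X^{1/2}, f(\Delta(Z,\tau))(X^{1/2})\rangle$, where $\Delta(Z,\tau)(W)=ZW\tau^{-1}$ on $B(H_S)$ with inner product $\langle A,B\rangle=\operatorname{tr}(A^*B)$. For positive semidefinite $X,Y$ on $H_S$, the optimized quantum $f$-divergence is $$\tilde{Q}_f(X\|Y)=\sup_{\tau>0,\ \operatorname{tr}(\tau)\le 1,\ \epsilon>0}\tilde{Q}_f(X\|Y+\epsilon\Pi_Y^{\perp};\tau),$$ where $\Pi_Y^\perp$ is the projection onto the kernel of $Y$. *)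

theory Defs
  imports "Jordan_Normal_Form.Gauss_Jordan_Elimination" "HOL-Library.Extended_Real"
begin

text \<open>Complex matrices (Jordan_Normal_Form), dimension carried at runtime.
  B(H) for dim H = n is the set carrier_mat n n of complex n x n matrices.\<close>

definition mtrace :: "complex mat \<Rightarrow> complex" where
  "mtrace A = (\<Sum>i<dim_row A. A $$ (i,i))"

definition dag :: "complex mat \<Rightarrow> complex mat" where
  "dag A = Matrix.mat (dim_col A) (dim_row A) (\<lambda>(i,j). cnj (A $$ (j,i)))"

definition cinner :: "complex vec \<Rightarrow> complex vec \<Rightarrow> complex" where
  "cinner v w = (\<Sum>i<dim_vec v. cnj (v $ i) * w $ i)"

definition hermitian :: "nat \<Rightarrow> complex mat \<Rightarrow> bool" where
  "hermitian n A \<longleftrightarrow> A \<in> carrier_mat n n \<and> dag A = A"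

definition psd :: "nat \<Rightarrow> complex mat \<Rightarrow> bool" where
  "psd n A \<longleftrightarrow> hermitian n A \<and>
     (\<forall>v \<in> carrier_vec n. 0 \<le> Re (cinner v (A *\<^sub>v v)))"

definition pd :: "nat \<Rightarrow> complex mat \<Rightarrow> bool" where
  "pd n A \<longleftrightarrow> hermitian n A \<and>
     (\<forall>v \<in> carrier_vec n. v \<noteq> 0\<^sub>v n \<longrightarrow> 0 < Re (cinner v (A *\<^sub>v v)))"

definition loewner_le :: "nat \<Rightarrow> complex mat \<Rightarrow> complex mat \<Rightarrow> bool" where
  "loewner_le n A B \<longleftrightarrow> A \<in> carrier_mat n n \<and> B \<in> carrier_mat n n \<and> psd n (B - A)"

definition unitary :: "nat \<Rightarrow> complex mat \<Rightarrow> bool" where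
  "unitary n U \<longleftrightarrow> U \<in> carrier_mat n n \<and> dag U * U = 1\<^sub>m n"

definition matfun :: "(real \<Rightarrow> real) \<Rightarrow> complex mat \<Rightarrow> complex mat" where
  "matfun f A = (let n = dim_row A;
     (U, d) = (SOME (U, d). unitary n U \<and>
                  A = U * mat_diag n (\<lambda>i. complex_of_real (d i)) * dag U)
   in U * mat_diag n (\<lambda>i. complex_of_real (f (d i))) * dag U)"

definition sqrtm :: "complex mat \<Rightarrow> complex mat" where
  "sqrtm A = matfun sqrt A"

definition minv :: "complex mat \<Rightarrow> complex mat" where
  "minv A = the (mat_inverse A)"

definition kron :: "complex mat \<Rightarrow> complex mat \<Rightarrow> complex mat" where
  "kron A B = Matrix.mat (dim_row A * dim_row B) (dim_col A * dim_col B)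
     (\<lambda>(i,j). A $$ (i div dim_row B, j div dim_col B) * B $$ (i mod dim_row B, j mod dim_col B))"

text \<open>Unnormalized maximally entangled vector |Gamma> = sum_i |i>|i>.\<close>
definition Gamma :: "nat \<Rightarrow> complex vec" where
  "Gamma n = vec (n * n) (\<lambda>k. if k div n = k mod n then 1 else 0)"

definition phivec :: "complex mat \<Rightarrow> complex vec" where
  "phivec X = kron (sqrtm X) (1\<^sub>m (dim_row X)) *\<^sub>v Gamma (dim_row X)"

definition Qtau :: "(real \<Rightarrow> real) \<Rightarrow> complex mat \<Rightarrow> complex mat \<Rightarrow> complex mat \<Rightarrow> real" where
  "Qtau f X Z \<tau> = Re (cinner (phivec X) (matfun f (kron (minv \<tau>) (transpose_mat Z)) *\<^sub>v phivec X))"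

definition kerproj :: "complex mat \<Rightarrow> complex mat" where
  "kerproj Y = (SOME P. let n = dim_row Y in P \<in> carrier_mat n n \<and> dag P = P \<and> P * P = P \<and>
      (\<forall>v \<in> carrier_vec n. P *\<^sub>v v = v \<longleftrightarrow> Y *\<^sub>v v = 0\<^sub>v n))"

text \<open>Optimized quantum f-divergence (as an extended real, the supremum may be infinite).\<close>
definition Qopt :: "(real \<Rightarrow> real) \<Rightarrow> complex mat \<Rightarrow> complex mat \<Rightarrow> ereal" where
  "Qopt f X Y = (let n = dim_row X in
     SUP p \<in> {(\<tau>, \<epsilon>). pd n \<tau> \<and> Re (mtrace \<tau>) \<le> 1 \<and> (\<epsilon>::real) > 0}.
       ereal (Qtau f X (Y + complex_of_real (snd p) \<cdot>\<^sub>m kerproj Y) (fst p)))"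

definition operator_antimonotone :: "(real \<Rightarrow> real) \<Rightarrow> bool" where
  "operator_antimonotone f \<longleftrightarrow> (\<forall>k A B. pd k A \<and> loewner_le k A B \<longrightarrow>
      loewner_le k (matfun f B) (matfun f A))"

end

theory Submission
  imports Defs "Jordan_Normal_Form.Spectral_Radius"
begin

text \<open>Let \<open>B = \<Phi> X\<close>, \<open>\<tau>\<close> a state on the output space, \<open>R\<close> the pseudo-inverse of
  \<open>sqrtm B\<close> and \<open>H = sqrtm X\<close>. The linear map \<open>T W = H * \<Phi>adj (R * W)\<close> is a Hilbert--Schmidt
  contraction by the Schwarz inequality and sends \<open>sqrtm B\<close> to \<open>H\<close>, without losing norm because
  \<open>\<Phi>\<close> preserves the trace. For \<open>\<omega> = H * \<Phi>adj (R * \<tau> * R) * H\<close>, whose trace is at most that of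
  \<open>\<tau>\<close>, the Schwarz inequality gives
  \<open>dag T * (minv \<omega> \<otimes> Z\<^sup>T) * T \<le> minv \<tau> \<otimes> (\<Phi> Z)\<^sup>T\<close>, and the operator Jensen inequality for
  contractions converts this into the comparison of the two divergences. Singular \<open>X\<close>, \<open>\<Phi> X\<close>,
  \<open>Y\<close> are dealt with by adding small multiples of the identity to \<open>\<omega>\<close> and of the kernel projection
  to \<open>Y\<close>; together with the slack in the Jensen inequality, this costs a factor \<open>r > 1\<close> on the
  right-hand side, which disappears as \<open>r \<rightarrow> 1\<close> because \<open>f\<close> is right continuous.\<close>

subsection \<open>Matrix algebra\<close>

text \<open>The state \<omega> is the image of \<tau> under the Petz recovery map of
  \<open>\<Phi>\<close> at \<open>X\<close>. Since the divergence is a supremum over states, one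
  such \<omega> for each \<tau> suffices. Its trace is computed by adjointness: with
  \<open>P\<close> the support projection of \<open>B\<close>, it equals the trace of
  \<open>\<tau> * P\<close>. Jensen's inequality for contractions normally needs a sign condition on
  the function at 0, while f may blow up there. Only one vector is tested here, and \<open>T\<close>
  preserves its norm; this replaces the condition. The slack in the Jensen inequality is forced by
  its proof: a block-diagonal majorant of a positive definite matrix cannot keep the same corner
  unless the off-diagonal blocks vanish, so the corner has to be raised by some
  \<open>c > 0\<close>. Right continuity is not part of anti-monotonicity. It is extracted from the
  Jensen inequality itself, applied to an isometry from dimension one into dimension two.\<close>

lemma mult_assoc_dim:
  "dim_col A = dim_row B \<Longrightarrow> dim_col B = dim_row C \<Longrightarrow>
   (A * B) * C = A * (B * (C :: complex mat))"
  by (rule assoc_mult_mat[of _ "dim_row A" "dim_col A" _ "dim_col B" _ "dim_col C"]) auto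

lemma mult_vec_assoc_dim:
  "dim_col A = dim_row B \<Longrightarrow> dim_col B = dim_vec v \<Longrightarrow>
   (A * B) *\<^sub>v v = A *\<^sub>v (B *\<^sub>v (v :: complex vec))"
  by (rule assoc_mult_mat_vec[OF carrier_matI carrier_matI carrier_vecI]) simp_all

lemma mult_add_left_dim:
  "dim_row A = dim_row B \<Longrightarrow> dim_col A = dim_col B \<Longrightarrow> dim_col B = dim_row C \<Longrightarrow>
   (A + B) * C = A * C + B * (C :: complex mat)"
  by (rule add_mult_distrib_mat[of _ "dim_row A" "dim_col A" _ _ "dim_col C"]) auto

lemma mult_add_right_dim:
  "dim_row B = dim_row C \<Longrightarrow> dim_col B = dim_col C \<Longrightarrow> dim_col A = dim_row B \<Longrightarrow>
   A * (B + C) = A * B + A * (C :: complex mat)"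
  by (rule mult_add_distrib_mat[of _ "dim_row A" "dim_col A" _ "dim_col B"]) auto

lemma mult_minus_left_dim:
  "dim_row A = dim_row B \<Longrightarrow> dim_col A = dim_col B \<Longrightarrow> dim_col B = dim_row C \<Longrightarrow>
   (A - B) * C = A * C - B * (C :: complex mat)"
  by (rule minus_mult_distrib_mat[of _ "dim_row A" "dim_col A" _ _ "dim_col C"]) auto

lemma mult_minus_right_dim:
  "dim_row B = dim_row C \<Longrightarrow> dim_col B = dim_col C \<Longrightarrow> dim_col A = dim_row B \<Longrightarrow>
   A * (B - C) = A * B - A * (C :: complex mat)"
  by (rule mult_minus_distrib_mat[of _ "dim_row A" "dim_col A" _ "dim_col B"]) auto

lemma mult_smult_left_dim:
  "dim_col A = dim_row B \<Longrightarrow> (c \<cdot>\<^sub>m A) * B = c \<cdot>\<^sub>m (A * (B :: complex mat))"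
  by (rule mult_smult_assoc_mat[of _ "dim_row A" "dim_col A" _ "dim_col B"]) auto

lemma mult_smult_right_dim:
  "dim_col A = dim_row B \<Longrightarrow> A * (c \<cdot>\<^sub>m B) = c \<cdot>\<^sub>m (A * (B :: complex mat))"
  by (rule mult_smult_distrib[of _ "dim_row A" "dim_col A" _ "dim_col B"]) auto

text \<open>The library laws have \<open>carrier_mat\<close> premises whose dimensions the
  simplifier would have to guess. With equations between dimensions as premises they become usable
  rewrite rules: products are expanded over sums and associated to the right.\<close>

lemmas mat_alg = mult_assoc_dim mult_add_left_dim mult_add_right_dim
  mult_minus_left_dim mult_minus_right_dim mult_smult_left_dim mult_smult_right_dim

lemma add_mult_vec_dim:
  "dim_row A = dim_row B \<Longrightarrow> dim_col A = dim_col B \<Longrightarrow> dim_col B = dim_vec v \<Longrightarrow>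
   (A + B) *\<^sub>v v = A *\<^sub>v v + B *\<^sub>v (v :: complex vec)"
  by (rule add_mult_distrib_mat_vec[OF carrier_matI carrier_matI carrier_vecI]) simp_all

lemma minus_mult_vec_dim:
  "dim_row A = dim_row B \<Longrightarrow> dim_col A = dim_col B \<Longrightarrow> dim_col B = dim_vec v \<Longrightarrow>
   (A - B) *\<^sub>v v = A *\<^sub>v v - B *\<^sub>v (v :: complex vec)"
  by (rule minus_mult_distrib_mat_vec[OF carrier_matI carrier_matI carrier_vecI]) simp_all

lemma smult_mult_vec_dim:
  "dim_col A = dim_vec v \<Longrightarrow> (c \<cdot>\<^sub>m A) *\<^sub>v v = c \<cdot>\<^sub>v (A *\<^sub>v (v :: complex vec))"
  by (intro eq_vecI) (auto simp: scalar_prod_def sum_distrib_left mult.assoc)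

lemma dim_dag [simp]: "dim_row (dag A) = dim_col A" "dim_col (dag A) = dim_row A"
  by (auto simp: dag_def)

lemma index_dag [simp]: "i < dim_col A \<Longrightarrow> j < dim_row A \<Longrightarrow> dag A $$ (i,j) = cnj (A $$ (j,i))"
  by (auto simp: dag_def)

lemma dag_carrier [simp]: "A \<in> carrier_mat n m \<Longrightarrow> dag A \<in> carrier_mat m n"
  by (intro carrier_matI) simp_all

lemma dag_dag [simp]: "dag (dag A) = A"
  by (intro eq_matI) auto

lemma dag_mult: "dim_col A = dim_row B \<Longrightarrow> dag (A * B) = dag B * dag A"
  by (intro eq_matI) (auto simp: scalar_prod_def intro!: sum.cong)

lemma dag_add: "dim_row A = dim_row B \<Longrightarrow> dim_col A = dim_col B \<Longrightarrow> dag (A + B) = dag A + dag B"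
  by (intro eq_matI) auto

lemma dag_minus: "dim_row A = dim_row B \<Longrightarrow> dim_col A = dim_col B \<Longrightarrow> dag (A - B) = dag A - dag B"
  by (intro eq_matI) auto

lemma dag_smult: "dag (c \<cdot>\<^sub>m A) = cnj c \<cdot>\<^sub>m dag A"
  by (intro eq_matI) auto

lemma dag_one [simp]: "dag (1\<^sub>m n) = 1\<^sub>m n"
  by (intro eq_matI) auto

lemma dag_zero [simp]: "dag (0\<^sub>m n m) = 0\<^sub>m m n"
  by (intro eq_matI) auto

lemma dag_mat_diag_real [simp]:
  "dag (mat_diag n (\<lambda>i. complex_of_real (d i))) = mat_diag n (\<lambda>i. complex_of_real (d i))"
  by (intro eq_matI) (auto simp: mat_diag_def)

lemma dag_four_block:
  assumes "A \<in> carrier_mat a c" "B \<in> carrier_mat a d" "C \<in> carrier_mat b c" "D \<in> carrier_mat b d"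
  shows "dag (four_block_mat A B C D) = four_block_mat (dag A) (dag C) (dag B) (dag D)"
  using assms by (intro eq_matI) auto

lemma dim_mat_diag [simp]: "dim_row (mat_diag n d) = n" "dim_col (mat_diag n d) = n"
  by (auto simp: mat_diag_def)

lemma mat_diag_smult: "mat_diag n (\<lambda>i. (c::complex) * d i) = c \<cdot>\<^sub>m mat_diag n d"
  by (intro eq_matI) (auto simp: mat_diag_def)

lemma mat_diag_const: "mat_diag n (\<lambda>i. (c::complex)) = c \<cdot>\<^sub>m 1\<^sub>m n"
  by (intro eq_matI) (auto simp: mat_diag_def)

subsection \<open>Inner product and trace\<close>

lemma cinner_add_right: "dim_vec v = dim_vec w \<Longrightarrow> dim_vec w = dim_vec u \<Longrightarrow>
   cinner v (w + u) = cinner v w + cinner v u"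
  by (auto simp: cinner_def sum.distrib algebra_simps)

lemma cinner_minus_right: "dim_vec v = dim_vec w \<Longrightarrow> dim_vec w = dim_vec u \<Longrightarrow>
   cinner v (w - u) = cinner v w - cinner v u"
  by (auto simp: cinner_def sum_subtractf algebra_simps)

lemma cinner_smult_right: "dim_vec v = dim_vec w \<Longrightarrow> cinner v (c \<cdot>\<^sub>v w) = c * cinner v w"
  by (auto simp: cinner_def sum_distrib_left algebra_simps)

lemma cinner_commute: "dim_vec v = dim_vec w \<Longrightarrow> cinner v w = cnj (cinner w v)"
  by (auto simp: cinner_def algebra_simps)

lemma cinner_adjoint:
  assumes "dim_vec v = dim_row A" "dim_vec w = dim_col A"
  shows "cinner v (A *\<^sub>v w) = cinner (dag A *\<^sub>v v) w"
proof -
  have "cinner v (A *\<^sub>v w) = (\<Sum>i<dim_row A. \<Sum>j<dim_col A. cnj (v $ i) * A $$ (i,j) * w $ j)"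
    using assms by (auto simp: cinner_def scalar_prod_def sum_distrib_left mult.assoc
        lessThan_atLeast0 intro!: sum.cong)
  also have "\<dots> = (\<Sum>j<dim_col A. \<Sum>i<dim_row A. cnj (v $ i) * A $$ (i,j) * w $ j)"
    by (rule sum.swap)
  also have "\<dots> = cinner (dag A *\<^sub>v v) w"
    using assms by (auto simp: cinner_def scalar_prod_def sum_distrib_right
        lessThan_atLeast0 intro!: sum.cong)
  finally show ?thesis .
qed

lemma cmod_square: "(complex_of_real (cmod z))\<^sup>2 = z * cnj z"
  by (simp add: complex_norm_square[symmetric])

lemma cinner_self: "cinner v v = complex_of_real (\<Sum>i<dim_vec v. (cmod (v $ i))\<^sup>2)"
  by (simp add: cinner_def complex_norm_square[symmetric] mult.commute del: of_real_sum)
    (simp add: complex_norm_square mult.commute)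

lemma cinner_self_nonneg [simp]: "0 \<le> Re (cinner v v)"
  by (simp add: cinner_self sum_nonneg del: of_real_sum)

lemma cinner_self_Im [simp]: "Im (cinner v v) = 0"
  by (simp add: cinner_self del: of_real_sum)

lemma cinner_self_eq_0: "Re (cinner v v) = 0 \<longleftrightarrow> v = 0\<^sub>v (dim_vec v)"
proof
  assume "Re (cinner v v) = 0"
  hence "(\<Sum>i<dim_vec v. (cmod (v $ i))\<^sup>2) = 0" by (simp add: cinner_self del: of_real_sum)
  hence "\<forall>i<dim_vec v. v $ i = 0" by (subst (asm) sum_nonneg_eq_0_iff) auto
  thus "v = 0\<^sub>v (dim_vec v)" by (intro eq_vecI) auto
next
  assume "v = 0\<^sub>v (dim_vec v)"
  moreover have "Re (cinner (0\<^sub>v (dim_vec v)) (0\<^sub>v (dim_vec v))) = 0" by (simp add: cinner_def)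
  ultimately show "Re (cinner v v) = 0" by simp
qed

lemma cinner_dag_mult:
  "dim_vec v = dim_col L \<Longrightarrow> cinner v ((dag L * L) *\<^sub>v v) = cinner (L *\<^sub>v v) (L *\<^sub>v v)"
  by (simp add: mult_vec_assoc_dim cinner_adjoint[of v "dag L"])

lemma mtrace_cyclic:
  assumes "dim_col A = dim_row B" "dim_col B = dim_row A"
  shows "mtrace (A * B) = mtrace (B * A)"
proof -
  have "mtrace (A * B) = (\<Sum>i<dim_row A. \<Sum>j<dim_row B. A $$ (i,j) * B $$ (j,i))"
    using assms by (auto simp: mtrace_def scalar_prod_def lessThan_atLeast0 intro!: sum.cong)
  also have "\<dots> = (\<Sum>j<dim_row B. \<Sum>i<dim_row A. B $$ (j,i) * A $$ (i,j))"
    by (subst sum.swap) (simp add: mult.commute)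
  also have "\<dots> = mtrace (B * A)"
    using assms by (auto simp: mtrace_def scalar_prod_def lessThan_atLeast0 intro!: sum.cong)
  finally show ?thesis .
qed

lemma mtrace_add: "dim_row A = dim_row B \<Longrightarrow> dim_col A = dim_col B \<Longrightarrow> dim_row A = dim_col A \<Longrightarrow>
    mtrace (A + B) = mtrace A + mtrace B"
  by (auto simp: mtrace_def sum.distrib)

lemma mtrace_minus: "dim_row A = dim_row B \<Longrightarrow> dim_col A = dim_col B \<Longrightarrow> dim_row A = dim_col A \<Longrightarrow>
    mtrace (A - B) = mtrace A - mtrace B"
  by (auto simp: mtrace_def sum_subtractf)

lemma mtrace_smult: "dim_row A = dim_col A \<Longrightarrow> mtrace (c \<cdot>\<^sub>m A) = c * mtrace A"
  by (auto simp: mtrace_def sum_distrib_left)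

lemma mtrace_one: "mtrace (1\<^sub>m n) = of_nat n"
  by (auto simp: mtrace_def)

lemma mtrace_dag: "dim_row A = dim_col A \<Longrightarrow> mtrace (dag A) = cnj (mtrace A)"
  by (auto simp: mtrace_def)

lemma mtrace_dag_mult:
  "mtrace (dag L * L) = complex_of_real (\<Sum>i<dim_col L. \<Sum>j<dim_row L. (cmod (L $$ (j,i)))\<^sup>2)"
  by (simp add: mtrace_def scalar_prod_def cmod_square mult.commute lessThan_atLeast0)

lemma mtrace_dag_mult_eq_0:
  assumes "Re (mtrace (dag L * L)) = 0"
  shows "L = 0\<^sub>m (dim_row L) (dim_col L)"
proof -
  from assms have "(\<Sum>i<dim_col L. \<Sum>j<dim_row L. (cmod (L $$ (j,i)))\<^sup>2) = 0"
    by (simp add: mtrace_dag_mult del: of_real_sum)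
  hence "\<forall>i<dim_col L. \<forall>j<dim_row L. L $$ (j,i) = 0"
    by (subst (asm) sum_nonneg_eq_0_iff) (auto simp: sum_nonneg sum_nonneg_eq_0_iff)
  thus ?thesis by (intro eq_matI) auto
qed

subsection \<open>Spectral theorem and functional calculus\<close>

lemma hermitian_carrier: "hermitian n A \<Longrightarrow> A \<in> carrier_mat n n"
  and hermitian_dag: "hermitian n A \<Longrightarrow> dag A = A"
  by (auto simp: hermitian_def)

lemma hermitian_dims: "hermitian n A \<Longrightarrow> dim_row A = n" "hermitian n A \<Longrightarrow> dim_col A = n"
  by (auto simp: hermitian_def)

lemma unitary_dims: "unitary n U \<Longrightarrow> dim_row U = n" "unitary n U \<Longrightarrow> dim_col U = n"
  by (auto simp: unitary_def)

lemma unitary_left: "unitary n U \<Longrightarrow> dag U * U = 1\<^sub>m n"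
  by (simp add: unitary_def)

lemma unitary_right: "unitary n U \<Longrightarrow> U * dag U = 1\<^sub>m n"
  by (auto simp: unitary_def intro: mat_mult_left_right_inverse[of _ n])

lemma mult_one_left: "dim_row A = n \<Longrightarrow> 1\<^sub>m n * A = (A :: complex mat)"
  by (rule left_mult_one_mat') simp

lemma mult_one_right: "dim_col A = n \<Longrightarrow> A * 1\<^sub>m n = (A :: complex mat)"
  by (rule right_mult_one_mat') simp

lemma unitary_left_cancel:
  "unitary n U \<Longrightarrow> dim_row A = n \<Longrightarrow> dag U * (U * A) = A"
  by (simp add: mult_assoc_dim[symmetric] unitary_dims unitary_left mult_one_left)

lemma unitary_right_cancel:
  "unitary n U \<Longrightarrow> dim_row A = n \<Longrightarrow> U * (dag U * A) = A"
  by (simp add: mult_assoc_dim[symmetric] unitary_dims unitary_right mult_one_left)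

lemma unitary_mult:
  assumes "unitary n U" "unitary n V"
  shows "unitary n (U * V)"
  using assms by (auto simp: unitary_def dag_mult mult_assoc_dim unitary_left_cancel[unfolded unitary_def])

lemma cinner_eq_cscalar: "dim_vec v = dim_vec w \<Longrightarrow> cinner v w = w \<bullet>c v"
  by (auto simp: cinner_def scalar_prod_def lessThan_atLeast0 mult.commute intro!: sum.cong)

text \<open>Gram-Schmidt applied to a basis that starts with \<open>v\<close> leaves its first
  vector unchanged.\<close>

lemma exists_unitary_first_col:
  assumes v: "v \<in> carrier_vec n" "v \<noteq> 0\<^sub>v n"
  obtains U c where "unitary n U" "col U 0 = (c::complex) \<cdot>\<^sub>v v"
proof -
  interpret cof_vec_space n "TYPE(complex)" .
  define b where "b = basis_completion v"
  define ws where "ws = gram_schmidt n b"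
  from basis_completion[OF v, folded b_def]
  have dist_b: "distinct b" and indep: "\<not> lin_dep (set b)" and b: "set b \<subseteq> carrier_vec n"
    and hdb: "hd b = v" and len_b: "length b = n" by auto
  have n: "n > 0" using v by (cases n) auto
  from hdb len_b n obtain vs where bv: "b = v # vs" by (cases b, auto)
  from gram_schmidt_result[OF b dist_b indep refl, folded ws_def]
  have ws: "set ws \<subseteq> carrier_vec n" "corthogonal ws" "length ws = n"
    by (auto simp: len_b)
  from gram_schmidt_hd[OF v(1), of vs, folded bv] have "hd ws = v" unfolding ws_def .
  with ws(3) n have ws0: "ws ! 0 = v" by (cases ws) auto
  have wsdim: "dim_vec (ws ! i) = n" if "i < n" for i
    using ws that by (metis carrier_vecD nth_mem subsetD)
  \<comment> \<open>The vectors \<open>ws\<close> are orthogonal but not normalised;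
    \<open>d\<close> supplies the norming factors, which is why column 0 is only a multiple of
    \<open>v\<close>.\<close>
  define d where "d i = 1 / sqrt (Re (cinner (ws ! i) (ws ! i)))" for i
  define U where "U = mat n n (\<lambda>(i,j). complex_of_real (d j) * ws ! j $ i)"
  have orth: "cinner (ws ! i) (ws ! j) = 0 \<longleftrightarrow> i \<noteq> j" if "i < n" "j < n" for i j
    using corthogonalD[OF ws(2), of j i] that ws(3) by (auto simp: cinner_eq_cscalar wsdim)
  have "dag U * U = 1\<^sub>m n"
  proof (rule eq_matI)
    fix i j assume "i < dim_row (1\<^sub>m n :: complex mat)" "j < dim_col (1\<^sub>m n :: complex mat)"
    hence ij: "i < n" "j < n" by auto
    have "(dag U * U) $$ (i,j) = (\<Sum>k<n. cnj (U $$ (k,i)) * U $$ (k,j))"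
      using ij by (auto simp: U_def scalar_prod_def lessThan_atLeast0 intro!: sum.cong)
    also have "\<dots> = complex_of_real (d i * d j) * cinner (ws ! i) (ws ! j)"
      using ij by (auto simp: U_def cinner_def wsdim sum_distrib_left intro!: sum.cong)
    also have "\<dots> = 1\<^sub>m n $$ (i,j)"
    proof (cases "i = j")
      case True
      define r where "r = Re (cinner (ws ! i) (ws ! i))"
      have c: "cinner (ws ! i) (ws ! i) = complex_of_real r"
        by (auto simp: r_def complex_eq_iff)
      have "r \<noteq> 0" using orth[OF ij(1) ij(1)] c by auto
      moreover have "r \<ge> 0" by (simp add: r_def)
      ultimately have "d i * d i * r = 1" by (simp add: d_def r_def[symmetric])
      thus ?thesis using ij True c by (simp flip: of_real_mult)
    next
      case False
      thus ?thesis using ij orth by auto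
    qed
    finally show "(dag U * U) $$ (i,j) = 1\<^sub>m n $$ (i,j)" .
  qed (auto simp: U_def)
  hence "unitary n U" by (auto simp: unitary_def U_def)
  moreover have "col U 0 = complex_of_real (d 0) \<cdot>\<^sub>v v"
    using v n ws0 by (intro eq_vecI) (auto simp: U_def)
  ultimately show ?thesis using that by blast
qed

text \<open>Deflation: an eigenvector becomes the first column of a unitary \<open>U\<close>, and
  \<open>dag U * A * U\<close> splits into a 1 by 1 block and a hermitian block of size
  \<open>k\<close>, to which the induction hypothesis applies.\<close>

theorem hermitian_spectral:
  "hermitian n A \<Longrightarrow>
   \<exists>U d. unitary n U \<and> A = U * mat_diag n (\<lambda>i. complex_of_real (d i)) * dag U"
proof (induction n arbitrary: A)
  case 0
  hence "A = 1\<^sub>m 0 * mat_diag 0 (\<lambda>i. complex_of_real 0) * dag (1\<^sub>m 0)"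
    by (intro eq_matI) (auto simp: hermitian_def)
  moreover have "unitary 0 (1\<^sub>m 0)" by (simp add: unitary_def)
  ultimately show ?case by (intro exI[of _ "1\<^sub>m 0"] exI[of _ "\<lambda>_. 0"] conjI)
next
  case (Suc k)
  note dims = hermitian_dims[OF Suc.prems]
  have Ac: "A \<in> carrier_mat (Suc k) (Suc k)" using Suc.prems by (simp add: hermitian_def)
  from spectrum_non_empty[OF Ac] obtain e where "eigenvalue A e"
    by (auto simp: spectrum_def)
  then obtain v where v: "v \<in> carrier_vec (Suc k)" "v \<noteq> 0\<^sub>v (Suc k)" "A *\<^sub>v v = e \<cdot>\<^sub>v v"
    using dims by (auto simp: eigenvalue_def eigenvector_def)
  from exists_unitary_first_col[OF v(1,2)] obtain U c
    where U: "unitary (Suc k) U" and c: "col U 0 = c \<cdot>\<^sub>v v" by metis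
  note Ud = unitary_dims[OF U]
  have Uc: "U \<in> carrier_mat (Suc k) (Suc k)" using U by (simp add: unitary_def)
  define B where "B = dag U * (A * U)"
  have Bd: "dim_row B = Suc k" "dim_col B = Suc k" by (auto simp: B_def Ud)
  have Bdag: "dag B = B"
    using Suc.prems by (simp add: B_def dag_mult Ud dims mult_assoc_dim hermitian_dag)
  have Bcnj: "B $$ (i,j) = cnj (B $$ (j,i))" if "i < Suc k" "j < Suc k" for i j
    by (subst Bdag[symmetric]) (use that Bd in \<open>simp del: Suc_eq_plus1\<close>)
  have Av: "A *\<^sub>v col U 0 = e \<cdot>\<^sub>v col U 0"
    using mult_mat_vec[OF Ac v(1)] v(3) by (simp add: c smult_smult_assoc mult.commute)
  have B0: "B $$ (i,0) = (if i = 0 then e else 0)" if i: "i < Suc k" for i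
  proof -
    have "B $$ (i,0) = row (dag U) i \<bullet> col (A * U) 0"
      using i by (simp add: B_def Ud dims)
    also have "col (A * U) 0 = e \<cdot>\<^sub>v col U 0"
      using col_mult2[OF Ac Uc, of 0] Av by simp
    also have "row (dag U) i \<bullet> (e \<cdot>\<^sub>v col U 0) = e * (dag U * U) $$ (i,0)"
      using i Ud by simp
    also have "\<dots> = (if i = 0 then e else 0)"
      using i by (simp add: unitary_left[OF U])
    finally show ?thesis .
  qed
  \<comment> \<open>Hermiticity carries the zeros of the first column over to the first row; it also
    makes the corner entry \<open>e\<close> real.\<close>
  have B0': "B $$ (0,j) = 0" if "j < Suc k" "j \<noteq> 0" for j
    using Bcnj[of 0 j] B0[of j] that by simp
  have e: "e = complex_of_real (Re e)"
    using Bcnj[of 0 0] B0[of 0] by (simp add: complex_eq_iff)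
  define A3 where "A3 = mat k k (\<lambda>(i,j). B $$ (Suc i, Suc j))"
  have "dag A3 = A3"
    by (intro eq_matI) (auto simp: A3_def Bcnj[symmetric])
  hence "hermitian k A3" by (simp add: hermitian_def A3_def)
  from Suc.IH[OF this] obtain V d where V: "unitary k V"
    and A3: "A3 = V * mat_diag k (\<lambda>i. complex_of_real (d i)) * dag V" by blast
  note Vd = unitary_dims[OF V]
  have Vc: "V \<in> carrier_mat k k" "dag V \<in> carrier_mat k k" using V by (auto simp: unitary_def)
  define E where "E = mat 1 1 (\<lambda>_. e)"
  have Ec: "E \<in> carrier_mat 1 1" by (simp add: E_def)
  define d' where "d' i = (case i of 0 \<Rightarrow> Re e | Suc i \<Rightarrow> d i)" for i
  define V' where "V' = four_block_mat (1\<^sub>m 1) (0\<^sub>m 1 k) (0\<^sub>m k 1) V"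
  have V'c: "V' \<in> carrier_mat (Suc k) (Suc k)"
    using four_block_carrier_mat[of "1\<^sub>m 1" 1 1 V k k] Vc by (simp add: V'_def)
  have dV': "dag V' = four_block_mat (1\<^sub>m 1) (0\<^sub>m 1 k) (0\<^sub>m k 1) (dag V)"
    using Vc unfolding V'_def by (subst dag_four_block[of _ 1 1 _ k _ k]) auto
  have "dag V' * V' = 1\<^sub>m (1 + k)"
    unfolding dV' four_block_one_mat[symmetric] unfolding V'_def
    by (subst mult_four_block_mat[of _ 1 1 _ k _ k _ _ 1 _ k])
      (use Vc V in \<open>simp_all add: unitary_left del: four_block_one_mat\<close>)
  hence V'u: "unitary (Suc k) V'" using V'c by (simp add: unitary_def)
  have D': "mat_diag (Suc k) (\<lambda>i. complex_of_real (d' i)) =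
    four_block_mat E (0\<^sub>m 1 k) (0\<^sub>m k 1) (mat_diag k (\<lambda>i. complex_of_real (d i)))"
    by (intro eq_matI) (auto simp: E_def mat_diag_def d'_def e[symmetric] split: nat.splits)
  have "B = four_block_mat E (0\<^sub>m 1 k) (0\<^sub>m k 1) A3"
    by (intro eq_matI) (auto simp: E_def A3_def Bd B0 B0' le_less_Suc_eq)
  also have "\<dots> = V' * mat_diag (Suc k) (\<lambda>i. complex_of_real (d' i)) * dag V'"
  proof -
    have 1: "V' * mat_diag (Suc k) (\<lambda>i. complex_of_real (d' i)) =
      four_block_mat E (0\<^sub>m 1 k) (0\<^sub>m k 1) (V * mat_diag k (\<lambda>i. complex_of_real (d i)))"
      unfolding D' V'_def
      by (subst mult_four_block_mat[of _ 1 1 _ k _ k _ _ 1 _ k])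
        (use Vc Ec in simp_all)
    have 2: "V * mat_diag k (\<lambda>i. complex_of_real (d i)) * dag V \<in> carrier_mat k k"
      by (intro carrier_matI) (simp_all add: Vd)
    show ?thesis
      unfolding 1 dV' A3
      by (subst mult_four_block_mat[of _ 1 1 _ k _ k _ _ 1 _ k])
        (use Vc Ec in \<open>simp_all add: left_add_zero_mat[OF 2]\<close>)
  qed
  finally have B: "B = V' * mat_diag (Suc k) (\<lambda>i. complex_of_real (d' i)) * dag V'" .
  have "A = U * B * dag U"
    by (simp add: B_def mult_assoc_dim Ud dims unitary_right_cancel[OF U] unitary_right[OF U] mult_one_right)
  also have "\<dots> = (U * V') * mat_diag (Suc k) (\<lambda>i. complex_of_real (d' i)) * dag (U * V')"
    using V'c by (simp add: B mult_assoc_dim dag_mult Ud)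
  finally show ?case using unitary_mult[OF U V'u] by blast
qed

text \<open>The decomposition chosen in \<open>matfun f A\<close> does not depend on \<open>f\<close>.\<close>

lemma matfun_spectral_choice:
  assumes "hermitian n A"
  obtains U d where "unitary n U" "A = U * mat_diag n (\<lambda>i. complex_of_real (d i)) * dag U"
    "\<And>f. matfun f A = U * mat_diag n (\<lambda>i. complex_of_real (f (d i))) * dag U"
proof -
  let ?P = "\<lambda>(U, d). unitary n U \<and> A = U * mat_diag n (\<lambda>i. complex_of_real (d i)) * dag U"
  obtain U d where Ud: "(SOME x. ?P x) = (U, d)" by (cases "SOME x. ?P x")
  have "\<exists>x. ?P x" using hermitian_spectral[OF assms] by auto
  hence "?P (SOME x. ?P x)" by (rule someI_ex)
  hence P: "unitary n U" "A = U * mat_diag n (\<lambda>i. complex_of_real (d i)) * dag U"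
    by (auto simp: Ud)
  have n: "dim_row A = n" by (rule hermitian_dims[OF assms])
  have "matfun f A = U * mat_diag n (\<lambda>i. complex_of_real (f (d i))) * dag U" for f
    unfolding matfun_def Let_def n Ud by simp
  thus ?thesis using P that by blast
qed

text \<open>Serves two purposes. With \<open>W\<close> the identity it shows that functional
  calculus does not depend on the diagonalisation; with an isometry \<open>W\<close> it evaluates a
  function of a matrix on an invariant subspace.\<close>

lemma spectral_intertwine:
  assumes U: "unitary k U" and V: "unitary l V" and W: "W \<in> carrier_mat k l"
    and eq: "(U * mat_diag k (\<lambda>i. complex_of_real (d i)) * dag U) * W =
             W * (V * mat_diag l (\<lambda>i. complex_of_real (e i)) * dag V)"
  shows "(U * mat_diag k (\<lambda>i. complex_of_real (f (d i))) * dag U) * W =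
         W * (V * mat_diag l (\<lambda>i. complex_of_real (f (e i))) * dag V)"
proof -
  note dims = unitary_dims[OF U] unitary_dims[OF V] carrier_matD[OF W]
  define C where "C = dag U * W * V"
  have Cc: "C \<in> carrier_mat k l" by (auto simp: C_def dims)
  have "dag U * ((U * mat_diag k (\<lambda>i. complex_of_real (d i)) * dag U) * W) * V =
        dag U * (W * (V * mat_diag l (\<lambda>i. complex_of_real (e i)) * dag V)) * V"
    by (simp only: eq)
  hence "mat_diag k (\<lambda>i. complex_of_real (d i)) * C = C * mat_diag l (\<lambda>i. complex_of_real (e i))"
    by (simp add: C_def mult_assoc_dim dims unitary_left_cancel[OF U] unitary_left[OF V] mult_one_right)
  hence "complex_of_real (d i) * C $$ (i,j) = C $$ (i,j) * complex_of_real (e j)"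
    if "i < k" "j < l" for i j
    using that unfolding mat_diag_mult_left[OF Cc] mat_diag_mult_right[OF Cc]
    by (auto dest!: arg_cong[of _ _ "\<lambda>M. M $$ (i,j)"])
  \<comment> \<open>a nonzero entry of \<open>C\<close> forces equal eigenvalues, so \<open>C\<close> also intertwines \<open>f (d i)\<close> and \<open>f (e j)\<close>\<close>
  hence ij: "C $$ (i,j) = 0 \<or> d i = e j" if "i < k" "j < l" for i j
    using that by fastforce
  have C2: "mat_diag k (\<lambda>i. complex_of_real (f (d i))) * C = C * mat_diag l (\<lambda>i. complex_of_real (f (e i)))"
    unfolding mat_diag_mult_left[OF Cc] mat_diag_mult_right[OF Cc]
    by (intro eq_matI) (use ij in \<open>fastforce+\<close>)
  have W': "dag U * W = C * dag V" "W * V = U * C"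
    by (simp_all add: C_def mult_assoc_dim dims unitary_right[OF V] mult_one_right
        unitary_right_cancel[OF U])
  have "(U * mat_diag k (\<lambda>i. complex_of_real (f (d i))) * dag U) * W =
        U * ((mat_diag k (\<lambda>i. complex_of_real (f (d i))) * C) * dag V)"
    using Cc by (simp add: mult_assoc_dim dims W')
  also have "\<dots> = (W * V) * (mat_diag l (\<lambda>i. complex_of_real (f (e i))) * dag V)"
    unfolding C2 W' using Cc by (simp add: mult_assoc_dim dims)
  finally show ?thesis by (simp add: mult_assoc_dim dims)
qed

lemma matfun_intertwine:
  assumes "hermitian k A" "hermitian l B" "W \<in> carrier_mat k l" "A * W = W * B"
  shows "matfun f A * W = W * matfun f B"
proof -
  obtain U d where 1: "unitary k U" "A = U * mat_diag k (\<lambda>i. complex_of_real (d i)) * dag U"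
    "\<And>f. matfun f A = U * mat_diag k (\<lambda>i. complex_of_real (f (d i))) * dag U"
    using matfun_spectral_choice[OF assms(1)] by metis
  obtain V e where 2: "unitary l V" "B = V * mat_diag l (\<lambda>i. complex_of_real (e i)) * dag V"
    "\<And>f. matfun f B = V * mat_diag l (\<lambda>i. complex_of_real (f (e i))) * dag V"
    using matfun_spectral_choice[OF assms(2)] by metis
  show ?thesis unfolding 1(3) 2(3)
    by (rule spectral_intertwine[OF 1(1) 2(1) assms(3)]) (use assms(4) 1(2) 2(2) in simp)
qed

lemma hermitian_unitary_diag:
  "unitary n U \<Longrightarrow> hermitian n (U * mat_diag n (\<lambda>i. complex_of_real (d i)) * dag U)"
  unfolding hermitian_def
  by (intro conjI carrier_matI) (simp_all add: dag_mult unitary_dims[of n U] mult_assoc_dim)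

lemma hermitian_matfun: "hermitian n A \<Longrightarrow> hermitian n (matfun f A)"
  by (metis matfun_spectral_choice hermitian_unitary_diag)

lemma matfun_mult:
  assumes "hermitian n A"
  shows "matfun f A * matfun g A = matfun (\<lambda>x. f x * g x) A"
proof -
  obtain U d where 1: "unitary n U" 
    "\<And>f. matfun f A = U * mat_diag n (\<lambda>i. complex_of_real (f (d i))) * dag U"
    using matfun_spectral_choice[OF assms(1)] by metis
  show ?thesis
    unfolding 1(2) using mat_diag_diag[of n "\<lambda>i. complex_of_real (f (d i))" "\<lambda>i. complex_of_real (g (d i))"]
    by (simp add: mult_assoc_dim unitary_dims[OF 1(1)] unitary_left_cancel[OF 1(1)])
       (simp add: mult_assoc_dim[symmetric] unitary_dims[OF 1(1)])
qed

lemma matfun_id: 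
  assumes "hermitian n A"
  shows "matfun (\<lambda>x. x) A = A"
proof -
  obtain U d where "A = U * mat_diag n (\<lambda>i. complex_of_real (d i)) * dag U"
    "\<And>f. matfun f A = U * mat_diag n (\<lambda>i. complex_of_real (f (d i))) * dag U"
    using matfun_spectral_choice[OF assms(1)] by metis
  thus ?thesis by simp
qed

lemma matfun_const: 
  assumes "hermitian n A"
  shows "matfun (\<lambda>x. c) A = complex_of_real c \<cdot>\<^sub>m 1\<^sub>m n"
proof -
  obtain U d where 1: "unitary n U" 
    "\<And>f. matfun f A = U * mat_diag n (\<lambda>i. complex_of_real (f (d i))) * dag U"
    using matfun_spectral_choice[OF assms(1)] by metis
  show ?thesis unfolding 1(2) mat_diag_const
    by (simp add: mult_smult_left_dim mult_smult_right_dim unitary_dims[OF 1(1)] mult_one_right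
        unitary_right[OF 1(1)])
qed

lemma matfun_one_minus:
  assumes "hermitian n A"
  shows "1\<^sub>m n - matfun f A = matfun (\<lambda>x. 1 - f x) A"
proof -
  obtain U e where 1: "unitary n U"
    "\<And>f. matfun f A = U * mat_diag n (\<lambda>i. complex_of_real (f (e i))) * dag U"
    using matfun_spectral_choice[OF assms] by metis
  have "mat_diag n (\<lambda>i. complex_of_real (1 - f (e i))) =
     1\<^sub>m n - mat_diag n (\<lambda>i. complex_of_real (f (e i)))"
    by (intro eq_matI) (auto simp: mat_diag_def)
  thus ?thesis unfolding 1(2)
    by (simp add: mat_alg unitary_dims[OF 1(1)] mult_one_left unitary_right[OF 1(1)])
qed

subsection \<open>Positive matrices\<close>

lemma mult_zero_vec_dim: "dim_col A = n \<Longrightarrow> A *\<^sub>v 0\<^sub>v n = (0\<^sub>v (dim_row A) :: complex vec)"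
  by (intro eq_vecI) (auto simp: scalar_prod_def)

lemma one_smult_mat: "(1 :: complex) \<cdot>\<^sub>m A = A"
  by (intro eq_matI) auto

lemma psd_hermitian: "psd n A \<Longrightarrow> hermitian n A"
  and pd_hermitian: "pd n A \<Longrightarrow> hermitian n A"
  by (auto simp: psd_def pd_def)

lemma psd_carrier: "psd n A \<Longrightarrow> A \<in> carrier_mat n n"
  and pd_carrier: "pd n A \<Longrightarrow> A \<in> carrier_mat n n"
  by (auto simp: psd_def pd_def hermitian_def)

lemma psd_dims: "psd n A \<Longrightarrow> dim_row A = n" "psd n A \<Longrightarrow> dim_col A = n"
  and pd_dims: "pd n A \<Longrightarrow> dim_row A = n" "pd n A \<Longrightarrow> dim_col A = n"
  by (auto dest: psd_carrier pd_carrier)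

lemma psd_dag: "psd n A \<Longrightarrow> dag A = A"
  and pd_dag: "pd n A \<Longrightarrow> dag A = A"
  by (auto simp: psd_def pd_def hermitian_def)

lemma psd_quad: "psd n A \<Longrightarrow> dim_vec v = n \<Longrightarrow> 0 \<le> Re (cinner v (A *\<^sub>v v))"
  by (metis carrier_vecI psd_def)

lemma pd_quad: "pd n A \<Longrightarrow> dim_vec v = n \<Longrightarrow> v \<noteq> 0\<^sub>v n \<Longrightarrow> 0 < Re (cinner v (A *\<^sub>v v))"
  by (metis carrier_vecI pd_def)

lemma pd_psd: assumes "pd n A" shows "psd n A"
proof -
  have "0 \<le> Re (cinner v (A *\<^sub>v v))" if v: "v \<in> carrier_vec n" for v
  proof (cases "v = 0\<^sub>v n")
    case True
    thus ?thesis by (simp add: cinner_def)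
  next
    case False
    thus ?thesis using assms v by (force simp: pd_def)
  qed
  thus ?thesis using assms by (simp add: psd_def pd_def)
qed

lemma psd_add:
  assumes "psd n A" "psd n B"
  shows "psd n (A + B)"
  using assms psd_dims[OF assms(1)] psd_dims[OF assms(2)]
  by (auto simp: psd_def hermitian_def dag_add add_mult_vec_dim cinner_add_right)

lemma pd_add_psd:
  assumes "pd n A" "psd n B"
  shows "pd n (A + B)"
  using assms pd_dims[OF assms(1)] psd_dims[OF assms(2)]
  by (auto simp: pd_def psd_def hermitian_def dag_add add_mult_vec_dim cinner_add_right
      intro!: add_pos_nonneg)

lemma psd_smult:
  assumes "psd n A" "c \<ge> 0"
  shows "psd n (complex_of_real c \<cdot>\<^sub>m A)"
  using assms psd_dims[OF assms(1)]
  by (auto simp: psd_def hermitian_def dag_smult smult_mult_vec_dim cinner_smult_right)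

lemma pd_smult:
  assumes "pd n A" "c > 0"
  shows "pd n (complex_of_real c \<cdot>\<^sub>m A)"
  using assms pd_dims[OF assms(1)]
  by (auto simp: pd_def hermitian_def dag_smult smult_mult_vec_dim cinner_smult_right)

lemma quad_conj:
  "dim_vec v = dim_col L \<Longrightarrow> dim_row A = dim_row L \<Longrightarrow> dim_col A = dim_row L \<Longrightarrow>
   cinner v ((dag L * A * L) *\<^sub>v v) = cinner (L *\<^sub>v v) (A *\<^sub>v (L *\<^sub>v v))"
  by (simp add: mult_vec_assoc_dim cinner_adjoint[of v "dag L"])

lemma hermitian_conj:
  assumes "hermitian n A" "L \<in> carrier_mat n m"
  shows "hermitian m (dag L * A * L)"
  using assms hermitian_dims[OF assms(1)]
  unfolding hermitian_def by (intro conjI carrier_matI) (auto simp: dag_mult mult_assoc_dim)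

lemma psd_conj:
  assumes "psd n A" "L \<in> carrier_mat n m"
  shows "psd m (dag L * A * L)"
  using hermitian_conj[OF psd_hermitian[OF assms(1)] assms(2)] psd_quad[OF assms(1)]
    assms(2) psd_dims[OF assms(1)]
  by (auto simp: psd_def quad_conj)

lemma pd_conj:
  assumes A: "pd n A" and L: "L \<in> carrier_mat n m"
    and inj: "\<And>v. v \<in> carrier_vec m \<Longrightarrow> L *\<^sub>v v = 0\<^sub>v n \<Longrightarrow> v = 0\<^sub>v m"
  shows "pd m (dag L * A * L)"
proof -
  have "0 < Re (cinner v ((dag L * A * L) *\<^sub>v v))" if "v \<in> carrier_vec m" "v \<noteq> 0\<^sub>v m" for v
    using pd_quad[OF A, of "L *\<^sub>v v"] L that inj[of v] pd_dims[OF A] by (auto simp: quad_conj)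
  thus ?thesis using hermitian_conj[OF pd_hermitian[OF A] L] by (auto simp: pd_def)
qed

lemma pd_one: "pd n (1\<^sub>m n)"
proof -
  have "0 < Re (cinner v v)" if "v \<in> carrier_vec n" "v \<noteq> 0\<^sub>v n" for v
    using that cinner_self_eq_0[of v] cinner_self_nonneg[of v] by (auto simp: less_le simp del: cinner_self_nonneg)
  thus ?thesis by (auto simp: pd_def hermitian_def)
qed

lemmas psd_one = pd_psd[OF pd_one]

lemma psd_dag_mult: "L \<in> carrier_mat m n \<Longrightarrow> psd n (dag L * L)"
  using psd_conj[OF psd_one, of L m n] by (simp add: mult_one_right)

lemma hermitian_add: "hermitian n A \<Longrightarrow> hermitian n B \<Longrightarrow> hermitian n (A + B)"
  by (auto simp: hermitian_def dag_add)

lemma hermitian_minus: "hermitian n A \<Longrightarrow> hermitian n B \<Longrightarrow> hermitian n (A - B)"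
  by (auto simp: hermitian_def dag_minus)

lemma hermitian_smult: "hermitian n A \<Longrightarrow> hermitian n (complex_of_real c \<cdot>\<^sub>m A)"
  by (auto simp: hermitian_def dag_smult)

lemma hermitian_one: "hermitian n (1\<^sub>m n)"
  by (auto simp: hermitian_def)

lemma cinner_unit_vec: "i < n \<Longrightarrow> dim_vec w = n \<Longrightarrow> cinner (unit_vec n i) w = w $ i"
  by (simp add: cinner_def unit_vec_def if_distrib if_distribR sum.delta cong: if_cong)

lemma psd_diag: "psd n A \<Longrightarrow> i < n \<Longrightarrow> 0 \<le> Re (A $$ (i,i))"
  using psd_quad[of n A "unit_vec n i"] psd_carrier[of n A]
  by (auto simp: cinner_unit_vec)

lemma pd_diag: "pd n A \<Longrightarrow> i < n \<Longrightarrow> 0 < Re (A $$ (i,i))"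
  using pd_quad[of n A "unit_vec n i"] pd_carrier[of n A]
  by (auto simp: cinner_unit_vec)

lemma mat_diag_cong: "(\<And>i. i < n \<Longrightarrow> d i = e i) \<Longrightarrow> mat_diag n d = mat_diag n (e :: nat \<Rightarrow> complex)"
  by (intro eq_matI) (auto simp: mat_diag_def)

lemma unitary_dag: "unitary n U \<Longrightarrow> unitary n (dag U)"
  using unitary_right[of n U] by (auto simp: unitary_def)

lemma unitary_inj: "unitary n U \<Longrightarrow> v \<in> carrier_vec n \<Longrightarrow> U *\<^sub>v v = 0\<^sub>v n \<Longrightarrow> v = 0\<^sub>v n"
proof -
  assume a: "unitary n U" "v \<in> carrier_vec n" "U *\<^sub>v v = 0\<^sub>v n"
  have "v = (dag U * U) *\<^sub>v v" using a by (simp add: unitary_left[OF a(1)])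
  also have "\<dots> = dag U *\<^sub>v 0\<^sub>v n" using a unitary_dims[OF a(1)] by (simp add: mult_vec_assoc_dim)
  also have "\<dots> = 0\<^sub>v n" using unitary_dims[OF a(1)] by (simp add: mult_zero_vec_dim)
  finally show ?thesis .
qed

lemma spectral_diag:
  "unitary n U \<Longrightarrow> A = U * mat_diag n d * dag U \<Longrightarrow> dag U * A * U = mat_diag n d"
  by (simp add: mult_assoc_dim unitary_dims[of n U] unitary_left_cancel[of n U]
      unitary_left[of n U] mult_one_right)

lemma psd_spectral:
  assumes "psd n A"
  obtains U d where "unitary n U" "\<And>i. i < n \<Longrightarrow> 0 \<le> d i"
    "A = U * mat_diag n (\<lambda>i. complex_of_real (d i)) * dag U"
    "\<And>f. matfun f A = U * mat_diag n (\<lambda>i. complex_of_real (f (d i))) * dag U"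
proof -
  obtain U d where 1: "unitary n U" "A = U * mat_diag n (\<lambda>i. complex_of_real (d i)) * dag U"
    "\<And>f. matfun f A = U * mat_diag n (\<lambda>i. complex_of_real (f (d i))) * dag U"
    using matfun_spectral_choice[OF psd_hermitian[OF assms]] by metis
  \<comment> \<open>The eigenvalues are the diagonal entries of \<open>dag U * A * U\<close>, which
    is again positive.\<close>
  have "psd n (mat_diag n (\<lambda>i. complex_of_real (d i)))"
    using psd_conj[OF assms, of U n] 1(1) spectral_diag[OF 1(1,2)] by (simp add: unitary_def)
  from psd_diag[OF this] have "\<And>i. i < n \<Longrightarrow> 0 \<le> d i" by (simp add: mat_diag_def)
  thus ?thesis using 1 that by blast
qed

lemma pd_spectral:
  assumes "pd n A"
  obtains U d where "unitary n U" "\<And>i. i < n \<Longrightarrow> 0 < d i"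
    "A = U * mat_diag n (\<lambda>i. complex_of_real (d i)) * dag U"
    "\<And>f. matfun f A = U * mat_diag n (\<lambda>i. complex_of_real (f (d i))) * dag U"
proof -
  obtain U d where 1: "unitary n U" "A = U * mat_diag n (\<lambda>i. complex_of_real (d i)) * dag U"
    "\<And>f. matfun f A = U * mat_diag n (\<lambda>i. complex_of_real (f (d i))) * dag U"
    using matfun_spectral_choice[OF pd_hermitian[OF assms]] by metis
  have "pd n (mat_diag n (\<lambda>i. complex_of_real (d i)))"
    using pd_conj[OF assms, of U n] 1(1) spectral_diag[OF 1(1,2)] unitary_inj[OF 1(1)]
    by (simp add: unitary_def)
  from pd_diag[OF this] have "\<And>i. i < n \<Longrightarrow> 0 < d i" by (simp add: mat_diag_def)
  thus ?thesis using 1 that by blast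
qed

lemma psd_mat_diag:
  assumes "\<And>i. i < n \<Longrightarrow> 0 \<le> d i"
  shows "psd n (mat_diag n (\<lambda>i. complex_of_real (d i)))"
proof -
  have "mat_diag n (\<lambda>i. complex_of_real (d i)) =
    dag (mat_diag n (\<lambda>i. complex_of_real (sqrt (d i)))) * mat_diag n (\<lambda>i. complex_of_real (sqrt (d i)))"
    by (simp add: flip: of_real_mult) (rule mat_diag_cong, use assms in simp)
  thus ?thesis using psd_dag_mult[of "mat_diag n (\<lambda>i. complex_of_real (sqrt (d i)))" n n] by simp
qed

lemma psd_unitary_diag:
  "unitary n U \<Longrightarrow> (\<And>i. i < n \<Longrightarrow> 0 \<le> d i) \<Longrightarrow>
   psd n (U * mat_diag n (\<lambda>i. complex_of_real (d i)) * dag U)"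
  using psd_conj[OF psd_mat_diag[of n d], of "dag U" n] unitary_dag[of n U] by (simp add: unitary_def)

lemma psd_matfun: 
  assumes "psd n A" "\<And>x. 0 \<le> x \<Longrightarrow> 0 \<le> f x"
  shows "psd n (matfun f A)"
proof -
  obtain U d where 1: "unitary n U" "\<And>i. i < n \<Longrightarrow> 0 \<le> d i"
    "\<And>f. matfun f A = U * mat_diag n (\<lambda>i. complex_of_real (f (d i))) * dag U"
    using psd_spectral[OF assms(1)] by metis
  show ?thesis unfolding 1(3) by (rule psd_unitary_diag[OF 1(1)]) (use 1(2) assms(2) in auto)
qed

lemma matfun_cong_psd:
  assumes "psd n A" "\<And>x. 0 \<le> x \<Longrightarrow> f x = g x"
  shows "matfun f A = matfun g A"
proof -
  obtain U d where 1: "unitary n U" "\<And>i. i < n \<Longrightarrow> 0 \<le> d i"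
    "\<And>f. matfun f A = U * mat_diag n (\<lambda>i. complex_of_real (f (d i))) * dag U"
    using psd_spectral[OF assms(1)] by metis
  have "mat_diag n (\<lambda>i. complex_of_real (f (d i))) = mat_diag n (\<lambda>i. complex_of_real (g (d i)))"
    by (rule mat_diag_cong) (simp add: assms(2) 1(2))
  thus ?thesis unfolding 1(3) by simp
qed

lemma matfun_cong_pd:
  assumes "pd n A" "\<And>x. 0 < x \<Longrightarrow> f x = g x"
  shows "matfun f A = matfun g A"
proof -
  obtain U d where 1: "unitary n U" "\<And>i. i < n \<Longrightarrow> 0 < d i"
    "\<And>f. matfun f A = U * mat_diag n (\<lambda>i. complex_of_real (f (d i))) * dag U"
    using pd_spectral[OF assms(1)] by metis
  have "mat_diag n (\<lambda>i. complex_of_real (f (d i))) = mat_diag n (\<lambda>i. complex_of_real (g (d i)))"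
    by (rule mat_diag_cong) (simp add: assms(2) 1(2))
  thus ?thesis unfolding 1(3) by simp
qed

lemma psd_sqrtm: "psd n A \<Longrightarrow> psd n (sqrtm A)"
  unfolding sqrtm_def by (rule psd_matfun) auto

lemma sqrtm_square: 
  assumes "psd n A"
  shows "sqrtm A * sqrtm A = A"
proof -
  have "sqrtm A * sqrtm A = matfun (\<lambda>x. sqrt x * sqrt x) A"
    unfolding sqrtm_def by (rule matfun_mult[OF psd_hermitian[OF assms]])
  also have "\<dots> = matfun (\<lambda>x. x) A" by (rule matfun_cong_psd[OF assms]) simp
  also have "\<dots> = A" by (rule matfun_id[OF psd_hermitian[OF assms]])
  finally show ?thesis .
qed

text \<open>The quadratic form is the squared norm of \<open>sqrtm A *\<^sub>v v\<close>, so already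
  the square root annihilates \<open>v\<close>.\<close>

lemma psd_eq_0_vec:
  assumes "psd n A" "v \<in> carrier_vec n" "Re (cinner v (A *\<^sub>v v)) = 0"
  shows "A *\<^sub>v v = 0\<^sub>v n"
proof -
  let ?S = "sqrtm A"
  note d = psd_dims[OF psd_sqrtm[OF assms(1)]]
  have A: "A = dag ?S * ?S" by (simp add: psd_dag[OF psd_sqrtm[OF assms(1)]] sqrtm_square[OF assms(1)])
  have "Re (cinner (?S *\<^sub>v v) (?S *\<^sub>v v)) = 0"
    using assms(2,3) d by (subst (asm) A) (simp add: cinner_dag_mult)
  hence "?S *\<^sub>v v = 0\<^sub>v n" using d by (simp add: cinner_self_eq_0)
  hence "?S *\<^sub>v (?S *\<^sub>v v) = 0\<^sub>v n" using d by (simp add: mult_zero_vec_dim)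
  thus ?thesis using assms(2) d
    by (subst sqrtm_square[OF assms(1), symmetric]) (simp add: mult_vec_assoc_dim)
qed

section \<open>Inverses of positive definite matrices\<close>

text \<open>\<open>minv\<close> is the result of Gauss-Jordan elimination under \<open>the\<close>;
  a two-sided inverse rules out \<open>None\<close>, and uniqueness of inverses identifies the
  result.\<close>

lemma minv_eqI:
  assumes "A \<in> carrier_mat n n" "C \<in> carrier_mat n n" "A * C = 1\<^sub>m n" "C * A = 1\<^sub>m n"
  shows "minv A = C"
proof (cases "mat_inverse A")
  case None
  with mat_inverse(1)[OF assms(1), where b = "()"] have "A \<notin> Units (ring_mat TYPE(complex) n ())" by blast
  moreover have "A \<in> Units (ring_mat TYPE(complex) n ())"
    using assms by (auto simp: Units_def ring_mat_simps)
  ultimately show ?thesis by blast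
next
  case (Some B)
  from mat_inverse(2)[OF assms(1) this] have B: "B * A = 1\<^sub>m n" "B \<in> carrier_mat n n" by auto
  have "B = B * (A * C)" using B assms by simp
  also have "\<dots> = (B * A) * C" by (rule assoc_mult_mat[symmetric]) (use B assms in auto)
  also have "\<dots> = C" using B assms by simp
  finally show ?thesis by (simp add: minv_def Some)
qed

lemma matfun_inverse:
  assumes "pd n A"
  shows "A * matfun inverse A = 1\<^sub>m n" "matfun inverse A * A = 1\<^sub>m n"
proof -
  note h = pd_hermitian[OF assms]
  have "A * matfun inverse A = matfun (\<lambda>x. x) A * matfun inverse A" by (simp add: matfun_id[OF h])
  also have "\<dots> = matfun (\<lambda>x. 1) A"
    unfolding matfun_mult[OF h] by (rule matfun_cong_pd[OF assms]) simp
  finally show "A * matfun inverse A = 1\<^sub>m n" by (simp add: matfun_const[OF h] one_smult_mat)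
  have "matfun inverse A * A = matfun inverse A * matfun (\<lambda>x. x) A" by (simp add: matfun_id[OF h])
  also have "\<dots> = matfun (\<lambda>x. 1) A"
    unfolding matfun_mult[OF h] by (rule matfun_cong_pd[OF assms]) simp
  finally show "matfun inverse A * A = 1\<^sub>m n" by (simp add: matfun_const[OF h] one_smult_mat)
qed

lemma minv_matfun: "pd n A \<Longrightarrow> minv A = matfun inverse A"
  by (rule minv_eqI[OF pd_carrier hermitian_carrier[OF hermitian_matfun[OF pd_hermitian]]
      matfun_inverse])

lemma minv_right: "pd n A \<Longrightarrow> A * minv A = 1\<^sub>m n"
  and minv_left: "pd n A \<Longrightarrow> minv A * A = 1\<^sub>m n"
  by (simp_all add: minv_matfun matfun_inverse)

lemma pd_psd_inj:
  assumes "psd n A" "\<And>v. v \<in> carrier_vec n \<Longrightarrow> A *\<^sub>v v = 0\<^sub>v n \<Longrightarrow> v = 0\<^sub>v n"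
  shows "pd n A"
proof -
  have "0 < Re (cinner v (A *\<^sub>v v))" if v: "v \<in> carrier_vec n" "v \<noteq> 0\<^sub>v n" for v
  proof (rule ccontr)
    assume "\<not> ?thesis"
    with psd_quad[OF assms(1), of v] v have "Re (cinner v (A *\<^sub>v v)) = 0" by auto
    from assms(2)[OF v(1) psd_eq_0_vec[OF assms(1) v(1) this]] v show False by blast
  qed
  thus ?thesis using psd_hermitian[OF assms(1)] by (auto simp: pd_def)
qed

lemma pd_minv: 
  assumes "pd n A"
  shows "pd n (minv A)"
proof (rule pd_psd_inj)
  show p: "psd n (minv A)"
    unfolding minv_matfun[OF assms] by (rule psd_matfun[OF pd_psd[OF assms]]) simp
  fix v assume v: "v \<in> carrier_vec n" "minv A *\<^sub>v v = 0\<^sub>v n"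
  have "v = (A * minv A) *\<^sub>v v" using v by (simp add: minv_right[OF assms])
  also have "\<dots> = A *\<^sub>v 0\<^sub>v n"
    using v pd_dims[OF assms] psd_dims[OF p] by (simp add: mult_vec_assoc_dim)
  also have "\<dots> = 0\<^sub>v n" using pd_dims[OF assms] by (simp add: mult_zero_vec_dim)
  finally show "v = 0\<^sub>v n" .
qed

section \<open>Comparison with multiples of the identity\<close>

lemma psd_shift_lower:
  assumes "pd n A"
  obtains c where "c > 0" "psd n (A - complex_of_real c \<cdot>\<^sub>m 1\<^sub>m n)"
proof -
  obtain U d where 1: "unitary n U" "\<And>i. i < n \<Longrightarrow> 0 < d i"
    "A = U * mat_diag n (\<lambda>i. complex_of_real (d i)) * dag U"
    using pd_spectral[OF assms(1)] by metis
  \<comment> \<open>The inserted 1 keeps the set nonempty in dimension 0.\<close>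
  define c where "c = Min (insert 1 (d ` {..<n}))"
  have c: "c > 0" "\<And>i. i < n \<Longrightarrow> c \<le> d i" using 1(2) by (auto simp: c_def)
  have "mat_diag n (\<lambda>i. complex_of_real (d i - c)) =
      mat_diag n (\<lambda>i. complex_of_real (d i)) - complex_of_real c \<cdot>\<^sub>m 1\<^sub>m n"
    by (intro eq_matI) (auto simp: mat_diag_def)
  hence "U * mat_diag n (\<lambda>i. complex_of_real (d i - c)) * dag U = A - complex_of_real c \<cdot>\<^sub>m 1\<^sub>m n"
    by (simp add: 1(3) mat_alg unitary_dims[OF 1(1)] mult_one_left unitary_right[OF 1(1)])
  thus ?thesis using psd_unitary_diag[OF 1(1), of "\<lambda>i. d i - c"] c that by auto
qed

lemma psd_shift_upper:
  assumes "hermitian n A"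
  obtains c where "c > 0" "psd n (complex_of_real c \<cdot>\<^sub>m 1\<^sub>m n - A)"
proof -
  obtain U d where 1: "unitary n U"
    "A = U * mat_diag n (\<lambda>i. complex_of_real (d i)) * dag U"
    using hermitian_spectral[OF assms(1)] by metis
  \<comment> \<open>The inserted 1 covers dimension 0 and keeps \<open>c\<close> positive when all
    eigenvalues are negative.\<close>
  define c where "c = Max (insert 1 (d ` {..<n}))"
  have c: "c \<ge> 1" "\<And>i. i < n \<Longrightarrow> d i \<le> c" by (auto simp: c_def)
  have "mat_diag n (\<lambda>i. complex_of_real (c - d i)) =
      complex_of_real c \<cdot>\<^sub>m 1\<^sub>m n - mat_diag n (\<lambda>i. complex_of_real (d i))"
    by (intro eq_matI) (auto simp: mat_diag_def)
  hence "U * mat_diag n (\<lambda>i. complex_of_real (c - d i)) * dag U = complex_of_real c \<cdot>\<^sub>m 1\<^sub>m n - A"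
    by (simp add: 1(2) mat_alg unitary_dims[OF 1(1)] mult_one_left unitary_right[OF 1(1)])
  thus ?thesis using psd_unitary_diag[OF 1(1), of "\<lambda>i. c - d i"] c that[of c] by auto
qed

text \<open>If \<open>P\<close> is at least \<open>c\<close> and \<open>H\<close> is at most
  \<open>b\<close>, then \<open>t = c / b\<close> works. This later supplies the constants \<delta>
  and \<open>g\<close> of the main estimate.\<close>

lemma pd_absorb:
  assumes "pd n P" "hermitian n H"
  obtains t where "t > 0" "psd n (P - complex_of_real t \<cdot>\<^sub>m H)"
proof -
  obtain c where c: "c > 0" "psd n (P - complex_of_real c \<cdot>\<^sub>m 1\<^sub>m n)"
    using psd_shift_lower[OF assms(1)] .
  obtain b where b: "b > 0" "psd n (complex_of_real b \<cdot>\<^sub>m 1\<^sub>m n - H)"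
    using psd_shift_upper[OF assms(2)] .
  have "P - complex_of_real (c / b) \<cdot>\<^sub>m H = (P - complex_of_real c \<cdot>\<^sub>m 1\<^sub>m n)
      + complex_of_real (c / b) \<cdot>\<^sub>m (complex_of_real b \<cdot>\<^sub>m 1\<^sub>m n - H)"
    using b pd_dims[OF assms(1)] hermitian_dims[OF assms(2)]
    by (intro eq_matI) (auto simp: field_simps)
  thus ?thesis using that[of "c / b"] b c psd_add[OF c(2) psd_smult[OF b(2), of "c / b"]] by simp
qed

section \<open>Traces of products of positive matrices\<close>

lemma mtrace_psd: 
  assumes "psd n A"
  shows "0 \<le> Re (mtrace A)"
  using psd_diag[OF assms] psd_dims[OF assms] by (auto simp: mtrace_def intro!: sum_nonneg)

text \<open>By cyclicity the trace equals that of \<open>sqrtm A * B * sqrtm A\<close>, which is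
  positive.\<close>

lemma mtrace_psd_mult:
  assumes A: "psd n A" and B: "psd n B"
  shows "0 \<le> Re (mtrace (A * B))"
proof -
  let ?S = "sqrtm A"
  note d = psd_dims[OF psd_sqrtm[OF A]] psd_dims[OF B]
  have "mtrace (A * B) = mtrace (?S * (?S * B))"
    using d by (simp add: sqrtm_square[OF A] mult_assoc_dim[symmetric])
  also have "\<dots> = mtrace (?S * B * ?S)"
    using d by (subst mtrace_cyclic) auto
  also have "\<dots> = mtrace (dag ?S * B * ?S)" by (simp add: psd_dag[OF psd_sqrtm[OF A]])
  finally show ?thesis
    using mtrace_psd[OF psd_conj[OF B psd_carrier[OF psd_sqrtm[OF A]]]] by simp
qed

lemma mtrace_mono:
  assumes "psd n (B - A)" "psd n Q" "A \<in> carrier_mat n n" "B \<in> carrier_mat n n"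
  shows "Re (mtrace (A * Q)) \<le> Re (mtrace (B * Q))"
  using mtrace_psd_mult[OF assms(1,2)] assms(3,4) psd_dims[OF assms(2)]
  by (simp add: mult_minus_left_dim mtrace_minus)

text \<open>A regularised form of the bound of \<open>dag L * minv (L * C * dag L) * L\<close> by
  \<open>minv C\<close>: the term with \<open>k\<close> makes the middle matrix invertible even if
  \<open>L\<close> is singular or not square. It is applied with \<open>L\<close> the pseudo-inverse
  \<open>R\<close> and with \<open>L = sqrtm X\<close>.\<close>

lemma minv_perturbed_le:
  assumes C: "pd n C" and L: "L \<in> carrier_mat m n" and k: "k > 0"
  defines "M \<equiv> L * C * dag L + complex_of_real k \<cdot>\<^sub>m 1\<^sub>m m"
  shows "pd m M" "psd n (minv C - dag L * minv M * L)"
proof -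
  have p: "psd m (L * C * dag L)" using psd_conj[OF pd_psd[OF C], of "dag L" m] L by simp
  from pd_add_psd[OF pd_smult[OF pd_one k] this] show M: "pd m M"
    by (simp add: M_def comm_add_mat[OF psd_carrier[OF p]])
  define I where "I = minv M"
  define J where "J = minv C"
  have I: "pd m I" and J: "pd n J" using pd_minv M C by (auto simp: I_def J_def)
  note d = pd_dims[OF I] pd_dims[OF J] pd_dims[OF C] carrier_matD[OF L]
  \<comment> \<open>completing the square: \<open>J - dag L * I * L = dag N * J * N + k \<cdot> dag (I * L) * (I * L)\<close>\<close>
  define N where "N = 1\<^sub>m n - C * dag L * I * L"
  have Nd: "dim_row N = n" "dim_col N = n" by (auto simp: N_def d)
  have JC: "J * C = 1\<^sub>m n" "C * J = 1\<^sub>m n" using minv_left[OF C] minv_right[OF C] by (auto simp: J_def)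
  have JC': "J * (C * X) = X" if "dim_row X = n" for X
    using JC that d by (simp add: mult_assoc_dim[symmetric] mult_one_left)
  \<comment> \<open>Writing \<open>L * C * dag L\<close> as \<open>M\<close> minus \<open>k\<close>
    times the identity lets \<open>M\<close> cancel against \<open>I\<close>; this evaluates the
    quadratic term of \<open>dag N * J * N\<close>.\<close>
  have "L * (C * dag L) = M - complex_of_real k \<cdot>\<^sub>m 1\<^sub>m m"
    using d by (intro eq_matI) (auto simp: M_def mult_assoc_dim simp del: index_mult_mat(1))
  hence LCL: "L * (C * (dag L * (I * L))) = L - complex_of_real k \<cdot>\<^sub>m (I * L)"
    using d minv_right[OF M] pd_dims[OF M]
    by (simp add: mult_assoc_dim[symmetric] I_def[symmetric])
      (simp add: mat_alg I_def[symmetric] mult_one_left; simp add: mult_assoc_dim[symmetric] I_def mult_one_left)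
  have "dag N * J * N = J - (dag L * I * L + complex_of_real k \<cdot>\<^sub>m (dag (I * L) * (I * L)))"
    using d
    by (simp add: N_def dag_minus dag_mult mat_alg pd_dag[OF I] pd_dag[OF C] JC' JC LCL mult_one_left mult_one_right)
      (intro eq_matI; simp del: index_mult_mat(1))
  hence "J - dag L * I * L = dag N * J * N + complex_of_real k \<cdot>\<^sub>m (dag (I * L) * (I * L))"
    using d by (intro eq_matI) (auto simp del: index_mult_mat(1))
  moreover have "psd n (dag N * J * N + complex_of_real k \<cdot>\<^sub>m (dag (I * L) * (I * L)))"
    by (intro psd_add psd_smult psd_conj[OF pd_psd[OF J]] psd_dag_mult[of _ m])
      (use k in \<open>auto simp: Nd d intro!: carrier_matI\<close>)
  ultimately show "psd n (minv C - dag L * minv M * L)" by (simp add: I_def J_def)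
qed

subsection \<open>Operator Jensen inequality\<close>

lemma operator_antimonotoneD:
  "operator_antimonotone f \<Longrightarrow> pd k A \<Longrightarrow> psd k (B - A) \<Longrightarrow> B \<in> carrier_mat k k \<Longrightarrow>
   psd k (matfun f A - matfun f B)"
  by (auto simp: operator_antimonotone_def loewner_le_def dest: pd_carrier)

text \<open>With \<open>P = W * dag W\<close> and \<open>Q = 1 - P\<close>, the off-diagonal blocks \<open>P * G * Q\<close> are absorbed into the
  diagonal ones by the square of \<open>c \<cdot> P - P * G * Q\<close>; the resulting \<open>Q\<close>-block is bounded by \<open>b \<cdot> Q\<close>.\<close>

lemma isometric_pinching_le:
  assumes G: "pd k G" and W: "W \<in> carrier_mat k l" "dag W * W = 1\<^sub>m l" and c: "c > 0"
  obtains b where "psd k (W * (dag W * G * W + complex_of_real c \<cdot>\<^sub>m 1\<^sub>m l) * dag W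
      + complex_of_real b \<cdot>\<^sub>m (1\<^sub>m k - W * dag W) - G)"
proof -
  define P where "P = W * dag W"
  have Pd: "dim_row P = k" "dim_col P = k" using W by (auto simp: P_def)
  note d = Pd pd_dims[OF G] carrier_matD[OF W(1)]
  have Pdag: "dag P = P" using W by (simp add: P_def dag_mult)
  have PP: "P * P = P"
  proof -
    have "P * P = W * (dag W * W) * dag W" using d by (simp add: P_def mult_assoc_dim)
    also have "\<dots> = P" unfolding W(2) using d by (simp add: P_def mult_one_right)
    finally show ?thesis .
  qed
  have PPX: "P * (P * X) = P * X" if "dim_row X = k" for X
    using that d by (simp add: mult_assoc_dim[symmetric] PP)
  have PGP: "W * (dag W * G * W + complex_of_real c \<cdot>\<^sub>m 1\<^sub>m l) * dag W = P * G * P + complex_of_real c \<cdot>\<^sub>m P"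
    using d by (simp add: P_def mat_alg mult_one_left)
  \<comment> \<open>Once \<open>dag N * N\<close> divided by \<open>c\<close> is split off, what
    remains besides \<open>b\<close> times \<open>Q\<close> is exactly \<open>- Q * H * Q\<close>;
    hence any upper bound \<open>b\<close> of \<open>H\<close> will do.\<close>
  define H where "H = G + complex_of_real (1 / c) \<cdot>\<^sub>m (G * P * G)"
  have "hermitian k H"
    using d pd_dag[OF G] Pdag unfolding H_def hermitian_def
    by (intro conjI carrier_matI) (simp_all add: dag_add dag_smult dag_mult mult_assoc_dim)
  then obtain b where b: "psd k (complex_of_real b \<cdot>\<^sub>m 1\<^sub>m k - H)" by (rule psd_shift_upper)
  have Hd: "dim_row H = k" "dim_col H = k" using d by (auto simp: H_def)
  define Q where "Q = 1\<^sub>m k - P"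
  have Qd: "dim_row Q = k" "dim_col Q = k" using d by (auto simp: Q_def)
  have Qdag: "dag Q = Q" using d by (simp add: Q_def dag_minus Pdag)
  define N where "N = complex_of_real c \<cdot>\<^sub>m P - P * G * Q"
  have Nd: "dim_row N = k" "dim_col N = k" using d Qd by (auto simp: N_def)
  have 1: "dag N * N = complex_of_real (c * c) \<cdot>\<^sub>m P - complex_of_real c \<cdot>\<^sub>m (P * G * Q)
      - complex_of_real c \<cdot>\<^sub>m (Q * G * P) + Q * G * P * G * Q"
    using d Qd by (simp add: N_def dag_minus dag_smult dag_mult Pdag Qdag pd_dag[OF G] mat_alg PPX PP)
      (intro eq_matI; simp del: index_mult_mat(1) add: algebra_simps)
  have 2: "G = P * G * P + P * G * Q + Q * G * P + Q * G * Q"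
    using d Qd unfolding Q_def by (simp add: mat_alg mult_one_left mult_one_right)
      (intro eq_matI; simp del: index_mult_mat(1) add: algebra_simps)
  have QQ: "Q * Q = Q"
    using d unfolding Q_def by (simp add: mat_alg mult_one_left mult_one_right PP)
      (intro eq_matI; simp del: index_mult_mat(1))
  have 3: "Q * (complex_of_real b \<cdot>\<^sub>m 1\<^sub>m k - H) * Q = complex_of_real b \<cdot>\<^sub>m Q - Q * G * Q
      - complex_of_real (1 / c) \<cdot>\<^sub>m (Q * G * P * G * Q)"
    using d Qd by (simp add: H_def mat_alg mult_one_left QQ)
      (intro eq_matI; simp del: index_mult_mat(1))
  have "P * G * P + complex_of_real c \<cdot>\<^sub>m P + complex_of_real b \<cdot>\<^sub>m Q - G
    = complex_of_real (1 / c) \<cdot>\<^sub>m (dag N * N) + Q * (complex_of_real b \<cdot>\<^sub>m 1\<^sub>m k - H) * Q"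
    unfolding 1 3
  proof (rule eq_matI, goal_cases)
    case (1 i j)
    hence ij: "i < k" "j < k" using Qd by auto
    have "G $$ (i,j) = (P * G * P + P * G * Q + Q * G * P + Q * G * Q) $$ (i,j)" by (simp flip: 2)
    thus ?case using ij d Qd c by (simp del: index_mult_mat(1) add: field_simps)
  qed (use d Qd in auto)
  moreover have "psd k (complex_of_real (1 / c) \<cdot>\<^sub>m (dag N * N) + Q * (complex_of_real b \<cdot>\<^sub>m 1\<^sub>m k - H) * Q)"
    using psd_conj[OF b, of Q k] c Nd Qd
    by (intro psd_add psd_smult psd_dag_mult[of _ k]) (auto simp: Qdag intro: carrier_matI)
  ultimately show ?thesis using that[of b] by (simp add: PGP P_def[symmetric] Q_def[symmetric])
qed

text \<open>The pinched matrix \<open>G'\<close> dominates \<open>G\<close>, so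
  \<open>matfun f G'\<close> lies below \<open>matfun f G\<close>. The range of \<open>W\<close> is
  invariant under \<open>G'\<close>, which acts there as \<open>D\<close>; compressing by
  \<open>W\<close> therefore turns \<open>matfun f G'\<close> into
  \<open>matfun f D\<close>.\<close>

theorem operator_jensen_isometry:
  assumes f: "operator_antimonotone f" and G: "pd k G"
    and W: "W \<in> carrier_mat k l" "dag W * W = 1\<^sub>m l" and c: "c > 0"
  shows "psd l (dag W * matfun f G * W - matfun f (dag W * G * W + complex_of_real c \<cdot>\<^sub>m 1\<^sub>m l))"
proof -
  define D where "D = dag W * G * W + complex_of_real c \<cdot>\<^sub>m 1\<^sub>m l"
  obtain b where b: "psd k (W * D * dag W + complex_of_real b \<cdot>\<^sub>m (1\<^sub>m k - W * dag W) - G)"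
    using isometric_pinching_le[OF G W c] unfolding D_def by blast
  define G' where "G' = W * D * dag W + complex_of_real b \<cdot>\<^sub>m (1\<^sub>m k - W * dag W)"
  note d = pd_dims[OF G] carrier_matD[OF W(1)]
  have Dd: "dim_row D = l" "dim_col D = l" using d by (auto simp: D_def)
  have G'd: "dim_row G' = k" "dim_col G' = k" using d by (auto simp: G'_def)
  have D: "hermitian l D"
    unfolding D_def
    by (intro hermitian_add hermitian_smult hermitian_one hermitian_conj[OF pd_hermitian[OF G] W(1)])
  have bb: "psd k (G' - G)" using b by (simp add: G'_def)
  have "G' = G + (G' - G)" using G'd d by (intro eq_matI) auto
  hence G': "pd k G'" using pd_add_psd[OF G bb] by simp
  have WWX: "dag W * (W * X) = X" if "dim_row X = l" for X
    using that d W(2) by (simp add: mult_assoc_dim[symmetric] mult_one_left)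
  have "G' * W = W * D"
    using d Dd by (simp add: G'_def mat_alg mult_one_left W(2) mult_one_right)
     (intro eq_matI; simp del: index_mult_mat(1))
  from matfun_intertwine[OF pd_hermitian[OF G'] D W(1) this]
  have fW: "matfun f G' * W = W * matfun f D" .
  have fd: "dim_row (matfun f D) = l" "dim_row (matfun f G') = k" "dim_col (matfun f G') = k"
     "dim_row (matfun f G) = k" "dim_col (matfun f G) = k"
    using hermitian_dims[OF hermitian_matfun[OF D]]
      hermitian_dims[OF hermitian_matfun[OF pd_hermitian[OF G']]]
      hermitian_dims[OF hermitian_matfun[OF pd_hermitian[OF G]]] by auto
  have "psd k (matfun f G - matfun f G')"
    by (rule operator_antimonotoneD[OF f G bb pd_carrier[OF G']])
  from psd_conj[OF this W(1)]
  have "psd l (dag W * matfun f G * W - dag W * (matfun f G' * W))"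
    using d fd by (simp add: mat_alg)
  thus ?thesis using d fd by (simp add: fW WWX flip: D_def)
qed

lemma mult_zero_right_dim: "dim_col A = n \<Longrightarrow> A * 0\<^sub>m n k = (0\<^sub>m (dim_row A) k :: complex mat)"
  by (intro eq_matI) (auto simp: scalar_prod_def)

lemma mult_zero_left_dim: "dim_row A = n \<Longrightarrow> 0\<^sub>m k n * A = (0\<^sub>m k (dim_col A) :: complex mat)"
  by (intro eq_matI) (auto simp: scalar_prod_def)

lemma index_dag_mult:
  "i < dim_col A \<Longrightarrow> j < dim_col B \<Longrightarrow> dim_row A = dim_row B \<Longrightarrow>
   (dag A * B) $$ (i,j) = (\<Sum>k<dim_row A. cnj (A $$ (k,i)) * B $$ (k,j))"
  by (auto simp: scalar_prod_def lessThan_atLeast0 intro!: sum.cong)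

text \<open>The two coordinate inclusions of a direct sum. Their relations replace block matrices,
  so that computations with dilations become plain rewriting.\<close>

lemma exists_orthogonal_embeddings:
  obtains E1 E2 :: "complex mat" where
    "E1 \<in> carrier_mat (n + m) n" "E2 \<in> carrier_mat (n + m) m"
    "dag E1 * E1 = 1\<^sub>m n" "dag E2 * E2 = 1\<^sub>m m" "dag E1 * E2 = 0\<^sub>m n m" "dag E2 * E1 = 0\<^sub>m m n"
    "E1 * dag E1 + E2 * dag E2 = 1\<^sub>m (n + m)"
proof -
  define E1 where "E1 = mat (n + m) n (\<lambda>(i,j). if i = j then 1 else 0 :: complex)"
  define E2 where "E2 = mat (n + m) m (\<lambda>(i,j). if i = n + j then 1 else 0 :: complex)"
  have Ed: "dim_row E1 = n + m" "dim_col E1 = n" "dim_row E2 = n + m" "dim_col E2 = m"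
    by (auto simp: E1_def E2_def)
  have 1: "dag E1 * E1 = 1\<^sub>m n"
  proof (rule eq_matI)
    fix i j assume "i < dim_row (1\<^sub>m n :: complex mat)" "j < dim_col (1\<^sub>m n :: complex mat)"
    hence ij: "i < n" "j < n" by auto
    have "(dag E1 * E1) $$ (i,j) = (\<Sum>k<n + m. cnj (E1 $$ (k,i)) * E1 $$ (k,j))"
      using ij index_dag_mult[of i E1 j E1] by (simp add: Ed del: index_mult_mat(1))
    also have "\<dots> = (\<Sum>k<n + m. if k = i then (if i = j then 1 else 0) else 0)"
      using ij by (intro sum.cong) (auto simp: E1_def E2_def)
    finally show "(dag E1 * E1) $$ (i,j) = 1\<^sub>m n $$ (i,j)"
      using ij by (simp del: index_mult_mat(1))
  qed (auto simp: E1_def E2_def)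
  have 2: "dag E2 * E2 = 1\<^sub>m m"
  proof (rule eq_matI)
    fix i j assume "i < dim_row (1\<^sub>m m :: complex mat)" "j < dim_col (1\<^sub>m m :: complex mat)"
    hence ij: "i < m" "j < m" by auto
    have "(dag E2 * E2) $$ (i,j) = (\<Sum>k<n + m. cnj (E2 $$ (k,i)) * E2 $$ (k,j))"
      using ij index_dag_mult[of i E2 j E2] by (simp add: Ed del: index_mult_mat(1))
    also have "\<dots> = (\<Sum>k<n + m. if k = n + i then (if i = j then 1 else 0) else 0)"
      using ij by (intro sum.cong) (auto simp: E1_def E2_def)
    finally show "(dag E2 * E2) $$ (i,j) = 1\<^sub>m m $$ (i,j)"
      using ij by (simp del: index_mult_mat(1))
  qed (auto simp: E1_def E2_def)
  have 3: "dag E1 * E2 = 0\<^sub>m n m"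
  proof (rule eq_matI)
    fix i j assume "i < dim_row (0\<^sub>m n m :: complex mat)" "j < dim_col (0\<^sub>m n m :: complex mat)"
    hence ij: "i < n" "j < m" by auto
    have "(dag E1 * E2) $$ (i,j) = (\<Sum>k<n + m. cnj (E1 $$ (k,i)) * E2 $$ (k,j))"
      using ij index_dag_mult[of i E1 j E2] by (simp add: Ed del: index_mult_mat(1))
    also have "\<dots> = (\<Sum>k<n + m. if k = i then 0 else 0)"
      using ij by (intro sum.cong) (auto simp: E1_def E2_def)
    finally show "(dag E1 * E2) $$ (i,j) = 0\<^sub>m n m $$ (i,j)"
      using ij by (simp del: index_mult_mat(1))
  qed (auto simp: E1_def E2_def)
  have 4: "dag E2 * E1 = 0\<^sub>m m n"
  proof (rule eq_matI)
    fix i j assume "i < dim_row (0\<^sub>m m n :: complex mat)" "j < dim_col (0\<^sub>m m n :: complex mat)"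
    hence ij: "i < m" "j < n" by auto
    have "(dag E2 * E1) $$ (i,j) = (\<Sum>k<n + m. cnj (E2 $$ (k,i)) * E1 $$ (k,j))"
      using ij index_dag_mult[of i E2 j E1] by (simp add: Ed del: index_mult_mat(1))
    also have "\<dots> = (\<Sum>k<n + m. if k = n + i then 0 else 0)"
      using ij by (intro sum.cong) (auto simp: E1_def E2_def)
    finally show "(dag E2 * E1) $$ (i,j) = 0\<^sub>m m n $$ (i,j)"
      using ij by (simp del: index_mult_mat(1))
  qed (auto simp: E1_def E2_def)
  have 5: "E1 * dag E1 + E2 * dag E2 = 1\<^sub>m (n + m)"
  proof (rule eq_matI)
    fix i j assume "i < dim_row (1\<^sub>m (n + m) :: complex mat)" "j < dim_col (1\<^sub>m (n + m) :: complex mat)"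
    hence ij: "i < n + m" "j < n + m" by auto
    have e1: "(E1 * dag E1) $$ (i,j) = (\<Sum>k<n. if k = i then (if i = j then 1 else 0) else 0)"
    proof -
      have "(E1 * dag E1) $$ (i,j) = (\<Sum>k<n. E1 $$ (i,k) * cnj (E1 $$ (j,k)))"
        using ij index_dag_mult[of i "dag E1" j "dag E1"] by (simp add: Ed del: index_mult_mat(1))
      also have "\<dots> = (\<Sum>k<n. if k = i then (if i = j then 1 else 0) else 0)"
        using ij by (intro sum.cong) (auto simp: E1_def)
      finally show ?thesis .
    qed
    \<comment> \<open>The subtraction \<open>i - n\<close> is truncated; for \<open>i < n\<close>
      the guard \<open>n \<le> i\<close> makes the selected term 0.\<close>
    have e2: "(E2 * dag E2) $$ (i,j) = (\<Sum>k<m. if k = i - n then (if i = j \<and> n \<le> i then 1 else 0) else 0)"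
    proof -
      have "(E2 * dag E2) $$ (i,j) = (\<Sum>k<m. E2 $$ (i,k) * cnj (E2 $$ (j,k)))"
        using ij index_dag_mult[of i "dag E2" j "dag E2"] by (simp add: Ed del: index_mult_mat(1))
      also have "\<dots> = (\<Sum>k<m. if k = i - n then (if i = j \<and> n \<le> i then 1 else 0) else 0)"
        using ij by (intro sum.cong) (auto simp: E2_def)
      finally show ?thesis .
    qed
    show "(E1 * dag E1 + E2 * dag E2) $$ (i,j) = 1\<^sub>m (n + m) $$ (i,j)"
      using ij by (simp add: Ed e1 e2 del: index_mult_mat(1)) auto
  qed (auto simp: E1_def E2_def)
  show ?thesis by (rule that[OF _ _ 1 2 3 4 5]) (auto simp: E1_def E2_def)
qed

lemma operator_antimonotone_pd_le:
  assumes "operator_antimonotone f" "pd k A" "psd k (B - A)" "B \<in> carrier_mat k k" "v \<in> carrier_vec k"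
  shows "Re (cinner v (matfun f B *\<^sub>v v)) \<le> Re (cinner v (matfun f A *\<^sub>v v))"
proof -
  have "B = A + (B - A)" using assms pd_dims[OF assms(2)] by (intro eq_matI) auto
  hence B: "pd k B" using pd_add_psd[OF assms(2,3)] by simp
  note d = hermitian_dims[OF hermitian_matfun[OF pd_hermitian[OF assms(2)]]]
      hermitian_dims[OF hermitian_matfun[OF pd_hermitian[OF B]]]
  from psd_quad[OF operator_antimonotoneD[OF assms(1-4)], of v] show ?thesis
    using d assms(5) by (simp add: minus_mult_vec_dim cinner_minus_right)
qed

text \<open>\<open>T\<close> is dilated to the isometry \<open>W = (T, S)\<close> with \<open>S\<^sup>2 = 1 - dag T * T\<close>. Since \<open>T\<close> preserves the
  norm of \<open>v\<close>, \<open>S\<close> annihilates \<open>v\<close>, so the second summand of the dilation does not contribute.\<close>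

theorem operator_jensen_contraction:
  assumes f: "operator_antimonotone f" and A: "pd n A" and D: "D \<in> carrier_mat m m"
    and T: "T \<in> carrier_mat n m" and contr: "psd m (1\<^sub>m m - dag T * T)"
    and g: "g > 0" and le: "psd m (D - (dag T * A * T + complex_of_real g \<cdot>\<^sub>m 1\<^sub>m m))"
    and v: "v \<in> carrier_vec m" and iso: "Re (cinner (T *\<^sub>v v) (T *\<^sub>v v)) = Re (cinner v v)"
  shows "Re (cinner v (matfun f D *\<^sub>v v)) \<le> Re (cinner (T *\<^sub>v v) (matfun f A *\<^sub>v (T *\<^sub>v v)))"
proof -
  \<comment> \<open>The slack \<open>g\<close> is spent twice: one half is the second block of the
    dilated matrix \<open>G\<close>, the other half is the slack of the isometric
    inequality.\<close>
  define c where "c = g / 2"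
  have c: "c > 0" using g by (simp add: c_def)
  define S where "S = sqrtm (1\<^sub>m m - dag T * T)"
  have S: "psd m S" unfolding S_def by (rule psd_sqrtm[OF contr])
  have SS: "S * S = 1\<^sub>m m - dag T * T" unfolding S_def by (rule sqrtm_square[OF contr])
  have Sdag: "dag S = S" by (rule psd_dag[OF S])
  note d = pd_dims[OF A] carrier_matD[OF T] psd_dims[OF S] carrier_matD[OF D]
  have vd: "dim_vec v = m" using v by simp
  have "Re (cinner (S *\<^sub>v v) (S *\<^sub>v v)) = Re (cinner v ((dag S * S) *\<^sub>v v))"
    using d vd by (simp add: cinner_dag_mult)
  also have "\<dots> = 0"
    using d v iso
    by (simp add: Sdag SS minus_mult_vec_dim cinner_minus_right cinner_dag_mult)
  finally have Sv: "S *\<^sub>v v = 0\<^sub>v m" using d by (simp add: cinner_self_eq_0)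
  obtain E1 E2 :: "complex mat" where E: "E1 \<in> carrier_mat (n + m) n" "E2 \<in> carrier_mat (n + m) m"
    and EE: "dag E1 * E1 = 1\<^sub>m n" "dag E2 * E2 = 1\<^sub>m m" "dag E1 * E2 = 0\<^sub>m n m" "dag E2 * E1 = 0\<^sub>m m n"
    and Es: "E1 * dag E1 + E2 * dag E2 = 1\<^sub>m (n + m)"
    by (rule exists_orthogonal_embeddings)
  note d = d carrier_matD[OF E(1)] carrier_matD[OF E(2)]
  have EX: "dim_row X = n \<Longrightarrow> dag E1 * (E1 * X) = X" "dim_row X = m \<Longrightarrow> dag E2 * (E2 * X) = X"
    "dim_row X = m \<Longrightarrow> dag E1 * (E2 * X) = 0\<^sub>m n (dim_col X)"
    "dim_row X = n \<Longrightarrow> dag E2 * (E1 * X) = 0\<^sub>m m (dim_col X)" for X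
    using d EE by (simp_all add: mult_assoc_dim[symmetric] mult_one_left mult_zero_left_dim)
  \<comment> \<open>The direct sum of \<open>A\<close> and the scalar \<open>c\<close>.
    Anti-monotonicity is available only for positive definite matrices, so the second block cannot
    be 0.\<close>
  define G where "G = E1 * A * dag E1 + complex_of_real c \<cdot>\<^sub>m (E2 * dag E2)"
  define W where "W = E1 * T + E2 * S"
  have Wc: "W \<in> carrier_mat (n + m) m" using d by (intro carrier_matI) (auto simp: W_def)
  have p1: "psd (n + m) (E1 * A * dag E1)" using psd_conj[OF pd_psd[OF A], of "dag E1" "n + m"] E by simp
  have p2: "psd (n + m) (E2 * dag E2)" using psd_dag_mult[of "dag E2" m "n + m"] E by simp
  have G: "pd (n + m) G"
  proof (rule pd_psd_inj)
    show pG: "psd (n + m) G" unfolding G_def using c by (intro psd_add p1 psd_smult p2) simp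
    fix x assume x: "x \<in> carrier_vec (n + m)" "G *\<^sub>v x = 0\<^sub>v (n + m)"
    have xd: "dim_vec x = n + m" using x by simp
    have "Re (cinner x (G *\<^sub>v x)) = Re (cinner (dag E1 *\<^sub>v x) (A *\<^sub>v (dag E1 *\<^sub>v x)))
        + c * Re (cinner (dag E2 *\<^sub>v x) (dag E2 *\<^sub>v x))"
      using d xd quad_conj[of x "dag E1" A] cinner_dag_mult[of x "dag E2"]
      by (simp add: G_def add_mult_vec_dim smult_mult_vec_dim cinner_add_right cinner_smult_right)
    moreover have "Re (cinner x (G *\<^sub>v x)) = 0" using x xd by (simp add: cinner_def)
    moreover have "0 \<le> Re (cinner (dag E1 *\<^sub>v x) (A *\<^sub>v (dag E1 *\<^sub>v x)))"
      by (rule psd_quad[OF pd_psd[OF A]]) (simp add: d)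
    moreover have "0 \<le> c * Re (cinner (dag E2 *\<^sub>v x) (dag E2 *\<^sub>v x))" using c by simp
    ultimately have z: "Re (cinner (dag E1 *\<^sub>v x) (A *\<^sub>v (dag E1 *\<^sub>v x))) = 0"
      "c * Re (cinner (dag E2 *\<^sub>v x) (dag E2 *\<^sub>v x)) = 0" by linarith+
    have e1: "dag E1 *\<^sub>v x = 0\<^sub>v n"
      using pd_quad[OF A, of "dag E1 *\<^sub>v x"] z(1) d by fastforce
    have e2: "dag E2 *\<^sub>v x = 0\<^sub>v m"
      using z(2) c d cinner_self_eq_0[of "dag E2 *\<^sub>v x"] by simp
    have "x = (E1 * dag E1 + E2 * dag E2) *\<^sub>v x" using x by (simp add: Es)
    also have "\<dots> = 0\<^sub>v (n + m)"
      using d xd by (simp add: add_mult_vec_dim mult_vec_assoc_dim e1 e2 mult_zero_vec_dim)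
    finally show "x = 0\<^sub>v (n + m)" .
  qed
  have WW: "dag W * W = 1\<^sub>m m"
    using d by (simp add: W_def dag_add dag_mult mat_alg EX Sdag mult_zero_right_dim SS)
      (intro eq_matI; simp del: index_mult_mat(1))
  have "dag W * G * W = dag T * A * T + complex_of_real c \<cdot>\<^sub>m (S * S)"
    using d by (simp add: G_def W_def dag_add dag_mult mat_alg EX EE Sdag mult_zero_right_dim mult_one_right)
      (intro eq_matI; simp del: index_mult_mat(1))
  hence WGW: "dag W * G * W + complex_of_real c \<cdot>\<^sub>m 1\<^sub>m m
      = dag T * A * T + complex_of_real c \<cdot>\<^sub>m (1\<^sub>m m - dag T * T) + complex_of_real c \<cdot>\<^sub>m 1\<^sub>m m" (is "_ = ?D'")
    by (simp add: SS)
  have D': "pd m ?D'"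
  proof -
    have p: "psd m (dag T * A * T + complex_of_real c \<cdot>\<^sub>m (1\<^sub>m m - dag T * T))"
      using c by (intro psd_add psd_smult psd_conj[OF pd_psd[OF A] T] contr) simp
    show ?thesis
      using pd_add_psd[OF pd_smult[OF pd_one c] p] comm_add_mat[OF psd_carrier[OF p], of "complex_of_real c \<cdot>\<^sub>m 1\<^sub>m m"]
      by simp
  qed
  \<comment> \<open>The second block contributes \<open>c\<close> times \<open>1 - dag T * T\<close>
    rather than \<open>c\<close>, so the bound holds with \<open>c\<close> times
    \<open>dag T * T\<close> to spare.\<close>
  have "D - ?D' = (D - (dag T * A * T + complex_of_real g \<cdot>\<^sub>m 1\<^sub>m m)) + complex_of_real c \<cdot>\<^sub>m (dag T * T)"
    using d by (intro eq_matI) (auto simp: c_def field_simps simp del: index_mult_mat(1))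
  moreover have "psd m \<dots>" using c by (intro psd_add le psd_smult psd_dag_mult[OF T]) simp
  ultimately have "psd m (D - ?D')" by simp
  from operator_antimonotone_pd_le[OF f D' this D v]
  have "Re (cinner v (matfun f D *\<^sub>v v)) \<le> Re (cinner v (matfun f ?D' *\<^sub>v v))" .
  also have "\<dots> \<le> Re (cinner v ((dag W * matfun f G * W) *\<^sub>v v))"
    using psd_quad[OF operator_jensen_isometry[OF f G Wc WW c], of v] vd d
      hermitian_dims[OF hermitian_matfun[OF pd_hermitian[OF D']], of f]
    by (simp add: WGW minus_mult_vec_dim cinner_minus_right carrier_matD[OF Wc])
  also have "\<dots> = Re (cinner (W *\<^sub>v v) (matfun f G *\<^sub>v (W *\<^sub>v v)))"
    using vd Wc hermitian_dims[OF hermitian_matfun[OF pd_hermitian[OF G]], of f]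
    by (simp add: quad_conj)
  also have "W *\<^sub>v v = E1 *\<^sub>v (T *\<^sub>v v)"
    using d vd by (simp add: W_def add_mult_vec_dim mult_vec_assoc_dim Sv mult_zero_vec_dim)
       (intro eq_vecI; simp)
  also have "cinner \<dots> (matfun f G *\<^sub>v \<dots>) = cinner (T *\<^sub>v v) (matfun f A *\<^sub>v (T *\<^sub>v v))"
  proof -
    \<comment> \<open>The first summand is invariant under \<open>G\<close>, so a function of
      \<open>G\<close> acts there as the same function of \<open>A\<close>.\<close>
    have "G * E1 = E1 * A"
      using d by (simp add: G_def mat_alg EX EE mult_zero_right_dim mult_one_right)
        (intro eq_matI; simp del: index_mult_mat(1))
    from matfun_intertwine[OF pd_hermitian[OF G] pd_hermitian[OF A] E(1) this]
    have fE: "matfun f G * E1 = E1 * matfun f A" .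
    note fd = hermitian_dims[OF hermitian_matfun[OF pd_hermitian[OF G]], of f]
      hermitian_dims[OF hermitian_matfun[OF pd_hermitian[OF A]], of f]
    have "matfun f G *\<^sub>v (E1 *\<^sub>v (T *\<^sub>v v)) = E1 *\<^sub>v (matfun f A *\<^sub>v (T *\<^sub>v v))"
      using d fd arg_cong[OF fE, of "\<lambda>M. M *\<^sub>v (T *\<^sub>v v)"] by (simp add: mult_vec_assoc_dim)
    moreover have "cinner (E1 *\<^sub>v x) (E1 *\<^sub>v y) = cinner x y"
      if "x \<in> carrier_vec n" "y \<in> carrier_vec n" for x y
    proof -
      have "cinner x ((dag E1 * E1) *\<^sub>v y) = cinner (E1 *\<^sub>v x) (E1 *\<^sub>v y)"
        using d that by (simp add: mult_vec_assoc_dim cinner_adjoint[of x "dag E1"] del: EE)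
      thus ?thesis using that EE(1) by simp
    qed
    moreover have "T *\<^sub>v v \<in> carrier_vec n" "matfun f A *\<^sub>v (T *\<^sub>v v) \<in> carrier_vec n"
      using d fd by (auto intro: carrier_vecI)
    ultimately show ?thesis by simp
  qed
  finally show ?thesis .
qed

subsection \<open>Right continuity of operator anti-monotone functions\<close>

lemma unitary_one: "unitary n (1\<^sub>m n)"
  by (simp add: unitary_def)

text \<open>\<open>matfun\<close> uses a decomposition picked by \<open>SOME\<close>. Intertwining
  the chosen and the given one by the identity shows that both yield the same value.\<close>

lemma matfun_unitary_diag:
  assumes U: "unitary n U"
  shows "matfun f (U * mat_diag n (\<lambda>i. complex_of_real (d i)) * dag U) =
    U * mat_diag n (\<lambda>i. complex_of_real (f (d i))) * dag U" (is "matfun f ?A = ?B")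
proof -
  obtain V e where V: "unitary n V" "?A = V * mat_diag n (\<lambda>i. complex_of_real (e i)) * dag V"
    "\<And>f. matfun f ?A = V * mat_diag n (\<lambda>i. complex_of_real (f (e i))) * dag V"
    using matfun_spectral_choice[OF hermitian_unitary_diag[OF U, of d]] by metis
  note dU = unitary_dims[OF U] unitary_dims[OF V(1)]
  have "?B * 1\<^sub>m n = 1\<^sub>m n * (V * mat_diag n (\<lambda>i. complex_of_real (f (e i))) * dag V)"
    by (rule spectral_intertwine[OF U V(1)])
      (use V(2) in \<open>simp_all add: mult_one_left mult_one_right dU\<close>)
  thus ?thesis by (simp add: V(3) mult_one_left mult_one_right dU)
qed

lemma matfun_mat_diag:
  "matfun f (mat_diag n (\<lambda>i. complex_of_real (d i))) = mat_diag n (\<lambda>i. complex_of_real (f (d i)))"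
  using matfun_unitary_diag[OF unitary_one, of f n d] by (simp add: mult_one_left mult_one_right)

lemma matfun_scalar:
  "matfun f (complex_of_real x \<cdot>\<^sub>m 1\<^sub>m n) = complex_of_real (f x) \<cdot>\<^sub>m 1\<^sub>m n"
  using matfun_mat_diag[of f n "\<lambda>_. x"] by (simp add: mat_diag_const)

lemma pd_mat_diag:
  assumes "\<And>i. i < n \<Longrightarrow> 0 < d i"
  shows "pd n (mat_diag n (\<lambda>i. complex_of_real (d i)))"
proof -
  define c where "c = Min (insert 1 (d ` {..<n}))"
  have c: "c > 0" "\<And>i. i < n \<Longrightarrow> c \<le> d i" using assms by (auto simp: c_def)
  have "mat_diag n (\<lambda>i. complex_of_real (d i)) =
      complex_of_real c \<cdot>\<^sub>m 1\<^sub>m n + mat_diag n (\<lambda>i. complex_of_real (d i - c))"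
    by (intro eq_matI) (auto simp: mat_diag_def)
  thus ?thesis
    using pd_add_psd[OF pd_smult[OF pd_one c(1)] psd_mat_diag[of n "\<lambda>i. d i - c"]] c(2) by simp
qed

lemma antimonotone_scalar:
  assumes f: "operator_antimonotone f" and "0 < x" "x \<le> y"
  shows "f y \<le> f x"
proof -
  have eq: "complex_of_real y \<cdot>\<^sub>m 1\<^sub>m 1 - complex_of_real x \<cdot>\<^sub>m 1\<^sub>m 1 = complex_of_real (y - x) \<cdot>\<^sub>m 1\<^sub>m 1"
    by (intro eq_matI) (auto simp: algebra_simps)
  have "psd 1 (complex_of_real (y - x) \<cdot>\<^sub>m 1\<^sub>m 1)" using assms by (intro psd_smult psd_one) simp
  from operator_antimonotoneD[OF f pd_smult[OF pd_one assms(2)], of 1 "complex_of_real y \<cdot>\<^sub>m 1\<^sub>m 1", unfolded eq, OF this]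
  have "psd 1 (complex_of_real (f x) \<cdot>\<^sub>m 1\<^sub>m 1 - complex_of_real (f y) \<cdot>\<^sub>m 1\<^sub>m 1)"
    by (simp add: matfun_scalar)
  from psd_diag[OF this, of 0] show ?thesis by simp
qed

text \<open>The Jensen inequality for the isometry into dimension two with both entries
  \<open>1 / sqrt 2\<close>, which compresses the diagonal matrix of \<open>x\<close> and
  \<open>y\<close> to their mean; \<open>c\<close> is the slack of that inequality.\<close>

lemma antimonotone_midpoint:
  assumes f: "operator_antimonotone f" and x: "0 < x" and y: "0 < y" and c: "0 < c"
  shows "f ((x + y) / 2 + c) \<le> (f x + f y) / 2"
proof -
  define d where "d i = (if i = (0::nat) then x else y)" for i
  define w where "w = complex_of_real (1 / sqrt 2)"
  have w: "cnj w * w = 1 / 2" "w * w = 1/2" "cnj w = w"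
    by (auto simp: w_def simp flip: of_real_mult)
  have t: "cnj w * (z * w) = z / 2" for z
  proof -
    have "cnj w * (z * w) = z * (cnj w * w)" by (simp only: mult.left_commute)
    thus ?thesis by (simp add: w(1))
  qed
  define W where "W = mat 2 1 (\<lambda>_. w)"
  have Wc: "W \<in> carrier_mat 2 1" by (simp add: W_def)
  have ent: "(dag W * mat_diag 2 (\<lambda>i. complex_of_real (e i)) * W) $$ (0,0) = complex_of_real ((e 0 + e 1) / 2)" for e
  proof -
    have "dag W * mat_diag 2 (\<lambda>i. complex_of_real (e i)) * W =
       dag W * mat 2 1 (\<lambda>(i,j). complex_of_real (e i) * W $$ (i,j))"
      using Wc by (simp add: mult_assoc_dim mat_diag_mult_left[OF Wc])
    also have "\<dots> $$ (0,0) = (\<Sum>k<2. cnj w * (complex_of_real (e k) * w))"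
      by (subst index_dag_mult) (auto simp: W_def intro!: sum.cong)
    also have "\<dots> = complex_of_real ((e 0 + e 1) / 2)"
      by (simp add: numeral_2_eq_2 t add_divide_distrib)
    finally show ?thesis .
  qed
  have WW: "dag W * W = 1\<^sub>m 1"
    using ent[of "\<lambda>_. 1"] Wc by (intro eq_matI) (auto simp: mat_diag_one mult_one_right simp del: index_mult_mat(1))
  have D: "dag W * mat_diag 2 (\<lambda>i. complex_of_real (d i)) * W + complex_of_real c \<cdot>\<^sub>m 1\<^sub>m 1
      = complex_of_real ((x + y) / 2 + c) \<cdot>\<^sub>m 1\<^sub>m 1"
    using ent[of d] Wc by (intro eq_matI) (auto simp: d_def simp del: index_mult_mat(1))
  have "pd 2 (mat_diag 2 (\<lambda>i. complex_of_real (d i)))" using x y by (intro pd_mat_diag) (simp add: d_def)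
  from psd_diag[OF operator_jensen_isometry[OF f this Wc WW c], of 0]
  have "0 \<le> Re ((dag W * mat_diag 2 (\<lambda>i. complex_of_real (f (d i))) * W) $$ (0,0)) - f ((x + y) / 2 + c)"
    using Wc unfolding D matfun_scalar matfun_mat_diag by (simp del: index_mult_mat(1))
  thus ?thesis by (subst (asm) ent) (simp add: d_def)
qed

text \<open>Monotonicity alone would allow a jump at \<open>x\<close>; approximate midpoint
  convexity excludes it, provided that the slack shrinks with the step \<open>h\<close>.\<close>

lemma antimonotone_right_tendsto:
  assumes f: "operator_antimonotone f" and x: "0 < x"
  shows "((\<lambda>r. f (r * x)) \<longlongrightarrow> f x) (at_right 1)"
proof (rule tendstoI)
  fix e :: real assume e: "e > 0"
  \<comment> \<open>The midpoint inequality with slack gives \<open>g h \<le> g (3 * h) / 2\<close>, hence left continuity at \<open>x\<close>,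
    and bounds the drop to the right of \<open>x\<close> by \<open>g\<close>.\<close>
  define g where "g h = f (x - h) - f x" for h
  have g1: "g h \<le> g (3 * h) / 2" if "0 < h" "3 * h < x" for h
  proof -
    \<comment> \<open>The midpoint lies \<open>3 * h / 2\<close> to the left of \<open>x\<close>;
      the slack \<open>h / 2\<close> moves it to \<open>x - h\<close>.\<close>
    have "(x - 3 * h + x) / 2 + h / 2 = x - h" by (simp add: field_simps)
    thus ?thesis using antimonotone_midpoint[OF f, of "x - 3 * h" x "h / 2"] x that by (simp add: g_def)
  qed
  have g2: "f x - f (x + h) \<le> g (2 * h)" if "0 < h" "2 * h < x" for h
  proof -
    \<comment> \<open>The points are chosen so that midpoint plus slack is exactly
      \<open>x\<close>.\<close>
    have "(x - 2 * h + (x + h)) / 2 + h / 2 = x" by (simp add: field_simps)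
    thus ?thesis using antimonotone_midpoint[OF f, of "x - 2 * h" "x + h" "h / 2"] x that by (simp add: g_def)
  qed
  \<comment> \<open>Each division of the step by 3 halves the bound, so \<open>g\<close> becomes
    arbitrarily small along this sequence.\<close>
  have gk: "g (x / 2 / 3 ^ k) \<le> g (x / 2) * (1 / 2) ^ k" for k
  proof (induction k)
    case (Suc k)
    have "x / 2 / 3 ^ k \<le> x / 2" using x by (simp add: divide_le_eq)
    hence "g (x / 2 / 3 ^ Suc k) \<le> g (x / 2 / 3 ^ k) / 2"
      using g1[of "x / 2 / 3 ^ Suc k"] x by simp
    thus ?case using Suc by simp
  qed simp
  have g0: "g (x / 2) \<ge> 0"
    using antimonotone_scalar[OF f, of "x / 2" x] x by (simp add: g_def)
  obtain k where k: "(1 / 2 :: real) ^ k < e / (g (x / 2) + 1)"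
    using real_arch_pow_inv[of "e / (g (x / 2) + 1)" "1 / 2"] e g0 by auto
  have "g (x / 2) * (1 / 2) ^ k \<le> (g (x / 2) + 1) * (1 / 2) ^ k" by (simp add: mult_right_mono)
  also have "\<dots> < e" using k g0 by (simp add: field_simps)
  finally have ge: "g (x / 2 / 3 ^ k) < e" using gk[of k] by simp
  define h where "h = x / 4 / 3 ^ k"
  have h: "0 < h" "2 * h = x / 2 / 3 ^ k" "2 * h < x"
  proof -
    show "0 < h" "2 * h = x / 2 / 3 ^ k" using x by (auto simp: h_def)
    have "x / 2 / 3 ^ k \<le> x / 2" using x by (simp add: divide_le_eq)
    thus "2 * h < x" using x \<open>2 * h = _\<close> by simp
  qed
  have fe: "f x - f (x + h) < e" using g2[OF h(1,3)] ge h(2) by simp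
  show "eventually (\<lambda>r. dist (f (r * x)) (f x) < e) (at_right 1)"
    unfolding eventually_at_right_field
  proof (intro exI[of _ "1 + h / x"] conjI allI impI)
    show "1 < 1 + h / x" using h x by simp
    fix r assume r: "1 < r" "r < 1 + h / x"
    have "x \<le> r * x" "r * x \<le> x + h" using r x by (auto simp: field_simps)
    hence "f (x + h) \<le> f (r * x)" "f (r * x) \<le> f x"
      using antimonotone_scalar[OF f, of "r * x" "x + h"] antimonotone_scalar[OF f, of x "r * x"] x by auto
    thus "dist (f (r * x)) (f x) < e" using fe by (simp add: dist_real_def)
  qed
qed

lemma mat_diag_mult_vec: "i < n \<Longrightarrow> dim_vec v = n \<Longrightarrow> (mat_diag n d *\<^sub>v v) $ i = d i * (v $ i :: complex)"
proof -
  assume i: "i < n" and v: "dim_vec v = n"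
  have "(mat_diag n d *\<^sub>v v) $ i = (\<Sum>k = 0..<n. mat_diag n d $$ (i,k) * v $ k)"
    using i v by (simp add: scalar_prod_def)
  also have "\<dots> = (\<Sum>k = 0..<n. if k = i then d i * v $ i else 0)"
    using i by (intro sum.cong) (auto simp: mat_diag_def)
  finally show ?thesis using i by simp
qed

text \<open>In an eigenbasis of \<open>D\<close> the quadratic form is a finite sum of values of f
  at \<open>r * d i\<close> with fixed weights, so the scalar limit can be taken term by
  term.\<close>

lemma matfun_quad_right_tendsto:
  assumes f: "operator_antimonotone f" and D: "pd k D" and v: "v \<in> carrier_vec k"
  shows "((\<lambda>r. Re (cinner v (matfun f (complex_of_real r \<cdot>\<^sub>m D) *\<^sub>v v)))
    \<longlongrightarrow> Re (cinner v (matfun f D *\<^sub>v v))) (at_right 1)"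
proof -
  obtain U d where 1: "unitary k U" "\<And>i. i < k \<Longrightarrow> 0 < d i"
    "D = U * mat_diag k (\<lambda>i. complex_of_real (d i)) * dag U"
    using pd_spectral[OF D] by metis
  note dims = unitary_dims[OF 1(1)]
  define w where "w = dag U *\<^sub>v v"
  have quad: "Re (cinner v ((U * mat_diag k (\<lambda>i. complex_of_real (e i)) * dag U) *\<^sub>v v))
      = (\<Sum>i<k. e i * (cmod (w $ i))\<^sup>2)" for e
  proof -
    have "cinner v ((dag (dag U) * mat_diag k (\<lambda>i. complex_of_real (e i)) * dag U) *\<^sub>v v)
      = cinner w (mat_diag k (\<lambda>i. complex_of_real (e i)) *\<^sub>v w)"
      unfolding w_def using v dims by (intro quad_conj) auto
    also have "\<dots> = (\<Sum>i<k. cnj (w $ i) * (complex_of_real (e i) * w $ i))"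
      using dims by (auto simp: cinner_def w_def mat_diag_mult_vec simp del: index_mult_mat_vec intro!: sum.cong)
    also have "Re \<dots> = (\<Sum>i<k. e i * (cmod (w $ i))\<^sup>2)"
      unfolding Re_sum by (intro sum.cong refl, simp add: cmod_power2)
        (simp add: power2_eq_square algebra_simps)
    finally show ?thesis by simp
  qed
  have rD: "complex_of_real r \<cdot>\<^sub>m D = U * mat_diag k (\<lambda>i. complex_of_real (r * d i)) * dag U" for r
    using dims by (simp add: 1(3) mat_diag_smult mult_smult_left_dim mult_smult_right_dim)
  have "((\<lambda>r. \<Sum>i<k. f (r * d i) * (cmod (w $ i))\<^sup>2) \<longlongrightarrow> (\<Sum>i<k. f (d i) * (cmod (w $ i))\<^sup>2)) (at_right 1)"
    by (intro tendsto_sum tendsto_mult tendsto_const antimonotone_right_tendsto[OF f]) (use 1(2) in auto)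
  thus ?thesis
    unfolding rD matfun_unitary_diag[OF 1(1)] quad
    by (simp add: 1(3) matfun_unitary_diag[OF 1(1)] quad)
qed

subsection \<open>Vectorisation and Kronecker products\<close>

text \<open>Row-major vectorisation. It matches \<open>kron\<close> and \<open>Gamma\<close>, where
  the quotient of an index belongs to the first factor and the remainder to the second.\<close>

definition mvec :: "nat \<Rightarrow> complex mat \<Rightarrow> complex vec" where
  "mvec n W = vec (n * n) (\<lambda>k. W $$ (k div n, k mod n))"

lemma dim_mvec [simp]: "dim_vec (mvec n W) = n * n"
  by (simp add: mvec_def)

lemma mvec_carrier: "mvec n W \<in> carrier_vec (n * n)"
  by (simp add: mvec_def)

lemma div_mod_less: "(k::nat) < n * n \<Longrightarrow> k div n < n \<and> k mod n < n"
  by (cases "n = 0") (auto simp: less_mult_imp_div_less)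

lemma mvec_surj:
  assumes "v \<in> carrier_vec (n * n)"
  obtains W where "W \<in> carrier_mat n n" "v = mvec n W"
proof
  show "v = mvec n (mat n n (\<lambda>(i,j). v $ (i * n + j)))"
    using assms by (intro eq_vecI) (auto simp: mvec_def div_mod_less)
qed simp

lemma mvec_inj:
  assumes "mvec n V = mvec n W" "V \<in> carrier_mat n n" "W \<in> carrier_mat n n"
  shows "V = W"
proof (rule eq_matI)
  fix i j assume "i < dim_row W" "j < dim_col W"
  hence ij: "i < n" "j < n" using assms by auto
  have "i * n + j < n * n"
  proof -
    have "i * n + j < Suc i * n" using ij by simp
    also have "\<dots> \<le> n * n" using ij by (intro mult_right_mono) auto
    finally show ?thesis .
  qed
  hence "mvec n M $ (i * n + j) = M $$ (i,j)" for M using ij by (simp add: mvec_def)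
  thus "V $$ (i,j) = W $$ (i,j)" using assms(1) by metis
qed (use assms in auto)

lemma sum_div_mod:
  fixes n m :: nat
  shows "(\<Sum>k<n * m. g (k div m) (k mod m)) = (\<Sum>i<n. \<Sum>j<m. (g i j :: complex))"
proof -
  have "(\<Sum>k<n * m. g (k div m) (k mod m)) = (\<Sum>i<n. \<Sum>k\<in>{i * m..<i * m + m}. g (k div m) (k mod m))"
    by (rule sum.nat_group[symmetric])
  also have "\<dots> = (\<Sum>i<n. \<Sum>j<m. g i j)"
  proof (rule sum.cong[OF refl])
    fix i
    have "(\<Sum>k\<in>{0 + i * m..<m + i * m}. g (k div m) (k mod m)) = (\<Sum>j\<in>{0..<m}. g ((j + i * m) div m) ((j + i * m) mod m))"
      by (rule sum.shift_bounds_nat_ivl)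
    also have "\<dots> = (\<Sum>j<m. g i j)" by (auto simp: lessThan_atLeast0 intro!: sum.cong)
    finally show "(\<Sum>k\<in>{i * m..<i * m + m}. g (k div m) (k mod m)) = (\<Sum>j<m. g i j)"
      by (simp add: add.commute)
  qed
  finally show ?thesis .
qed

lemma cinner_mvec:
  assumes "V \<in> carrier_mat n n" "W \<in> carrier_mat n n"
  shows "cinner (mvec n V) (mvec n W) = mtrace (dag V * W)"
proof -
  have "cinner (mvec n V) (mvec n W) = (\<Sum>k<n*n. cnj (V $$ (k div n, k mod n)) * W $$ (k div n, k mod n))"
    by (auto simp: cinner_def mvec_def intro!: sum.cong)
  also have "\<dots> = (\<Sum>i<n. \<Sum>j<n. cnj (V $$ (i,j)) * W $$ (i,j))"
    by (rule sum_div_mod)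
  also have "\<dots> = (\<Sum>j<n. \<Sum>i<n. cnj (V $$ (i,j)) * W $$ (i,j))"
    by (rule sum.swap)
  also have "\<dots> = mtrace (dag V * W)"
    using assms by (auto simp: mtrace_def index_dag_mult simp del: index_mult_mat(1) intro!: sum.cong)
  finally show ?thesis .
qed

lemma dim_kron [simp]: "dim_row (kron A B) = dim_row A * dim_row B" "dim_col (kron A B) = dim_col A * dim_col B"
  by (auto simp: kron_def)

text \<open>The transpose makes the second factor act by multiplication from the right. Thus
  \<open>kron (minv \<tau>) (transpose_mat Z)\<close> is the relative modular operator sending
  \<open>W\<close> to \<open>minv \<tau> * W * Z\<close>.\<close>

lemma kron_mvec:
  assumes "A \<in> carrier_mat n n" "B \<in> carrier_mat n n" "W \<in> carrier_mat n n"
  shows "kron A (transpose_mat B) *\<^sub>v mvec n W = mvec n (A * W * B)"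
proof (rule eq_vecI)
  fix k assume "k < dim_vec (mvec n (A * W * B))"
  hence k: "k < n * n" by simp
  define i where "i = k div n"
  define j where "j = k mod n"
  have ij: "i < n" "j < n" using div_mod_less[OF k] by (auto simp: i_def j_def)
  have "(kron A (transpose_mat B) *\<^sub>v mvec n W) $ k
     = (\<Sum>l<n * n. A $$ (i, l div n) * W $$ (l div n, l mod n) * B $$ (l mod n, j))"
    using k assms ij
    by (auto simp: scalar_prod_def kron_def mvec_def lessThan_atLeast0 i_def j_def div_mod_less intro!: sum.cong)
  also have "\<dots> = (\<Sum>a<n. \<Sum>b<n. A $$ (i, a) * W $$ (a, b) * B $$ (b, j))"
    by (rule sum_div_mod)
  also have "\<dots> = (\<Sum>a<n. A $$ (i, a) * (\<Sum>b<n. W $$ (a, b) * B $$ (b, j)))"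
    by (simp add: sum_distrib_left mult.assoc)
  also have "\<dots> = (A * W * B) $$ (i,j)"
    using assms ij by (simp add: scalar_prod_def lessThan_atLeast0)
  also have "\<dots> = mvec n (A * W * B) $ k" using k by (simp add: mvec_def i_def j_def)
  finally show "(kron A (transpose_mat B) *\<^sub>v mvec n W) $ k = mvec n (A * W * B) $ k" .
qed (use assms in auto)

text \<open>The unnormalised maximally entangled vector is the vectorised identity.\<close>

lemma phivec_mvec:
  assumes "psd n X"
  shows "phivec X = mvec n (sqrtm X)"
proof -
  have "Gamma n = mvec n (1\<^sub>m n)"
    by (intro eq_vecI) (auto simp: Gamma_def mvec_def div_mod_less)
  hence "phivec X = kron (sqrtm X) (transpose_mat (1\<^sub>m n)) *\<^sub>v mvec n (1\<^sub>m n)"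
    using psd_dims[OF assms] by (simp add: phivec_def)
  also have "\<dots> = mvec n (sqrtm X * 1\<^sub>m n * 1\<^sub>m n)"
    by (rule kron_mvec) (use psd_carrier[OF psd_sqrtm[OF assms]] in auto)
  finally show ?thesis using psd_dims[OF psd_sqrtm[OF assms]] by (simp add: mult_one_right)
qed

text \<open>Turns positivity and order of Kronecker products into trace inequalities for products of
  positive matrices.\<close>

lemma kron_quad:
  assumes "P \<in> carrier_mat n n" "Q \<in> carrier_mat n n" "W \<in> carrier_mat n n"
  shows "cinner (mvec n W) (kron P (transpose_mat Q) *\<^sub>v mvec n W) = mtrace (dag W * P * W * Q)"
proof -
  have "P * W * Q \<in> carrier_mat n n" using assms by (intro carrier_matI) auto
  thus ?thesis using assms by (simp add: kron_mvec cinner_mvec mult_assoc_dim)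
qed

lemma dag_kron_transpose:
  assumes "P \<in> carrier_mat n n" "Q \<in> carrier_mat n n"
  shows "dag (kron P (transpose_mat Q)) = kron (dag P) (transpose_mat (dag Q))"
  using assms by (intro eq_matI) (auto simp: kron_def div_mod_less)

lemma psd_kron:
  assumes P: "psd n P" and Q: "psd n Q"
  shows "psd (n * n) (kron P (transpose_mat Q))"
proof -
  have "0 \<le> Re (cinner v (kron P (transpose_mat Q) *\<^sub>v v))" if v: "v \<in> carrier_vec (n * n)" for v
  proof -
    obtain W where W: "W \<in> carrier_mat n n" "v = mvec n W" using mvec_surj[OF v] .
    show ?thesis
      using mtrace_psd_mult[OF psd_conj[OF P W(1)] Q]
      by (simp add: W(2) kron_quad[OF psd_carrier[OF P] psd_carrier[OF Q] W(1)])
  qed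
  moreover have "hermitian (n * n) (kron P (transpose_mat Q))"
    using dag_kron_transpose[OF psd_carrier[OF P] psd_carrier[OF Q]] psd_dims[OF P] psd_dims[OF Q]
    unfolding hermitian_def by (intro conjI carrier_matI) (auto simp: psd_dag[OF P] psd_dag[OF Q])
  ultimately show ?thesis by (simp add: psd_def)
qed

lemma pd_kron:
  assumes P: "pd n P" and Q: "pd n Q"
  shows "pd (n * n) (kron P (transpose_mat Q))"
proof (rule pd_psd_inj[OF psd_kron[OF pd_psd[OF P] pd_psd[OF Q]]])
  fix v assume v: "v \<in> carrier_vec (n * n)" "kron P (transpose_mat Q) *\<^sub>v v = 0\<^sub>v (n * n)"
  obtain W where W: "W \<in> carrier_mat n n" "v = mvec n W" using mvec_surj[OF v(1)] .
  note d = pd_dims[OF P] pd_dims[OF Q] carrier_matD[OF W(1)] pd_dims[OF pd_minv[OF P]] pd_dims[OF pd_minv[OF Q]]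
  have "0\<^sub>v (n * n) = mvec n (0\<^sub>m n n)" by (intro eq_vecI) (auto simp: mvec_def div_mod_less)
  hence "mvec n (P * W * Q) = mvec n (0\<^sub>m n n)"
    using v(2) W by (simp add: kron_mvec[OF pd_carrier[OF P] pd_carrier[OF Q]])
  hence 0: "P * W * Q = 0\<^sub>m n n"
    by (rule mvec_inj) (auto simp: d intro: carrier_matI)
  have "W = (minv P * P) * W * (Q * minv Q)"
    using d by (simp add: minv_left[OF P] minv_right[OF Q] mult_one_left mult_one_right)
  also have "\<dots> = minv P * (P * W * Q) * minv Q" using d by (simp add: mult_assoc_dim)
  also have "\<dots> = 0\<^sub>m n n" using d by (simp add: 0 mult_zero_left_dim mult_zero_right_dim)
  finally show "v = 0\<^sub>v (n * n)" using \<open>0\<^sub>v (n * n) = _\<close> W by simp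
qed

subsection \<open>Kernel projection\<close>

text \<open>\<open>kerproj\<close> is defined by \<open>SOME\<close>, so a projection with the
  required property has to be exhibited first.\<close>

lemma kerproj_props:
  assumes Y: "psd n Y"
  shows "psd n (kerproj Y)" "\<And>v. v \<in> carrier_vec n \<Longrightarrow> Y *\<^sub>v v = 0\<^sub>v n \<Longrightarrow> kerproj Y *\<^sub>v v = v"
proof -
  note h = psd_hermitian[OF Y] and d = psd_dims[OF Y]
  \<comment> \<open>The spectral projection of \<open>Y\<close> at 0. Its companion \<open>N\<close>
    is the pseudo-inverse of \<open>Y\<close>, and \<open>N * Y = 1 - P\<close> shows that
    \<open>P\<close> fixes the whole kernel.\<close>
  define P where "P = matfun (\<lambda>x. if x = 0 then 1 else 0) Y"
  define N where "N = matfun (\<lambda>x. if x = 0 then 0 else 1 / x) Y"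
  have PH: "hermitian n P" unfolding P_def by (rule hermitian_matfun[OF h])
  have NH: "hermitian n N" unfolding N_def by (rule hermitian_matfun[OF h])
  note d = d hermitian_dims[OF PH] hermitian_dims[OF NH]
  have PP: "P * P = P" unfolding P_def matfun_mult[OF h] by (rule arg_cong[of _ _ "\<lambda>f. matfun f Y"]) auto
  have YP: "Y * P = 0\<^sub>m n n"
  proof -
    have "Y * P = matfun (\<lambda>x. x) Y * P" by (simp add: matfun_id[OF h])
    also have "\<dots> = matfun (\<lambda>x. 0) Y"
      unfolding P_def matfun_mult[OF h] by (rule arg_cong[of _ _ "\<lambda>f. matfun f Y"]) auto
    also have "\<dots> = 0\<^sub>m n n" unfolding matfun_const[OF h] by (intro eq_matI) auto
    finally show ?thesis .
  qed
  have NY: "N * Y = 1\<^sub>m n - P"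
  proof -
    have "N * Y = N * matfun (\<lambda>x. x) Y" by (simp add: matfun_id[OF h])
    also have "\<dots> = matfun (\<lambda>x. 1 - (if x = 0 then 1 else 0)) Y"
      unfolding N_def matfun_mult[OF h] by (rule arg_cong[of _ _ "\<lambda>f. matfun f Y"]) auto
    finally show ?thesis unfolding P_def matfun_one_minus[OF h] .
  qed
  have "P *\<^sub>v v = v \<longleftrightarrow> Y *\<^sub>v v = 0\<^sub>v n" if v: "v \<in> carrier_vec n" for v
  proof
    assume Pv: "P *\<^sub>v v = v"
    have "Y *\<^sub>v (P *\<^sub>v v) = (Y * P) *\<^sub>v v" using d v by (simp add: mult_vec_assoc_dim)
    also have "\<dots> = 0\<^sub>v n" unfolding YP using v by (intro eq_vecI) (auto simp: scalar_prod_def)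
    finally show "Y *\<^sub>v v = 0\<^sub>v n" by (simp add: Pv)
  next
    assume Yv: "Y *\<^sub>v v = 0\<^sub>v n"
    have "0\<^sub>v n = (N * Y) *\<^sub>v v" using d v by (simp add: mult_vec_assoc_dim Yv mult_zero_vec_dim)
    also have "\<dots> = v - P *\<^sub>v v" using d v by (simp add: NY minus_mult_vec_dim)
    finally have z: "0\<^sub>v n = v - P *\<^sub>v v" .
    show "P *\<^sub>v v = v"
    proof (rule eq_vecI)
      fix i assume "i < dim_vec v"
      thus "(P *\<^sub>v v) $ i = v $ i" using arg_cong[OF z, of "\<lambda>w. w $ i"] d v by (simp del: index_mult_mat_vec)
    qed (use d v in auto)
  qed
  hence ex: "\<exists>P. let n = dim_row Y in P \<in> carrier_mat n n \<and> dag P = P \<and> P * P = P \<and>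
      (\<forall>v \<in> carrier_vec n. P *\<^sub>v v = v \<longleftrightarrow> Y *\<^sub>v v = 0\<^sub>v n)"
    using PH PP d by (intro exI[of _ P]) (simp add: hermitian_def)
  have K: "kerproj Y \<in> carrier_mat n n" "dag (kerproj Y) = kerproj Y" "kerproj Y * kerproj Y = kerproj Y"
    "\<forall>v \<in> carrier_vec n. kerproj Y *\<^sub>v v = v \<longleftrightarrow> Y *\<^sub>v v = 0\<^sub>v n"
    using someI_ex[OF ex] d unfolding kerproj_def Let_def by auto
  show "psd n (kerproj Y)" using psd_dag_mult[OF K(1)] K(2,3) by simp
  show "\<And>v. v \<in> carrier_vec n \<Longrightarrow> Y *\<^sub>v v = 0\<^sub>v n \<Longrightarrow> kerproj Y *\<^sub>v v = v" using K(4) by blast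
qed

text \<open>A vector annihilated by the sum has both quadratic forms equal to 0: the first puts it
  into the kernel of \<open>Y\<close>, where \<open>kerproj Y\<close> is the identity, and the
  second then makes its norm 0.\<close>

lemma pd_add_kerproj:
  assumes Y: "psd n Y" and e: "e > 0"
  shows "pd n (Y + complex_of_real e \<cdot>\<^sub>m kerproj Y)"
proof (rule pd_psd_inj)
  note K = kerproj_props[OF Y]
  note d = psd_dims[OF Y] psd_dims[OF K(1)]
  have eK: "psd n (complex_of_real e \<cdot>\<^sub>m kerproj Y)" by (rule psd_smult[OF K(1)]) (use e in simp)
  show "psd n (Y + complex_of_real e \<cdot>\<^sub>m kerproj Y)" by (intro psd_add Y eK)
  fix v assume v: "v \<in> carrier_vec n" "(Y + complex_of_real e \<cdot>\<^sub>m kerproj Y) *\<^sub>v v = 0\<^sub>v n"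
  have "Re (cinner v ((Y + complex_of_real e \<cdot>\<^sub>m kerproj Y) *\<^sub>v v)) = 0"
    using v by (simp add: cinner_def)
  hence "Re (cinner v (Y *\<^sub>v v)) + e * Re (cinner v (kerproj Y *\<^sub>v v)) = 0"
    using d v(1) by (simp add: add_mult_vec_dim smult_mult_vec_dim cinner_add_right cinner_smult_right)
  moreover have "0 \<le> Re (cinner v (Y *\<^sub>v v))" "0 \<le> e * Re (cinner v (kerproj Y *\<^sub>v v))"
    using psd_quad[OF Y, of v] psd_quad[OF K(1), of v] e v by auto
  ultimately have z: "Re (cinner v (Y *\<^sub>v v)) = 0" "e * Re (cinner v (kerproj Y *\<^sub>v v)) = 0" by linarith+
  have "kerproj Y *\<^sub>v v = v" by (rule K(2)[OF v(1) psd_eq_0_vec[OF Y v(1) z(1)]])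
  hence "Re (cinner v v) = 0" using z(2) e by simp
  thus "v = 0\<^sub>v n" using v(1) by (simp add: cinner_self_eq_0)
qed

subsection \<open>Positive trace-preserving maps with a Schwarz inequality\<close>

text \<open>Tested with \<open>A = C - D\<close>. \<open>\<Phi>adj\<close> is given only through its
  pairing with \<open>\<Phi>\<close>; its linearity, compatibility with \<open>dag\<close> and
  unitality are all obtained from this.\<close>

lemma mtrace_nondegenerate:
  assumes "C \<in> carrier_mat n n" "D \<in> carrier_mat n n"
    and "\<And>A. A \<in> carrier_mat n n \<Longrightarrow> mtrace (dag C * A) = mtrace (dag D * A)"
  shows "C = D"
proof -
  let ?E = "C - D"
  have d: "dim_row C = n" "dim_col C = n" "dim_row D = n" "dim_col D = n" using assms by auto
  have "mtrace (dag ?E * ?E) = mtrace (dag C * ?E) - mtrace (dag D * ?E)"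
    using d by (simp add: dag_minus mult_minus_left_dim mtrace_minus)
  also have "\<dots> = 0" using assms(3)[OF minus_carrier_mat[OF assms(2)]] by simp
  finally have E0: "?E = 0\<^sub>m n n" using mtrace_dag_mult_eq_0[of ?E] d by simp
  hence "C $$ (i,j) - D $$ (i,j) = 0" if "i < n" "j < n" for i j
  proof -
    have "?E $$ (i,j) = 0" unfolding E0 using that by simp
    thus ?thesis using that d by simp
  qed
  thus ?thesis using d by (intro eq_matI) auto
qed

lemma psd_quad_mono:
  assumes "hermitian n A" "hermitian n B"
    and "\<And>v. v \<in> carrier_vec n \<Longrightarrow> Re (cinner v (A *\<^sub>v v)) \<le> Re (cinner v (B *\<^sub>v v))"
  shows "psd n (B - A)"
  using assms hermitian_minus[OF assms(2,1)] hermitian_dims[OF assms(1)] hermitian_dims[OF assms(2)]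
  by (auto simp: psd_def minus_mult_vec_dim cinner_minus_right)

text \<open>With \<open>L = sqrtm N * sqrtm X\<close>, the trace of \<open>X * N\<close> is that of
  \<open>dag L * L\<close>, so \<open>L\<close> vanishes.\<close>

lemma psd_mult_eq_0:
  assumes X: "psd n X" and N: "psd n N" and tr: "Re (mtrace (X * N)) = 0"
  shows "sqrtm X * N = 0\<^sub>m n n"
proof -
  let ?H = "sqrtm X" and ?S = "sqrtm N"
  note H = psd_sqrtm[OF X] and S = psd_sqrtm[OF N]
  note d = psd_dims[OF H] psd_dims[OF S] psd_dims[OF X] psd_dims[OF N]
  define L where "L = ?S * ?H"
  have "mtrace (dag L * L) = mtrace (?H * (?S * ?S * ?H))"
    using d by (simp add: L_def dag_mult mult_assoc_dim psd_dag[OF H] psd_dag[OF S])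
  also have "\<dots> = mtrace ((?S * ?S * ?H) * ?H)" using d by (subst mtrace_cyclic) auto
  also have "\<dots> = mtrace (N * X)"
    using d by (simp add: mult_assoc_dim sqrtm_square[OF X]) (simp add: mult_assoc_dim[symmetric] sqrtm_square[OF N])
  also have "\<dots> = mtrace (X * N)" using d by (subst mtrace_cyclic) auto
  finally have "L = 0\<^sub>m n n" using mtrace_dag_mult_eq_0[of L] tr d by (simp add: L_def)
  hence "dag L * ?S = 0\<^sub>m n n" using d by (simp add: mult_zero_left_dim)
  thus ?thesis using d by (simp add: L_def dag_mult mult_assoc_dim psd_dag[OF H] psd_dag[OF S] sqrtm_square[OF N])
qed

lemma minv_smult:
  assumes "pd n A" "c > 0"
  shows "minv (complex_of_real c \<cdot>\<^sub>m A) = complex_of_real (1 / c) \<cdot>\<^sub>m minv A"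
proof (rule minv_eqI)
  note d = pd_dims[OF assms(1)] pd_dims[OF pd_minv[OF assms(1)]]
  show "complex_of_real c \<cdot>\<^sub>m A \<in> carrier_mat n n"
    "complex_of_real (1 / c) \<cdot>\<^sub>m minv A \<in> carrier_mat n n" using d by (auto intro: carrier_matI)
  show "complex_of_real c \<cdot>\<^sub>m A * (complex_of_real (1 / c) \<cdot>\<^sub>m minv A) = 1\<^sub>m n"
    "complex_of_real (1 / c) \<cdot>\<^sub>m minv A * (complex_of_real c \<cdot>\<^sub>m A) = 1\<^sub>m n"
    using d assms(2)
    by (simp_all add: mult_smult_left_dim mult_smult_right_dim minv_right[OF assms(1)] minv_left[OF assms(1)])
      (intro eq_matI; simp)+
qed

lemma minv_one: "minv (1\<^sub>m n) = 1\<^sub>m n"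
  by (rule minv_eqI) auto

locale schwarz_map =
  fixes n m :: nat
    and \<Phi> :: "complex mat \<Rightarrow> complex mat"
    and \<Phi>adj :: "complex mat \<Rightarrow> complex mat"
  assumes \<Phi>_dim: "A \<in> carrier_mat n n \<Longrightarrow> \<Phi> A \<in> carrier_mat m m"
    and \<Phi>_add: "A \<in> carrier_mat n n \<Longrightarrow> B \<in> carrier_mat n n \<Longrightarrow> \<Phi> (A + B) = \<Phi> A + \<Phi> B"
    and \<Phi>_smult: "A \<in> carrier_mat n n \<Longrightarrow> \<Phi> (c \<cdot>\<^sub>m A) = c \<cdot>\<^sub>m \<Phi> A"
    and \<Phi>_pos: "psd n A \<Longrightarrow> psd m (\<Phi> A)"
    and \<Phi>_tp: "A \<in> carrier_mat n n \<Longrightarrow> mtrace (\<Phi> A) = mtrace A"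
    and adj_dim: "C \<in> carrier_mat m m \<Longrightarrow> \<Phi>adj C \<in> carrier_mat n n"
    and adj: "A \<in> carrier_mat n n \<Longrightarrow> C \<in> carrier_mat m m \<Longrightarrow>
               mtrace (dag C * \<Phi> A) = mtrace (dag (\<Phi>adj C) * A)"
    and schwarz: "\<rho> \<in> carrier_mat m m \<Longrightarrow> pd m \<sigma> \<Longrightarrow>
               loewner_le n (\<Phi>adj (dag \<rho>) * minv (\<Phi>adj \<sigma>) * \<Phi>adj \<rho>)
                            (\<Phi>adj (dag \<rho> * minv \<sigma> * \<rho>))"
begin

text \<open>A hermitian matrix is the difference of two positive ones, a multiple of the identity
  being large enough for the first.\<close>

lemma \<Phi>_hermitian:
  assumes "hermitian n A"
  shows "hermitian m (\<Phi> A)"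
proof -
  obtain c where c: "c > 0" "psd n (complex_of_real c \<cdot>\<^sub>m 1\<^sub>m n - A)" using psd_shift_upper[OF assms] .
  let ?P = "complex_of_real c \<cdot>\<^sub>m 1\<^sub>m n" and ?Q = "complex_of_real c \<cdot>\<^sub>m 1\<^sub>m n - A"
  have A: "A \<in> carrier_mat n n" using assms by (simp add: hermitian_def)
  have P: "hermitian m (\<Phi> ?P)" using c by (intro psd_hermitian \<Phi>_pos psd_smult psd_one) simp
  have Q: "hermitian m (\<Phi> ?Q)" by (intro psd_hermitian \<Phi>_pos c)
  have "?P = ?Q + A" using A by (intro eq_matI) auto
  hence "\<Phi> ?P = \<Phi> ?Q + \<Phi> A" using \<Phi>_add[OF psd_carrier[OF c(2)] A] by simp
  hence "\<Phi> A = \<Phi> ?P - \<Phi> ?Q"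
    using hermitian_dims[OF Q] \<Phi>_dim[OF A] by (intro eq_matI) auto
  thus ?thesis using hermitian_minus[OF P Q] by simp
qed

lemma \<Phi>_dag:
  assumes A: "A \<in> carrier_mat n n"
  shows "\<Phi> (dag A) = dag (\<Phi> A)"
proof -
  \<comment> \<open>Decomposition into hermitian real and imaginary parts, each of which
    \<open>\<Phi>\<close> keeps hermitian.\<close>
  define R where "R = complex_of_real (1/2) \<cdot>\<^sub>m (A + dag A)"
  define I where "I = (- \<i> / 2) \<cdot>\<^sub>m (A - dag A)"
  have R: "hermitian n R" and I: "hermitian n I"
    using A unfolding R_def I_def hermitian_def
    by (auto intro!: eq_matI simp: algebra_simps)
  have A1: "A = R + \<i> \<cdot>\<^sub>m I" and A2: "dag A = R + (- \<i>) \<cdot>\<^sub>m I"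
    using A by (auto intro!: eq_matI simp: R_def I_def field_simps)
  have e: "\<Phi> (R + z \<cdot>\<^sub>m I) = \<Phi> R + z \<cdot>\<^sub>m \<Phi> I" for z
    using hermitian_carrier[OF R] hermitian_carrier[OF I] by (simp add: \<Phi>_add \<Phi>_smult)
  have "\<Phi> A = \<Phi> R + \<i> \<cdot>\<^sub>m \<Phi> I" by (subst A1) (rule e)
  hence "dag (\<Phi> A) = dag (\<Phi> R + \<i> \<cdot>\<^sub>m \<Phi> I)" by simp
  also have "\<dots> = \<Phi> R + (- \<i>) \<cdot>\<^sub>m \<Phi> I"
    using \<Phi>_hermitian[OF R] \<Phi>_hermitian[OF I] hermitian_dims[OF \<Phi>_hermitian[OF R]]
      hermitian_dims[OF \<Phi>_hermitian[OF I]]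
    by (simp add: dag_add dag_smult hermitian_dag)
  also have "\<dots> = \<Phi> (dag A)" by (simp add: e A2)
  finally show ?thesis ..
qed

lemma adj_dag:
  assumes C: "C \<in> carrier_mat m m"
  shows "\<Phi>adj (dag C) = dag (\<Phi>adj C)"
proof (rule mtrace_nondegenerate)
  show "\<Phi>adj (dag C) \<in> carrier_mat n n" "dag (\<Phi>adj C) \<in> carrier_mat n n" using C by (auto intro: adj_dim dag_carrier)
  fix A :: "complex mat" assume A: "A \<in> carrier_mat n n"
  note d = carrier_matD[OF A] carrier_matD[OF C] carrier_matD[OF adj_dim[OF C]] carrier_matD[OF \<Phi>_dim[OF A]]
  have "mtrace (dag (dag (\<Phi>adj C)) * A) = cnj (mtrace (dag (\<Phi>adj C) * dag A))"
  proof -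
    have "cnj (mtrace (dag (\<Phi>adj C) * dag A)) = mtrace (dag (dag (\<Phi>adj C) * dag A))"
      using d by (subst mtrace_dag) auto
    also have "\<dots> = mtrace (A * \<Phi>adj C)" using d by (simp add: dag_mult)
    also have "\<dots> = mtrace (\<Phi>adj C * A)" using d by (intro mtrace_cyclic) auto
    finally show ?thesis by simp
  qed
  also have "\<dots> = cnj (mtrace (dag C * dag (\<Phi> A)))"
    using adj[of "dag A" C] A C by (simp add: \<Phi>_dag)
  also have "\<dots> = mtrace (dag (dag C * dag (\<Phi> A)))" using d by (subst mtrace_dag) auto
  also have "\<dots> = mtrace (\<Phi> A * C)" using d by (simp add: dag_mult)
  also have "\<dots> = mtrace (dag (dag C) * \<Phi> A)" using d by (simp add: mtrace_cyclic[of C])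
  also have "\<dots> = mtrace (dag (\<Phi>adj (dag C)) * A)" using A C by (intro adj) auto
  finally show "mtrace (dag (\<Phi>adj (dag C)) * A) = mtrace (dag (dag (\<Phi>adj C)) * A)" ..
qed

lemma mtrace_adj:
  assumes "C \<in> carrier_mat m m" "A \<in> carrier_mat n n"
  shows "mtrace (\<Phi>adj C * A) = mtrace (C * \<Phi> A)"
  using adj[of A "dag C"] assms by (simp add: adj_dag)

lemma adj_add:
  assumes "B \<in> carrier_mat m m" "C \<in> carrier_mat m m"
  shows "\<Phi>adj (B + C) = \<Phi>adj B + \<Phi>adj C"
proof (rule mtrace_nondegenerate)
  have BC: "B + C \<in> carrier_mat m m" using assms by auto
  show "\<Phi>adj (B + C) \<in> carrier_mat n n" "\<Phi>adj B + \<Phi>adj C \<in> carrier_mat n n"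
    using assms adj_dim by auto
  fix A :: "complex mat" assume A: "A \<in> carrier_mat n n"
  note d = carrier_matD[OF A] carrier_matD[OF adj_dim[OF assms(1)]] carrier_matD[OF adj_dim[OF assms(2)]]
    carrier_matD[OF \<Phi>_dim[OF A]] carrier_matD[OF assms(1)] carrier_matD[OF assms(2)]
  show "mtrace (dag (\<Phi>adj (B + C)) * A) = mtrace (dag (\<Phi>adj B + \<Phi>adj C) * A)"
    using d by (simp add: dag_add mult_add_left_dim mtrace_add flip: adj[OF A BC] adj[OF A assms(1)] adj[OF A assms(2)])
qed

lemma adj_smult:
  assumes "C \<in> carrier_mat m m"
  shows "\<Phi>adj (c \<cdot>\<^sub>m C) = c \<cdot>\<^sub>m \<Phi>adj C"
proof (rule mtrace_nondegenerate)
  have cC: "c \<cdot>\<^sub>m C \<in> carrier_mat m m" using assms by auto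
  show "\<Phi>adj (c \<cdot>\<^sub>m C) \<in> carrier_mat n n" "c \<cdot>\<^sub>m \<Phi>adj C \<in> carrier_mat n n"
    using assms adj_dim by auto
  fix A :: "complex mat" assume A: "A \<in> carrier_mat n n"
  note d = carrier_matD[OF A] carrier_matD[OF adj_dim[OF assms(1)]]
    carrier_matD[OF \<Phi>_dim[OF A]] carrier_matD[OF assms(1)]
  show "mtrace (dag (\<Phi>adj (c \<cdot>\<^sub>m C)) * A) = mtrace (dag (c \<cdot>\<^sub>m \<Phi>adj C) * A)"
    using d by (simp add: dag_smult mult_smult_left_dim mtrace_smult flip: adj[OF A cC] adj[OF A assms(1)])
qed

lemma adj_minus:
  assumes "B \<in> carrier_mat m m" "C \<in> carrier_mat m m"
  shows "\<Phi>adj (B - C) = \<Phi>adj B - \<Phi>adj C"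
proof -
  have "B - C = B + (- 1) \<cdot>\<^sub>m C" using assms by (intro eq_matI) auto
  hence "\<Phi>adj (B - C) = \<Phi>adj B + (- 1) \<cdot>\<^sub>m \<Phi>adj C" using assms by (simp add: adj_add adj_smult)
  thus ?thesis using adj_dim[OF assms(1)] adj_dim[OF assms(2)] by (auto intro!: eq_matI)
qed

text \<open>Unitality of the adjoint is dual to trace preservation.\<close>

lemma adj_one: "\<Phi>adj (1\<^sub>m m) = 1\<^sub>m n"
proof (rule mtrace_nondegenerate)
  fix A :: "complex mat" assume A: "A \<in> carrier_mat n n"
  show "mtrace (dag (\<Phi>adj (1\<^sub>m m)) * A) = mtrace (dag (1\<^sub>m n) * A)"
    using adj[OF A, of "1\<^sub>m m"] \<Phi>_dim[OF A] A by (simp add: \<Phi>_tp)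
qed (auto intro: adj_dim)

lemma adj_schwarz:
  assumes K: "K \<in> carrier_mat m m" and s: "pd m \<sigma>"
  shows "psd n (\<Phi>adj (dag K * minv \<sigma> * K) - dag (\<Phi>adj K) * minv (\<Phi>adj \<sigma>) * \<Phi>adj K)"
  using schwarz[OF K s] by (simp add: loewner_le_def adj_dag[OF K])

text \<open>The Schwarz hypothesis at the identity, where unitality removes both inverses: the
  Kadison-Schwarz inequality.\<close>

lemma adj_kadison:
  assumes K: "K \<in> carrier_mat m m"
  shows "psd n (\<Phi>adj (dag K * K) - dag (\<Phi>adj K) * \<Phi>adj K)"
  using adj_schwarz[OF K pd_one] K adj_dim[OF K]
  by (simp add: minv_one adj_one mult_one_right)

text \<open>Kadison-Schwarz for the square root bounds \<open>\<Phi>adj C\<close> below by a matrix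
  of the form \<open>dag L * L\<close>.\<close>

lemma adj_psd:
  assumes "psd m C"
  shows "psd n (\<Phi>adj C)"
proof -
  let ?S = "sqrtm C"
  note S = psd_sqrtm[OF assms]
  have C: "dag ?S * ?S = C" by (simp add: psd_dag[OF S] sqrtm_square[OF assms])
  have a: "\<Phi>adj C \<in> carrier_mat n n" "\<Phi>adj ?S \<in> carrier_mat n n"
    using adj_dim psd_carrier[OF assms] psd_carrier[OF S] by auto
  have "\<Phi>adj C = (\<Phi>adj C - dag (\<Phi>adj ?S) * \<Phi>adj ?S) + dag (\<Phi>adj ?S) * \<Phi>adj ?S"
    using a by (intro eq_matI) (auto simp del: index_mult_mat(1))
  moreover have "psd n \<dots>"
    using psd_add[OF adj_kadison[OF psd_carrier[OF S]] psd_dag_mult[OF a(2)]] by (simp add: C)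
  ultimately show ?thesis by simp
qed

text \<open>Ensures that \<open>minv (\<Phi>adj \<sigma>)\<close> in the Schwarz inequality is a
  genuine inverse.\<close>

lemma adj_pd:
  assumes "pd m C"
  shows "pd n (\<Phi>adj C)"
proof -
  obtain c where c: "c > 0" "psd m (C - complex_of_real c \<cdot>\<^sub>m 1\<^sub>m m)" using psd_shift_lower[OF assms] .
  have C: "C \<in> carrier_mat m m" by (rule pd_carrier[OF assms])
  have "\<Phi>adj (C - complex_of_real c \<cdot>\<^sub>m 1\<^sub>m m) = \<Phi>adj C - complex_of_real c \<cdot>\<^sub>m 1\<^sub>m n"
    using C by (simp add: adj_minus adj_smult adj_one)
  hence p: "psd n (\<Phi>adj C - complex_of_real c \<cdot>\<^sub>m 1\<^sub>m n)" using adj_psd[OF c(2)] by simp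
  have "\<Phi>adj C = complex_of_real c \<cdot>\<^sub>m 1\<^sub>m n + (\<Phi>adj C - complex_of_real c \<cdot>\<^sub>m 1\<^sub>m n)"
    using adj_dim[OF C] by (intro eq_matI) auto
  thus ?thesis using pd_add_psd[OF pd_smult[OF pd_one c(1)] p] by simp
qed

text \<open>The Jensen inequality needs its contraction as a matrix, whereas
  \<open>\<Phi>adj\<close> is a function on matrices.\<close>

lemma adj_matrix:
  obtains J where "J \<in> carrier_mat (n * n) (m * m)"
    "\<And>C. C \<in> carrier_mat m m \<Longrightarrow> J *\<^sub>v mvec m C = mvec n (\<Phi>adj C)"
proof
  define E where "E i j = mat n n (\<lambda>(a,b). if a = i \<and> b = j then 1 else 0 :: complex)" for i j
  \<comment> \<open>The conjugate transpose of the matrix of \<open>\<Phi>\<close> with respect to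
    the matrix units \<open>E i j\<close>.\<close>
  define J where "J = mat (n * n) (m * m) (\<lambda>(k,l). cnj (mvec m (\<Phi> (E (k div n) (k mod n))) $ l))"
  show "J \<in> carrier_mat (n * n) (m * m)" by (simp add: J_def)
  fix C :: "complex mat" assume C: "C \<in> carrier_mat m m"
  have E: "E i j \<in> carrier_mat n n" for i j by (simp add: E_def)
  show "J *\<^sub>v mvec m C = mvec n (\<Phi>adj C)"
  proof (rule eq_vecI)
    fix k assume "k < dim_vec (mvec n (\<Phi>adj C))"
    hence k: "k < n * n" by simp
    define i where "i = k div n"
    define j where "j = k mod n"
    have ij: "i < n" "j < n" using div_mod_less[OF k] by (auto simp: i_def j_def)
    have "(J *\<^sub>v mvec m C) $ k = cinner (mvec m (\<Phi> (E i j))) (mvec m C)"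
      using k by (simp add: J_def scalar_prod_def cinner_def lessThan_atLeast0 i_def j_def)
    also have "\<dots> = cnj (cinner (mvec m C) (mvec m (\<Phi> (E i j))))" by (rule cinner_commute) simp
    also have "\<dots> = cnj (mtrace (dag (\<Phi>adj C) * E i j))"
      by (simp add: cinner_mvec[OF C \<Phi>_dim[OF E]] adj[OF E C])
    also have "\<dots> = cnj (cinner (mvec n (\<Phi>adj C)) (mvec n (E i j)))"
      by (simp add: cinner_mvec[OF adj_dim[OF C] E])
    also have "mvec n (E i j) = unit_vec (n * n) k"
    proof (rule eq_vecI)
      fix l assume "l < dim_vec (unit_vec (n * n) k :: complex vec)"
      hence l: "l < n * n" by simp
      have "l div n = k div n \<and> l mod n = k mod n \<longleftrightarrow> l = k" by (metis div_mult_mod_eq)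
      thus "mvec n (E i j) $ l = unit_vec (n * n) k $ l"
        using k l by (simp add: mvec_def E_def unit_vec_def i_def j_def div_mod_less)
    qed simp
    also have "cnj (cinner (mvec n (\<Phi>adj C)) (unit_vec (n * n) k)) = mvec n (\<Phi>adj C) $ k"
      using k by (subst cinner_commute[symmetric]) (auto simp: cinner_unit_vec)
    finally show "(J *\<^sub>v mvec m C) $ k = mvec n (\<Phi>adj C) $ k" .
  qed (simp add: J_def)
qed

end

text \<open>\<open>R\<close> is the pseudo-inverse of \<open>sqrtm B\<close> because \<open>1 / sqrt 0 = 0\<close>; \<open>P\<close> is the support projection.\<close>

lemma psd_pinv_sqrt:
  assumes B: "psd m B"
  obtains R P where "psd m R" "P \<in> carrier_mat m m" "R * sqrtm B = P" "R * B * R = P"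
    "B * P = B" "psd m (1\<^sub>m m - P)"
proof
  note h = psd_hermitian[OF B]
  define R where "R = matfun (\<lambda>x. 1 / sqrt x) B"
  define P where "P = matfun (\<lambda>x. if x = 0 then 0 else 1) B"
  show "psd m R" unfolding R_def by (rule psd_matfun[OF B]) simp
  show "P \<in> carrier_mat m m" unfolding P_def by (intro hermitian_carrier hermitian_matfun h)
  show "R * sqrtm B = P"
    unfolding R_def P_def sqrtm_def matfun_mult[OF h] by (rule matfun_cong_psd[OF B]) auto
  have "R * B * R = R * matfun (\<lambda>x. x) B * R" by (simp add: matfun_id[OF h])
  also have "\<dots> = P"
    unfolding R_def P_def matfun_mult[OF h]
    by (rule matfun_cong_psd[OF B]) (auto simp: real_div_sqrt)
  finally show "R * B * R = P" .
  have "B * P = matfun (\<lambda>x. x) B * P" by (simp add: matfun_id[OF h])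
  also have "\<dots> = matfun (\<lambda>x. x) B"
    unfolding P_def matfun_mult[OF h] by (rule matfun_cong_psd[OF B]) auto
  finally show "B * P = B" by (simp add: matfun_id[OF h])
  show "psd m (1\<^sub>m m - P)"
    unfolding P_def matfun_one_minus[OF h] by (rule psd_matfun[OF B]) simp
qed

section \<open>The transfer contraction and the pulled-back state\<close>

context schwarz_map
begin

lemma transfer_contraction:
  assumes X: "psd n X" and R: "psd m R" and P: "P \<in> carrier_mat m m"
    and RS: "R * sqrtm (\<Phi> X) = P" and RBR: "R * \<Phi> X * R = P" and BP: "\<Phi> X * P = \<Phi> X"
    and P1: "psd m (1\<^sub>m m - P)"
  obtains T where "T \<in> carrier_mat (n * n) (m * m)"
    "\<And>W. W \<in> carrier_mat m m \<Longrightarrow> T *\<^sub>v mvec m W = mvec n (sqrtm X * \<Phi>adj (R * W))"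
    "psd (m * m) (1\<^sub>m (m * m) - dag T * T)"
    "T *\<^sub>v phivec (\<Phi> X) = phivec X"
proof -
  define H where "H = sqrtm X"
  define B where "B = \<Phi> X"
  have H: "psd n H" unfolding H_def by (rule psd_sqrtm[OF X])
  have HH: "H * H = X" unfolding H_def by (rule sqrtm_square[OF X])
  have B: "psd m B" unfolding B_def by (rule \<Phi>_pos[OF X])
  note d = psd_dims[OF X] psd_dims[OF R] psd_dims[OF H] psd_dims[OF B] carrier_matD[OF P]
  note c = psd_carrier[OF X] psd_carrier[OF R] psd_carrier[OF H] psd_carrier[OF B]
  obtain J where J: "J \<in> carrier_mat (n * n) (m * m)"
    "\<And>C. C \<in> carrier_mat m m \<Longrightarrow> J *\<^sub>v mvec m C = mvec n (\<Phi>adj C)" using adj_matrix by metis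
  \<comment> \<open>Left multiplication by \<open>R\<close>, then \<open>\<Phi>adj\<close>, then
    left multiplication by \<open>H\<close>, all in vectorised form.\<close>
  define T where "T = kron H (transpose_mat (1\<^sub>m n)) * J * kron R (transpose_mat (1\<^sub>m m))"
  have T: "T \<in> carrier_mat (n * n) (m * m)"
    using d J(1) unfolding T_def by (intro carrier_matI) auto
  have TW: "T *\<^sub>v mvec m W = mvec n (H * \<Phi>adj (R * W))" if W: "W \<in> carrier_mat m m" for W
  proof -
    have RW: "R * W \<in> carrier_mat m m" using c W by auto
    have "T *\<^sub>v mvec m W = kron H (transpose_mat (1\<^sub>m n)) *\<^sub>v (J *\<^sub>v (kron R (transpose_mat (1\<^sub>m m)) *\<^sub>v mvec m W))"
      using d J(1) by (simp add: T_def mult_vec_assoc_dim)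
    also have "kron R (transpose_mat (1\<^sub>m m)) *\<^sub>v mvec m W = mvec m (R * W * 1\<^sub>m m)"
      by (rule kron_mvec) (use c W in auto)
    also have "R * W * 1\<^sub>m m = R * W" using W by (simp add: mult_one_right)
    also have "J *\<^sub>v mvec m (R * W) = mvec n (\<Phi>adj (R * W))" by (rule J(2)[OF RW])
    also have "kron H (transpose_mat (1\<^sub>m n)) *\<^sub>v mvec n (\<Phi>adj (R * W)) = mvec n (H * \<Phi>adj (R * W) * 1\<^sub>m n)"
      by (rule kron_mvec) (use c adj_dim[OF RW] in auto)
    also have "H * \<Phi>adj (R * W) * 1\<^sub>m n = H * \<Phi>adj (R * W)"
      using adj_dim[OF RW] by (simp add: mult_one_right)
    finally show ?thesis .
  qed
  have contr: "psd (m * m) (1\<^sub>m (m * m) - dag T * T)"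
  proof (rule psd_quad_mono)
    show "hermitian (m * m) (dag T * T)" by (rule psd_hermitian[OF psd_dag_mult[OF T]])
    show "hermitian (m * m) (1\<^sub>m (m * m))" by (rule hermitian_one)
    fix v :: "complex vec" assume v: "v \<in> carrier_vec (m * m)"
    obtain W where W: "W \<in> carrier_mat m m" "v = mvec m W" using mvec_surj[OF v] .
    define K where "K = R * W"
    have K: "K \<in> carrier_mat m m" using c W by (auto simp: K_def)
    define C where "C = \<Phi>adj K"
    have C: "C \<in> carrier_mat n n" unfolding C_def by (rule adj_dim[OF K])
    note d = d carrier_matD[OF K] carrier_matD[OF C] carrier_matD[OF W(1)]
    \<comment> \<open>The inequality is used for \<open>dag K\<close>: moving \<open>X\<close> to
      the end of the trace leaves \<open>C * dag C\<close>, not \<open>dag C * C\<close>.\<close>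
    have KK: "psd n (\<Phi>adj (K * dag K) - C * dag C)"
      using adj_kadison[of "dag K"] K by (simp add: adj_dag C_def)
    have KKc: "K * dag K \<in> carrier_mat m m" using K by auto
    have "cinner v ((dag T * T) *\<^sub>v v) = cinner (mvec n (H * C)) (mvec n (H * C))"
      using T by (simp add: cinner_dag_mult W(2) TW[OF W(1)] K_def C_def)
    also have "\<dots> = mtrace (dag (H * C) * (H * C))"
      using c C by (intro cinner_mvec) auto
    also have "\<dots> = mtrace (dag C * (X * C))"
      using d by (simp add: dag_mult psd_dag[OF H] mult_assoc_dim HH[symmetric])
    also have "\<dots> = mtrace ((X * C) * dag C)" using d by (intro mtrace_cyclic) auto
    also have "\<dots> = mtrace (X * (C * dag C))" using d by (simp add: mult_assoc_dim)
    also have "\<dots> = mtrace ((C * dag C) * X)" using d by (intro mtrace_cyclic) auto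
    finally have "Re (cinner v ((dag T * T) *\<^sub>v v)) = Re (mtrace ((C * dag C) * X))" by simp
    also have "\<dots> \<le> Re (mtrace (\<Phi>adj (K * dag K) * X))"
      by (rule mtrace_mono[OF KK X]) (use C adj_dim[OF KKc] in auto)
    also have "mtrace (\<Phi>adj (K * dag K) * X) = mtrace (K * dag K * B)"
      unfolding B_def by (rule mtrace_adj[OF KKc c(1)])
    also have "\<dots> = mtrace ((R * W) * (dag W * R * B))"
      using d by (simp add: K_def dag_mult psd_dag[OF R] mult_assoc_dim)
    also have "\<dots> = mtrace ((dag W * R * B) * (R * W))" using d by (intro mtrace_cyclic) auto
    also have "\<dots> = mtrace (dag W * (R * B * R) * W)" using d by (simp add: mult_assoc_dim)
    also have "R * B * R = P" using RBR by (simp add: B_def)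
    also have "Re (mtrace (dag W * P * W)) \<le> Re (mtrace (dag W * W))"
      using mtrace_psd[OF psd_conj[OF P1 W(1)]] d
      by (simp add: mat_alg mult_one_left mtrace_minus)
    also have "mtrace (dag W * W) = cinner v (1\<^sub>m (m * m) *\<^sub>v v)"
      using v by (simp add: W(2) cinner_mvec[OF W(1) W(1)])
    finally show "Re (cinner v ((dag T * T) *\<^sub>v v)) \<le> Re (cinner v (1\<^sub>m (m * m) *\<^sub>v v))" .
  qed
  have "T *\<^sub>v phivec B = mvec n (H * \<Phi>adj P)"
    using TW[OF psd_carrier[OF psd_sqrtm[OF B]]] RS by (simp add: phivec_mvec[OF B[unfolded B_def]] B_def)
  \<comment> \<open>If \<open>B\<close> is singular, \<open>P\<close> is not the identity, but
    \<open>X\<close> is orthogonal to \<open>\<Phi>adj (1 - P)\<close>: by adjointness the trace of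
    their product is that of \<open>(1 - P) * B\<close>, which is 0.\<close>
  also have "H * \<Phi>adj P = H"
  proof -
    have N: "psd n (\<Phi>adj (1\<^sub>m m - P))" by (rule adj_psd[OF P1])
    have "mtrace (X * \<Phi>adj (1\<^sub>m m - P)) = mtrace (\<Phi>adj (1\<^sub>m m - P) * X)"
      using d psd_dims[OF N] by (intro mtrace_cyclic) auto
    also have "\<dots> = mtrace ((1\<^sub>m m - P) * B)"
      unfolding B_def by (rule mtrace_adj[OF psd_carrier[OF P1] c(1)])
    also have "\<dots> = mtrace (B * (1\<^sub>m m - P))" using d by (intro mtrace_cyclic) auto
    also have "\<dots> = 0" using d BP by (simp add: mult_minus_right_dim mult_one_right mtrace_minus B_def)
    finally have "H * \<Phi>adj (1\<^sub>m m - P) = 0\<^sub>m n n"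
      unfolding H_def by (intro psd_mult_eq_0[OF X N]) simp
    hence z: "H - H * \<Phi>adj P = 0\<^sub>m n n"
      using d P adj_dim[OF P] by (simp add: adj_minus adj_one mult_minus_right_dim mult_one_right)
    have "H $$ (i,j) = (H * \<Phi>adj P) $$ (i,j)" if "i < n" "j < n" for i j
    proof -
      have "(H - H * \<Phi>adj P) $$ (i,j) = 0" unfolding z using that by simp
      thus ?thesis using that d adj_dim[OF P] by (simp del: index_mult_mat(1))
    qed
    thus ?thesis using d adj_dim[OF P] by (intro eq_matI) (auto simp del: index_mult_mat(1))
  qed
  finally have Tphi: "T *\<^sub>v phivec (\<Phi> X) = phivec X" by (simp add: phivec_mvec[OF X] H_def B_def)
  show ?thesis by (rule that[OF T _ contr Tphi]) (simp add: TW[unfolded H_def])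
qed

text \<open>The regularised Petz image of \<tau>. The final bound chains three inequalities:
  \<open>minv_perturbed_le\<close> for \<open>H\<close>, the Schwarz inequality for
  \<open>\<Phi>adj\<close>, and \<open>minv_perturbed_le\<close> for \<open>R\<close>;
  \<open>Z\<close> is carried through by monotonicity of the trace and adjointness.\<close>

lemma pullback_state:
  assumes X: "psd n X" and R: "psd m R" and P: "P \<in> carrier_mat m m"
    and RBR: "R * \<Phi> X * R = P" and P1: "psd m (1\<^sub>m m - P)"
    and tau: "pd m \<tau>" and k: "k > 0"
  obtains \<omega> where "pd n \<omega>"
    "Re (mtrace \<omega>) \<le> Re (mtrace \<tau>) + k * (Re (mtrace X) + real n)"
    "\<And>W Z. W \<in> carrier_mat m m \<Longrightarrow> psd n Z \<Longrightarrow>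
      Re (mtrace (dag (sqrtm X * \<Phi>adj (R * W)) * minv \<omega> * (sqrtm X * \<Phi>adj (R * W)) * Z))
      \<le> Re (mtrace (dag W * minv \<tau> * W * \<Phi> Z))"
proof -
  define H where "H = sqrtm X"
  define B where "B = \<Phi> X"
  have H: "psd n H" unfolding H_def by (rule psd_sqrtm[OF X])
  have HH: "H * H = X" unfolding H_def by (rule sqrtm_square[OF X])
  have B: "psd m B" unfolding B_def by (rule \<Phi>_pos[OF X])
  \<comment> \<open>\<open>R * \<tau> * R\<close> is singular whenever \<open>\<Phi> X\<close> is,
    but the Schwarz inequality needs a positive definite argument.\<close>
  define \<sigma> where "\<sigma> = R * \<tau> * dag R + complex_of_real k \<cdot>\<^sub>m 1\<^sub>m m"
  have s: "pd m \<sigma>" and s_le: "psd m (minv \<tau> - dag R * minv \<sigma> * R)"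
    unfolding \<sigma>_def using minv_perturbed_le[OF tau psd_carrier[OF R] k] by auto
  \<comment> \<open>The same \<open>k\<close> regularises a second time, now because
    \<open>X\<close> may be singular; together the two shifts add at most \<open>k\<close> times
    \<open>Re (mtrace X) + real n\<close> to the trace.\<close>
  define \<omega> where "\<omega> = H * \<Phi>adj \<sigma> * dag H + complex_of_real k \<cdot>\<^sub>m 1\<^sub>m n"
  have as: "pd n (\<Phi>adj \<sigma>)" by (rule adj_pd[OF s])
  have w: "pd n \<omega>" and w_le: "psd n (minv (\<Phi>adj \<sigma>) - dag H * minv \<omega> * H)"
    unfolding \<omega>_def using minv_perturbed_le[OF as psd_carrier[OF H] k] by auto
  have Rd: "dag R = R" and Hd: "dag H = H" using psd_dag R H by auto
  note d = psd_dims[OF X] psd_dims[OF R] psd_dims[OF H] psd_dims[OF B] carrier_matD[OF P]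
    pd_dims[OF tau] pd_dims[OF s] pd_dims[OF w] pd_dims[OF as]
    pd_dims[OF pd_minv[OF tau]] pd_dims[OF pd_minv[OF s]] pd_dims[OF pd_minv[OF w]] pd_dims[OF pd_minv[OF as]]
  show ?thesis
  proof (rule that[OF w])
    have "mtrace (H * \<Phi>adj \<sigma> * H) = mtrace (\<sigma> * B)"
    proof -
      have "mtrace ((H * \<Phi>adj \<sigma>) * H) = mtrace (H * (H * \<Phi>adj \<sigma>))" using d by (intro mtrace_cyclic) auto
      also have "\<dots> = mtrace (X * \<Phi>adj \<sigma>)" using d by (simp add: mult_assoc_dim[symmetric] HH)
      also have "\<dots> = mtrace (\<Phi>adj \<sigma> * X)" using d by (intro mtrace_cyclic) auto
      also have "\<dots> = mtrace (\<sigma> * B)"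
        unfolding B_def by (rule mtrace_adj[OF pd_carrier[OF s] psd_carrier[OF X]])
      finally show ?thesis .
    qed
    moreover have "mtrace (\<sigma> * B) = mtrace (\<tau> * P) + complex_of_real k * mtrace X"
    proof -
      have "mtrace (R * (\<tau> * R * B)) = mtrace ((\<tau> * R * B) * R)" using d by (intro mtrace_cyclic) auto
      also have "\<dots> = mtrace (\<tau> * (R * B * R))" using d by (simp add: mult_assoc_dim)
      also have "R * B * R = P" using RBR by (simp add: B_def)
      finally have "mtrace (R * (\<tau> * R * B)) = mtrace (\<tau> * P)" .
      moreover have "mtrace B = mtrace X" unfolding B_def by (rule \<Phi>_tp[OF psd_carrier[OF X]])
      ultimately show ?thesis
        using d by (simp add: \<sigma>_def Rd mat_alg mult_one_left mtrace_add mtrace_smult)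
    qed
    moreover have "mtrace \<omega> = mtrace (H * \<Phi>adj \<sigma> * H) + complex_of_real k * of_nat n"
      using d by (simp add: \<omega>_def Hd mtrace_add mtrace_smult mtrace_one)
    moreover have "0 \<le> Re (mtrace \<tau>) - Re (mtrace (\<tau> * P))"
      using mtrace_psd_mult[OF pd_psd[OF tau] P1] d
      by (simp add: mult_minus_right_dim mult_one_right mtrace_minus)
    ultimately show "Re (mtrace \<omega>) \<le> Re (mtrace \<tau>) + k * (Re (mtrace X) + real n)"
      by (simp add: algebra_simps)
  next
    fix W Z :: "complex mat" assume W: "W \<in> carrier_mat m m" and Z: "psd n Z"
    define K where "K = R * W"
    have K: "K \<in> carrier_mat m m" using W d by (auto simp: K_def intro: carrier_matI)
    define C where "C = \<Phi>adj K"
    have C: "C \<in> carrier_mat n n" unfolding C_def by (rule adj_dim[OF K])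
    have FZ: "psd m (\<Phi> Z)" by (rule \<Phi>_pos[OF Z])
    note d = d carrier_matD[OF K] carrier_matD[OF C] carrier_matD[OF W] psd_dims[OF Z] psd_dims[OF FZ]
    have KsK: "dag K * minv \<sigma> * K \<in> carrier_mat m m" using d by (intro carrier_matI) auto
    have 1: "psd n (dag C * minv (\<Phi>adj \<sigma>) * C - dag C * (dag H * minv \<omega> * H) * C)"
      using psd_conj[OF w_le C] d by (simp add: mult_minus_left_dim mult_minus_right_dim)
    have 2: "psd n (\<Phi>adj (dag K * minv \<sigma> * K) - dag C * minv (\<Phi>adj \<sigma>) * C)"
      unfolding C_def by (rule adj_schwarz[OF K s])
    have 3: "psd m (dag W * minv \<tau> * W - dag W * (dag R * minv \<sigma> * R) * W)"
      using psd_conj[OF s_le W] d by (simp add: mult_minus_left_dim mult_minus_right_dim)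
    have "dag (H * C) * minv \<omega> * (H * C) = dag C * (dag H * minv \<omega> * H) * C"
      using d by (simp add: dag_mult mult_assoc_dim)
    hence "Re (mtrace (dag (H * C) * minv \<omega> * (H * C) * Z)) = Re (mtrace ((dag C * (dag H * minv \<omega> * H) * C) * Z))"
      by simp
    also have "\<dots> \<le> Re (mtrace ((dag C * minv (\<Phi>adj \<sigma>) * C) * Z))"
      by (intro mtrace_mono[OF 1 Z] carrier_matI) (use d in simp_all)
    also have "\<dots> \<le> Re (mtrace (\<Phi>adj (dag K * minv \<sigma> * K) * Z))"
      by (intro mtrace_mono[OF 2 Z] adj_dim[OF KsK] carrier_matI) (use d in simp_all)
    also have "mtrace (\<Phi>adj (dag K * minv \<sigma> * K) * Z) = mtrace (dag K * minv \<sigma> * K * \<Phi> Z)"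
      by (rule mtrace_adj[OF KsK psd_carrier[OF Z]])
    also have "dag K * minv \<sigma> * K = dag W * (dag R * minv \<sigma> * R) * W"
      using d by (simp add: K_def dag_mult mult_assoc_dim)
    also have "Re (mtrace (dag W * (dag R * minv \<sigma> * R) * W * \<Phi> Z)) \<le> Re (mtrace (dag W * minv \<tau> * W * \<Phi> Z))"
      by (intro mtrace_mono[OF 3 FZ] carrier_matI) (use d in simp_all)
    finally show "Re (mtrace (dag (sqrtm X * \<Phi>adj (R * W)) * minv \<omega> * (sqrtm X * \<Phi>adj (R * W)) * Z))
      \<le> Re (mtrace (dag W * minv \<tau> * W * \<Phi> Z))"
      by (simp add: H_def C_def K_def)
  qed
qed

text \<open>Every competitor in the supremum for the images is matched, up to \<open>e\<close>, by
  one in the supremum for \<open>X\<close> and \<open>Y\<close>. The order of choices matters: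
  \<open>r\<close> comes from right continuity, \<open>a\<close> from \<open>r\<close>, and
  \<open>k\<close>, \<delta>, \<open>g\<close> from \<open>a\<close>.\<close>

lemma Qtau_approx:
  assumes f: "operator_antimonotone f" and X: "psd n X" and Y: "psd n Y"
    and tau: "pd m \<tau>" "Re (mtrace \<tau>) \<le> 1" and eps: "\<epsilon> > 0" and e: "e > 0"
  obtains \<omega> \<delta> where "pd n \<omega>" "Re (mtrace \<omega>) \<le> 1" "\<delta> > 0"
    "Qtau f (\<Phi> X) (\<Phi> Y + complex_of_real \<epsilon> \<cdot>\<^sub>m kerproj (\<Phi> Y)) \<tau>
      \<le> Qtau f X (Y + complex_of_real \<delta> \<cdot>\<^sub>m kerproj Y) \<omega> + e"
proof -
  define B where "B = \<Phi> X"
  have B: "psd m B" unfolding B_def by (rule \<Phi>_pos[OF X])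
  have FY: "psd m (\<Phi> Y)" by (rule \<Phi>_pos[OF Y])
  define ZB where "ZB = \<Phi> Y + complex_of_real \<epsilon> \<cdot>\<^sub>m kerproj (\<Phi> Y)"
  have ZB: "pd m ZB" unfolding ZB_def by (rule pd_add_kerproj[OF FY eps])
  define D where "D = kron (minv \<tau>) (transpose_mat ZB)"
  have D: "pd (m * m) D" unfolding D_def by (rule pd_kron[OF pd_minv[OF tau(1)] ZB])
  define v where "v = phivec B"
  have v: "v \<in> carrier_vec (m * m)" by (simp add: v_def phivec_mvec[OF B] mvec_carrier)
  obtain r where r: "r > 1" 
    "Re (cinner v (matfun f D *\<^sub>v v)) - e < Re (cinner v (matfun f (complex_of_real r \<cdot>\<^sub>m D) *\<^sub>v v))"
  proof -
    have "eventually (\<lambda>r. Re (cinner v (matfun f D *\<^sub>v v)) - e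
        < Re (cinner v (matfun f (complex_of_real r \<cdot>\<^sub>m D) *\<^sub>v v))) (at_right 1)"
      by (rule order_tendstoD(1)[OF matfun_quad_right_tendsto[OF f D v]]) (use e in simp)
    then obtain b where "b > 1" "\<And>y. 1 < y \<Longrightarrow> y < b \<Longrightarrow> Re (cinner v (matfun f D *\<^sub>v v)) - e
        < Re (cinner v (matfun f (complex_of_real y \<cdot>\<^sub>m D) *\<^sub>v v))"
      unfolding eventually_at_right_field by blast
    thus ?thesis using that[of "(1 + b) / 2"] by (simp del: of_real_divide of_real_add)
  qed
  \<comment> \<open>One factor \<open>1 + a\<close> pays for normalising the trace of
    \<open>w\<close>, the other for the kernel term of \<open>Y\<close>, and the additional
    \<open>a\<close> for the slack \<open>g\<close>. With \<open>a \<le> 1\<close> the sum is at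
    most \<open>1 + 4 * a\<close>, hence the 4.\<close>
  define a where "a = min 1 ((r - 1) / 4)"
  have a: "a > 0" "(1 + a) * (1 + a) + a \<le> r"
  proof -
    show "a > 0" using r by (simp add: a_def)
    have "a * a \<le> a * 1" using r by (intro mult_left_mono) (auto simp: a_def)
    moreover have "a \<le> (r - 1) / 4" unfolding a_def by (rule min.cobounded2)
    ultimately show "(1 + a) * (1 + a) + a \<le> r" by (simp add: algebra_simps)
  qed
  obtain R P where RP: "psd m R" "P \<in> carrier_mat m m" "R * sqrtm B = P" "R * B * R = P"
    "B * P = B" "psd m (1\<^sub>m m - P)" using psd_pinv_sqrt[OF B] .
  obtain T where T: "T \<in> carrier_mat (n * n) (m * m)"
    "\<And>W. W \<in> carrier_mat m m \<Longrightarrow> T *\<^sub>v mvec m W = mvec n (sqrtm X * \<Phi>adj (R * W))"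
    "psd (m * m) (1\<^sub>m (m * m) - dag T * T)" "T *\<^sub>v phivec B = phivec X"
    using transfer_contraction[OF X RP(1,2) RP(3-5)[unfolded B_def] RP(6)] unfolding B_def by blast
  \<comment> \<open>Keeps the excess trace of \<open>w\<close> below \<open>a\<close>; the added 1
    keeps the denominator positive.\<close>
  define k where "k = a / (Re (mtrace X) + real n + 1)"
  have trX: "Re (mtrace X) \<ge> 0" by (rule mtrace_psd[OF X])
  have k: "k > 0" "k * (Re (mtrace X) + real n) \<le> a"
    using a(1) trX by (auto simp: k_def field_simps)
  obtain w where w: "pd n w" "Re (mtrace w) \<le> Re (mtrace \<tau>) + k * (Re (mtrace X) + real n)"
    "\<And>W Z. W \<in> carrier_mat m m \<Longrightarrow> psd n Z \<Longrightarrow>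
      Re (mtrace (dag (sqrtm X * \<Phi>adj (R * W)) * minv w * (sqrtm X * \<Phi>adj (R * W)) * Z))
      \<le> Re (mtrace (dag W * minv \<tau> * W * \<Phi> Z))"
    using pullback_state[OF X RP(1,2) RP(4)[unfolded B_def] RP(6) tau(1) k(1)] by blast
  define \<omega> where "\<omega> = complex_of_real (1 / (1 + a)) \<cdot>\<^sub>m w"
  have om: "pd n \<omega>" unfolding \<omega>_def using a by (intro pd_smult[OF w(1)]) simp
  have "Re (mtrace w) \<le> 1 + a" using w(2) k(2) tau(2) by linarith
  hence om_tr: "Re (mtrace \<omega>) \<le> 1"
    using a pd_dims[OF w(1)] by (simp add: \<omega>_def mtrace_smult field_simps)
  have om_inv: "minv \<omega> = complex_of_real (1 + a) \<cdot>\<^sub>m minv w"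
    unfolding \<omega>_def using minv_smult[OF w(1), of "1 / (1 + a)"] a by simp
  note KY = kerproj_props(1)[OF Y]
  \<comment> \<open>\<open>\<Phi> (kerproj Y)\<close> is in general unrelated to
    \<open>kerproj (\<Phi> Y)\<close>, so \<delta> is taken so small that positive definiteness of
    \<open>ZB\<close> absorbs it.\<close>
  obtain \<delta> where del: "\<delta> > 0" "psd m (complex_of_real a \<cdot>\<^sub>m ZB - complex_of_real \<delta> \<cdot>\<^sub>m \<Phi> (kerproj Y))"
    using pd_absorb[OF pd_smult[OF ZB a(1)] psd_hermitian[OF \<Phi>_pos[OF KY]]] .
  define Z where "Z = Y + complex_of_real \<delta> \<cdot>\<^sub>m kerproj Y"
  have Z: "pd n Z" unfolding Z_def by (rule pd_add_kerproj[OF Y del(1)])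
  have FZ: "psd m (\<Phi> Z)" by (rule \<Phi>_pos[OF pd_psd[OF Z]])
  note KFY = kerproj_props(1)[OF FY]
  have ZZ: "psd m (complex_of_real (1 + a) \<cdot>\<^sub>m ZB - \<Phi> Z)"
  proof -
    have "\<Phi> Z = \<Phi> Y + complex_of_real \<delta> \<cdot>\<^sub>m \<Phi> (kerproj Y)"
      using psd_carrier[OF Y] psd_carrier[OF KY] by (simp add: Z_def \<Phi>_add \<Phi>_smult)
    hence "complex_of_real (1 + a) \<cdot>\<^sub>m ZB - \<Phi> Z = complex_of_real \<epsilon> \<cdot>\<^sub>m kerproj (\<Phi> Y)
      + (complex_of_real a \<cdot>\<^sub>m ZB - complex_of_real \<delta> \<cdot>\<^sub>m \<Phi> (kerproj Y))"
      using psd_dims[OF FY] psd_dims[OF KFY] psd_dims[OF \<Phi>_pos[OF KY]] pd_dims[OF ZB]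
      by (intro eq_matI) (auto simp: ZB_def algebra_simps)
    moreover have "psd m \<dots>" by (intro psd_add psd_smult[OF KFY] del(2)) (use eps in simp)
    ultimately show ?thesis by simp
  qed
  define A where "A = kron (minv \<omega>) (transpose_mat Z)"
  have A: "pd (n * n) A" unfolding A_def by (rule pd_kron[OF pd_minv[OF om] Z])
  obtain g where g: "g > 0" "psd (m * m) (complex_of_real a \<cdot>\<^sub>m D - complex_of_real g \<cdot>\<^sub>m 1\<^sub>m (m * m))"
    using pd_absorb[OF pd_smult[OF D a(1)] hermitian_one] .
  have TAT: "psd (m * m) (dag T * A * T)" by (rule psd_conj[OF pd_psd[OF A] T(1)])
  have le1: "psd (m * m) (complex_of_real ((1 + a) * (1 + a)) \<cdot>\<^sub>m D - dag T * A * T)"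
  proof (rule psd_quad_mono)
    show "hermitian (m * m) (dag T * A * T)" by (rule psd_hermitian[OF TAT])
    show "hermitian (m * m) (complex_of_real ((1 + a) * (1 + a)) \<cdot>\<^sub>m D)"
      by (rule hermitian_smult[OF pd_hermitian[OF D]])
    fix u :: "complex vec" assume u: "u \<in> carrier_vec (m * m)"
    obtain W where W: "W \<in> carrier_mat m m" "u = mvec m W" using mvec_surj[OF u] .
    define C where "C = sqrtm X * \<Phi>adj (R * W)"
    have RW: "R * W \<in> carrier_mat m m" using psd_carrier[OF RP(1)] W by auto
    have C: "C \<in> carrier_mat n n"
      unfolding C_def using psd_carrier[OF psd_sqrtm[OF X]] adj_dim[OF RW] by auto
    note d = carrier_matD[OF C] carrier_matD[OF W(1)] pd_dims[OF pd_minv[OF w(1)]] pd_dims[OF pd_minv[OF tau(1)]]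
      pd_dims[OF Z] pd_dims[OF ZB] psd_dims[OF FZ] pd_dims[OF A] pd_dims[OF D] carrier_matD[OF T(1)]
    have "cinner u ((dag T * A * T) *\<^sub>v u) = cinner (T *\<^sub>v u) (A *\<^sub>v (T *\<^sub>v u))"
      using d u by (intro quad_conj) auto
    also have "T *\<^sub>v u = mvec n C" unfolding W(2) C_def by (rule T(2)[OF W(1)])
    also have "cinner (mvec n C) (A *\<^sub>v mvec n C) = mtrace (dag C * minv \<omega> * C * Z)"
      unfolding A_def by (rule kron_quad[OF pd_carrier[OF pd_minv[OF om]] pd_carrier[OF Z] C])
    also have "\<dots> = complex_of_real (1 + a) * mtrace (dag C * minv w * C * Z)"
      using d by (simp add: om_inv mult_smult_left_dim mult_smult_right_dim mtrace_smult)
    finally have "Re (cinner u ((dag T * A * T) *\<^sub>v u)) = (1 + a) * Re (mtrace (dag C * minv w * C * Z))"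
      by simp
    also have "\<dots> \<le> (1 + a) * Re (mtrace (dag W * minv \<tau> * W * \<Phi> Z))"
      unfolding C_def using a by (intro mult_left_mono w(3)[OF W(1) pd_psd[OF Z]]) simp
    also have "\<dots> \<le> (1 + a) * Re (mtrace (dag W * minv \<tau> * W * (complex_of_real (1 + a) \<cdot>\<^sub>m ZB)))"
    proof -
      have "0 \<le> Re (mtrace ((dag W * minv \<tau> * W) * (complex_of_real (1 + a) \<cdot>\<^sub>m ZB - \<Phi> Z)))"
        by (rule mtrace_psd_mult[OF psd_conj[OF pd_psd[OF pd_minv[OF tau(1)]] W(1)] ZZ])
      thus ?thesis using d a by (intro mult_left_mono) (simp_all add: mult_minus_right_dim mtrace_minus)
    qed
    also have "\<dots> = (1 + a) * (1 + a) * Re (mtrace (dag W * minv \<tau> * W * ZB))"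
      using d by (simp add: mult_smult_right_dim mtrace_smult algebra_simps)
    also have "mtrace (dag W * minv \<tau> * W * ZB) = cinner u (D *\<^sub>v u)"
      unfolding D_def W(2) by (rule kron_quad[symmetric, OF pd_carrier[OF pd_minv[OF tau(1)]] pd_carrier[OF ZB] W(1)])
    also have "(1 + a) * (1 + a) * Re (cinner u (D *\<^sub>v u))
        = Re (cinner u ((complex_of_real ((1 + a) * (1 + a)) \<cdot>\<^sub>m D) *\<^sub>v u))"
      using d u by (simp add: smult_mult_vec_dim cinner_smult_right del: of_real_mult of_real_add)
    finally show "Re (cinner u ((dag T * A * T) *\<^sub>v u))
        \<le> Re (cinner u ((complex_of_real ((1 + a) * (1 + a)) \<cdot>\<^sub>m D) *\<^sub>v u))" .
  qed
  have le: "psd (m * m) (complex_of_real r \<cdot>\<^sub>m D - (dag T * A * T + complex_of_real g \<cdot>\<^sub>m 1\<^sub>m (m * m)))"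
  proof -
    have "complex_of_real r \<cdot>\<^sub>m D - (dag T * A * T + complex_of_real g \<cdot>\<^sub>m 1\<^sub>m (m * m)) =
      (complex_of_real ((1 + a) * (1 + a)) \<cdot>\<^sub>m D - dag T * A * T)
      + (complex_of_real a \<cdot>\<^sub>m D - complex_of_real g \<cdot>\<^sub>m 1\<^sub>m (m * m))
      + complex_of_real (r - ((1 + a) * (1 + a) + a)) \<cdot>\<^sub>m D"
      using pd_dims[OF D] psd_dims[OF TAT]
      by (intro eq_matI) (auto simp: algebra_simps simp del: index_mult_mat(1))
    moreover have "psd (m * m) \<dots>"
      by (intro psd_add le1 g(2) psd_smult[OF pd_psd[OF D]]) (use a(2) in simp)
    ultimately show ?thesis by simp
  qed
  \<comment> \<open>The two squared norms are the traces of \<open>X\<close> and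
    \<open>\<Phi> X\<close>, equal by trace preservation.\<close>
  have iso: "Re (cinner (T *\<^sub>v v) (T *\<^sub>v v)) = Re (cinner v v)"
  proof -
    have q: "cinner (phivec M) (phivec M) = mtrace M" if "psd j M" for j M
      using psd_carrier[OF psd_sqrtm[OF that]]
      by (simp add: phivec_mvec[OF that] cinner_mvec psd_dag[OF psd_sqrtm[OF that]] sqrtm_square[OF that])
    show ?thesis
      unfolding v_def T(4) q[OF X] q[OF B] unfolding B_def by (simp add: \<Phi>_tp[OF psd_carrier[OF X]])
  qed
  have "Re (cinner v (matfun f (complex_of_real r \<cdot>\<^sub>m D) *\<^sub>v v))
      \<le> Re (cinner (T *\<^sub>v v) (matfun f A *\<^sub>v (T *\<^sub>v v)))"
    by (rule operator_jensen_contraction[OF f A _ T(1,3) g(1) le v iso]) (use pd_carrier[OF D] in auto)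
  with r(2) have "Re (cinner v (matfun f D *\<^sub>v v)) \<le> Re (cinner (phivec X) (matfun f A *\<^sub>v phivec X)) + e"
    by (simp add: v_def T(4))
  hence "Qtau f B ZB \<tau> \<le> Qtau f X Z \<omega> + e"
    by (simp add: Qtau_def D_def A_def v_def)
  thus ?thesis using that[OF om om_tr del(1)] by (simp add: B_def ZB_def Z_def)
qed

theorem Qopt_monotone:
  assumes f: "operator_antimonotone f" and X: "psd n X" and Y: "psd n Y"
  shows "Qopt f (\<Phi> X) (\<Phi> Y) \<le> Qopt f X Y"
proof -
  have d: "dim_row X = n" "dim_row (\<Phi> X) = m"
    using psd_dims[OF X] psd_dims[OF \<Phi>_pos[OF X]] by auto
  show ?thesis unfolding Qopt_def Let_def d
  proof (rule SUP_least)
    fix p :: "complex mat \<times> real" assume p: "p \<in> {(\<tau>, \<epsilon>). pd m \<tau> \<and> Re (mtrace \<tau>) \<le> 1 \<and> \<epsilon> > 0}"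
    obtain \<tau> \<epsilon> where te: "p = (\<tau>, \<epsilon>)" "pd m \<tau>" "Re (mtrace \<tau>) \<le> 1" "\<epsilon> > 0" using p by auto
    let ?S = "SUP p\<in>{(\<tau>, \<epsilon>). pd n \<tau> \<and> Re (mtrace \<tau>) \<le> 1 \<and> 0 < \<epsilon>}.
        ereal (Qtau f X (Y + complex_of_real (snd p) \<cdot>\<^sub>m kerproj Y) (fst p))"
    have "ereal (Qtau f (\<Phi> X) (\<Phi> Y + complex_of_real \<epsilon> \<cdot>\<^sub>m kerproj (\<Phi> Y)) \<tau>) \<le> ?S"
    \<comment> \<open>The matching competitor depends on \<open>e\<close>, but the supremum over all
      of them does not, so \<open>e\<close> can tend to 0.\<close>
    proof (rule ereal_le_epsilon2)
      fix e :: real assume e: "0 < e"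
      obtain \<omega> \<delta> where o: "pd n \<omega>" "Re (mtrace \<omega>) \<le> 1" "\<delta> > 0"
        "Qtau f (\<Phi> X) (\<Phi> Y + complex_of_real \<epsilon> \<cdot>\<^sub>m kerproj (\<Phi> Y)) \<tau>
          \<le> Qtau f X (Y + complex_of_real \<delta> \<cdot>\<^sub>m kerproj Y) \<omega> + e"
        using Qtau_approx[OF f X Y te(2,3,4) e] .
      have "ereal (Qtau f (\<Phi> X) (\<Phi> Y + complex_of_real \<epsilon> \<cdot>\<^sub>m kerproj (\<Phi> Y)) \<tau>)
         \<le> ereal (Qtau f X (Y + complex_of_real \<delta> \<cdot>\<^sub>m kerproj Y) \<omega>) + ereal e" using o(4) by simp
      also have "ereal (Qtau f X (Y + complex_of_real \<delta> \<cdot>\<^sub>m kerproj Y) \<omega>) \<le> ?S"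
        by (rule SUP_upper2[of "(\<omega>, \<delta>)"]) (use o in auto)
      finally show "ereal (Qtau f (\<Phi> X) (\<Phi> Y + complex_of_real \<epsilon> \<cdot>\<^sub>m kerproj (\<Phi> Y)) \<tau>) \<le> ?S + ereal e"
        by (simp add: add_right_mono)
    qed
    thus "ereal (Qtau f (\<Phi> X) (\<Phi> Y + complex_of_real (snd p) \<cdot>\<^sub>m kerproj (\<Phi> Y)) (fst p)) \<le> ?S"
      by (simp add: te(1))
  qed
qed

end

theorem mainTheorem2:
  fixes n m :: nat
    and \<Phi> :: "complex mat \<Rightarrow> complex mat"
    and \<Phi>adj :: "complex mat \<Rightarrow> complex mat"
    and f :: "real \<Rightarrow> real"
    and X Y :: "complex mat"
  assumes \<Phi>_dim: "\<And>A. A \<in> carrier_mat n n \<Longrightarrow> \<Phi> A \<in> carrier_mat m m"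
    and \<Phi>_add: "\<And>A B. A \<in> carrier_mat n n \<Longrightarrow> B \<in> carrier_mat n n \<Longrightarrow> \<Phi> (A + B) = \<Phi> A + \<Phi> B"
    and \<Phi>_smult: "\<And>c A. A \<in> carrier_mat n n \<Longrightarrow> \<Phi> (c \<cdot>\<^sub>m A) = c \<cdot>\<^sub>m \<Phi> A"
    and \<Phi>_pos: "\<And>A. psd n A \<Longrightarrow> psd m (\<Phi> A)"
    and \<Phi>_tp: "\<And>A. A \<in> carrier_mat n n \<Longrightarrow> mtrace (\<Phi> A) = mtrace A"
    and adj_dim: "\<And>B. B \<in> carrier_mat m m \<Longrightarrow> \<Phi>adj B \<in> carrier_mat n n"
    and adj: "\<And>A B. A \<in> carrier_mat n n \<Longrightarrow> B \<in> carrier_mat m m \<Longrightarrow>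
               mtrace (dag B * \<Phi> A) = mtrace (dag (\<Phi>adj B) * A)"
    and schwarz: "\<And>\<rho> \<sigma>. \<rho> \<in> carrier_mat m m \<Longrightarrow> pd m \<sigma> \<Longrightarrow>
               loewner_le n (\<Phi>adj (dag \<rho>) * minv (\<Phi>adj \<sigma>) * \<Phi>adj \<rho>)
                            (\<Phi>adj (dag \<rho> * minv \<sigma> * \<rho>))"
    and f_anti: "operator_antimonotone f"
    and X: "psd n X" and Y: "psd n Y"
  shows "Qopt f X Y \<ge> Qopt f (\<Phi> X) (\<Phi> Y)"
proof -
  interpret schwarz_map n m \<Phi> \<Phi>adj
    by (standard; fact assms)
  show ?thesis by (rule Qopt_monotone[OF f_anti X Y])
qed

end
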